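(* There is a universal constant $c_1$ such that the following holds. Let $G=(V,E)$ be an $r$-regular graph on $n$ vertices, let $\{\mathbf x_v\}_{v\in V}$ be any sequence of vectors, and let $\epsilon,\delta>0$. If $$\lambda_k> c_1\cdot\log^2 k\cdot\mathcal E(d^2_{\mathbf x})\cdot\frac{\log^2(1/\epsilon)}{\epsilon^3\delta},$$ then there are $2k$ sets $T_1,\dots,T_{2k}\subseteq V$ with $\mathrm{diam}(T_i,d^2_{\mathbf x})\le\delta$ for all $i$ covering at least a $1-\epsilon$ fraction of the vertices. Furthermore, these sets can be found by a randomized polynomial-time algorithm.
   Context: $\lambda_k$ is the $k$-th smallest eigenvalue of the normalized Laplacian $I-A/r$ of $G$. $d^2_{\mathbf x}(u,v)=\|\mathbf x_u-\mathbf x_v\|^2$. For a function $d$ on pairs of vertices, $\mathcal E(d)=\frac{1}{2rn}\sum_{(u,v)\in E}d(u,v)$ and $\mathrm{diam}(S,d)=\max_{u,v\in S}d(u,v)$.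
   Formalization: The claim is proved for ε ≤ 1/2: for ε near 1 it is false as stated, since log²(1/ε) tends to 0 (complete graphs, orthonormal vectors, k = 2, δ = 1); the algorithm takes rational vectors, ε and δ as input. *)

theory Defs
  imports
    "HOL-Library.Log_Nat"
    "HOL-Computational_Algebra.Computational_Algebra"
    "HOL-Probability.Probability_Mass_Function"
    "Jordan_Normal_Form.Char_Poly"
begin

section \<open>Graphs, eigenvalues, energy and diameter\<close>

text \<open>The vertex set of a graph on \<open>n\<close> vertices is \<open>{..<n}\<close>. The edge set \<open>E\<close> of an
  undirected simple graph is a symmetric irreflexive relation, so every edge occurs in it in both
  orientations. Degree 0 is excluded, since \<open>I - A/r\<close> and \<open>1/(2rn)\<close> need \<open>r > 0\<close>.\<close>

definition regular_graph :: "nat \<Rightarrow> nat \<Rightarrow> (nat \<times> nat) set \<Rightarrow> bool" where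
  "regular_graph n r E \<longleftrightarrow>
     0 < r \<and> E \<subseteq> {..<n} \<times> {..<n} \<and> sym E \<and> irrefl E \<and> (\<forall>u<n. card (E `` {u}) = r)"

definition adjacency_matrix :: "nat \<Rightarrow> (nat \<times> nat) set \<Rightarrow> real mat" where
  "adjacency_matrix n E = mat n n (\<lambda>(u, v). if (u, v) \<in> E then 1 else 0)"

definition normalized_laplacian :: "nat \<Rightarrow> nat \<Rightarrow> (nat \<times> nat) set \<Rightarrow> real mat" where
  "normalized_laplacian n r E = 1\<^sub>m n - (1 / real r) \<cdot>\<^sub>m adjacency_matrix n E"

text \<open>The \<open>k\<close>-th smallest eigenvalue (\<open>1 \<le> k \<le> n\<close>), counted with multiplicity. The matrix is real
  symmetric, so its characteristic polynomial has \<open>n\<close> real roots.\<close>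

definition laplacian_eigenvalue :: "nat \<Rightarrow> nat \<Rightarrow> (nat \<times> nat) set \<Rightarrow> nat \<Rightarrow> real" where
  "laplacian_eigenvalue n r E k =
     sorted_list_of_multiset (proots (char_poly (normalized_laplacian n r E))) ! (k - 1)"

definition sqdist :: "(nat \<Rightarrow> real vec) \<Rightarrow> nat \<Rightarrow> nat \<Rightarrow> real" where
  "sqdist x u v = scalar_prod (x u - x v) (x u - x v)"

text \<open>The sum runs over both orientations of every edge.\<close>

definition energy :: "nat \<Rightarrow> nat \<Rightarrow> (nat \<times> nat) set \<Rightarrow> (nat \<Rightarrow> nat \<Rightarrow> real) \<Rightarrow> real" where
  "energy n r E d = 1 / (2 * real r * real n) * (\<Sum>(u, v)\<in>E. d u v)"

definition diam :: "nat set \<Rightarrow> (nat \<Rightarrow> nat \<Rightarrow> real) \<Rightarrow> real" where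
  "diam S d = (if S = {} then 0 else Max {d u v | u v. u \<in> S \<and> v \<in> S})"

text \<open>The right-hand side is meaningful only for \<open>\<epsilon>\<close> bounded away from 1: the factor
  \<open>log\<^sup>2(1/\<epsilon>)\<close> vanishes as \<open>\<epsilon>\<close> tends to 1, and with \<open>\<epsilon>\<close> arbitrary in \<open>(0, 1)\<close> no constant
  \<open>c\<close> would make this condition sufficient for a cover, as complete graphs with orthonormal
  vectors and \<open>k = 2\<close>, \<open>\<delta> = 1\<close> show. It is used for \<open>\<epsilon> \<le> 1/2\<close>.\<close>

definition eigenvalue_large ::
    "real \<Rightarrow> nat \<Rightarrow> nat \<Rightarrow> (nat \<times> nat) set \<Rightarrow> nat \<Rightarrow> (nat \<Rightarrow> real vec) \<Rightarrow> real \<Rightarrow> real \<Rightarrow> bool" where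
  "eigenvalue_large c n r E k x \<epsilon> \<delta> \<longleftrightarrow>
     laplacian_eigenvalue n r E k >
       c * (ln (real k))\<^sup>2 * energy n r E (sqdist x) * ((ln (1 / \<epsilon>))\<^sup>2 / (\<epsilon> ^ 3 * \<delta>))"

definition low_diameter_cover ::
    "nat \<Rightarrow> nat \<Rightarrow> (nat \<Rightarrow> real vec) \<Rightarrow> real \<Rightarrow> real \<Rightarrow> (nat \<Rightarrow> nat set) \<Rightarrow> bool" where
  "low_diameter_cover n k x \<epsilon> \<delta> T \<longleftrightarrow>
     (\<forall>i\<in>{1..2 * k}. T i \<subseteq> {..<n} \<and> diam (T i) (sqdist x) \<le> \<delta>) \<and>
     real (card (\<Union>i\<in>{1..2 * k}. T i)) \<ge> (1 - \<epsilon>) * real n"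


section \<open>Randomized polynomial time\<close>

text \<open>Programs of a probabilistic random access machine over the integers, with finitely many named
  registers and an indirectly addressed memory. Every executed instruction and every test costs one
  time unit. There is no multiplication and no other instruction that lengthens the binary
  representation of the stored numbers by more than one bit per step beyond the constants of the
  program; hence the number of steps is polynomially related to Turing machine time, as it would
  not be with unit-cost multiplication.\<close>

datatype com =
    Const nat int      \<comment> \<open>\<open>R i := c\<close>\<close>
  | Add nat nat nat    \<comment> \<open>\<open>R i := R j + R l\<close>\<close>
  | Sub nat nat nat    \<comment> \<open>\<open>R i := R j - R l\<close>\<close>
  | Half nat nat       \<comment> \<open>\<open>R i := R j div 2\<close>\<close>
  | Load nat nat       \<comment> \<open>\<open>R i := M (R j)\<close>\<close>
  | Store nat nat      \<comment> \<open>\<open>M (R i) := R j\<close>\<close>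
  | Flip nat           \<comment> \<open>\<open>R i :=\<close> a fair coin, 0 or 1\<close>
  | Seq com com
  | IfPos nat com com  \<comment> \<open>test \<open>R i > 0\<close>\<close>
  | WhilePos nat com   \<comment> \<open>test \<open>R i > 0\<close>\<close>

text \<open>A state consists of the registers, the memory and the coins not tossed yet. The relation
  \<open>exec c s t s'\<close> says that \<open>c\<close> started in \<open>s\<close> terminates in \<open>s'\<close> after \<open>t\<close> time units. There is
  no rule for tossing a coin when none is left. Memory addresses are natural numbers: a negative
  address means address 0.\<close>

type_synonym state = "(nat \<Rightarrow> int) \<times> (nat \<Rightarrow> int) \<times> bool list"

inductive exec :: "com \<Rightarrow> state \<Rightarrow> nat \<Rightarrow> state \<Rightarrow> bool" where
  Const: "exec (Const i c) (R, M, bs) 1 (R(i := c), M, bs)"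
| Add: "exec (Add i j l) (R, M, bs) 1 (R(i := R j + R l), M, bs)"
| Sub: "exec (Sub i j l) (R, M, bs) 1 (R(i := R j - R l), M, bs)"
| Half: "exec (Half i j) (R, M, bs) 1 (R(i := R j div 2), M, bs)"
| Load: "exec (Load i j) (R, M, bs) 1 (R(i := M (nat (R j))), M, bs)"
| Store: "exec (Store i j) (R, M, bs) 1 (R, M(nat (R i) := R j), bs)"
| Flip: "exec (Flip i) (R, M, b # bs) 1 (R(i := of_bool b), M, bs)"
| Seq: "exec c1 s t1 s' \<Longrightarrow> exec c2 s' t2 s'' \<Longrightarrow> exec (Seq c1 c2) s (t1 + t2) s''"
| IfTrue: "R i > 0 \<Longrightarrow> exec c1 (R, M, bs) t s' \<Longrightarrow> exec (IfPos i c1 c2) (R, M, bs) (t + 1) s'"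
| IfFalse: "R i \<le> 0 \<Longrightarrow> exec c2 (R, M, bs) t s' \<Longrightarrow> exec (IfPos i c1 c2) (R, M, bs) (t + 1) s'"
| WhileFalse: "R i \<le> 0 \<Longrightarrow> exec (WhilePos i c) (R, M, bs) 1 (R, M, bs)"
| WhileTrue: "R i > 0 \<Longrightarrow> exec c (R, M, bs) t1 s' \<Longrightarrow> exec (WhilePos i c) s' t2 s'' \<Longrightarrow>
    exec (WhilePos i c) (R, M, bs) (t1 + t2 + 1) s''"

definition initial_state :: "int list \<Rightarrow> bool list \<Rightarrow> state" where
  "initial_state inp bs = (\<lambda>_. 0, \<lambda>a. if a < length inp then inp ! a else 0, bs)"

definition input_size :: "int list \<Rightarrow> nat" where
  "input_size inp = (\<Sum>z\<leftarrow>inp. nat (bitlen \<bar>z\<bar>) + 1)"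

text \<open>\<open>Inst\<close> are the instances, encoded as inputs by \<open>enc\<close>, and \<open>Sol a M\<close> says that the final memory
  \<open>M\<close> is a correct answer to the instance \<open>a\<close>. One program must stop on all instances and for all
  coin tosses within a time polynomial in the bit length of the input, and must answer correctly
  with probability at least \<open>2/3\<close>. A run of at most \<open>p\<close> steps tosses at most \<open>p\<close> coins, so \<open>p\<close> coins
  suffice.\<close>

definition randomized_polytime ::
    "('a \<Rightarrow> int list) \<Rightarrow> 'a set \<Rightarrow> ('a \<Rightarrow> (nat \<Rightarrow> int) \<Rightarrow> bool) \<Rightarrow> bool" where
  "randomized_polytime enc Inst Sol \<longleftrightarrow>
     (\<exists>(c :: com) (q :: nat poly). \<forall>a\<in>Inst. \<exists>p. p = poly q (input_size (enc a)) \<and>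
        (\<forall>bs. length bs = p \<longrightarrow> (\<exists>t\<le>p. \<exists>s'. exec c (initial_state (enc a) bs) t s')) \<and>
        measure_pmf.prob (pmf_of_set {bs. length bs = p})
          {bs. \<exists>t R M bs'. exec c (initial_state (enc a) bs) t (R, M, bs') \<and> Sol a M} \<ge> 2 / 3)"


section \<open>Instances of the covering problem\<close>

text \<open>Inputs of algorithms are finite objects, so here vectors and parameters are rational.\<close>

record cover_instance =
  inst_n :: nat
  inst_r :: nat
  inst_k :: nat
  inst_dim :: nat
  inst_E :: "(nat \<times> nat) set"
  inst_x :: "nat \<Rightarrow> rat vec"
  inst_eps :: rat
  inst_delta :: rat

definition real_x :: "cover_instance \<Rightarrow> nat \<Rightarrow> real vec" where
  "real_x I v = map_vec of_rat (inst_x I v)"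

definition wf_instance :: "cover_instance \<Rightarrow> bool" where
  "wf_instance I \<longleftrightarrow>
     regular_graph (inst_n I) (inst_r I) (inst_E I) \<and>
     (\<forall>v<inst_n I. inst_x I v \<in> carrier_vec (inst_dim I)) \<and>
     1 \<le> inst_k I \<and> inst_k I \<le> inst_n I \<and> 0 < inst_eps I \<and> 0 < inst_delta I"

definition encode_rat :: "rat \<Rightarrow> int list" where
  "encode_rat q = [fst (quotient_of q), snd (quotient_of q)]"

definition encode_instance :: "cover_instance \<Rightarrow> int list" where
  "encode_instance I =
     [int (inst_n I), int (inst_r I), int (inst_k I), int (inst_dim I)] @
     encode_rat (inst_eps I) @ encode_rat (inst_delta I) @
     [of_bool ((u, v) \<in> inst_E I). u \<leftarrow> [0..<inst_n I], v \<leftarrow> [0..<inst_n I]] @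
     concat [encode_rat (vec_index (inst_x I v) j). v \<leftarrow> [0..<inst_n I], j \<leftarrow> [0..<inst_dim I]]"

text \<open>The final memory lists the sets as \<open>2k\<close> consecutive characteristic vectors of length \<open>n\<close>.\<close>

definition decode_sets :: "cover_instance \<Rightarrow> (nat \<Rightarrow> int) \<Rightarrow> nat \<Rightarrow> nat set" where
  "decode_sets I M i = {v. v < inst_n I \<and> M ((i - 1) * inst_n I + v) \<noteq> 0}"

end

theory Submission
  imports Defs "Jordan_Normal_Form.Spectral_Radius" "HOL-Combinatorics.Permutations"
begin

text \<open>Let \<open>K\<^sub>u\<^sub>v = exp (- t d(u, v))\<close> be the Gaussian kernel of the vectors, where \<open>d\<close> is the squared
  distance, \<open>\<rho> = \<delta> / 36\<close> and \<open>exp (- t \<rho>) = 1 / (8 k)\<close>. Since \<open>1 - K\<^sub>u\<^sub>v \<le> t d(u, v)\<close>, the trace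
  of \<open>K L\<close> is at most \<open>2 n t \<E>(d)\<close>, so the eigenvectors of the Laplacian \<open>L\<close> from the \<open>k\<close>-th on carry
  little energy with respect to \<open>K\<close>: for all but \<open>\<epsilon> n\<close> vertices, the unit vector is within \<open>1 / 2\<close>,
  in the seminorm of \<open>K\<close>, of the span of the first \<open>k - 1\<close> eigenvectors. Among these vertices, points at
  squared distance more than \<open>\<rho>\<close> from each other give almost orthonormal unit vectors, and a space of
  dimension \<open>k - 1\<close> cannot be close to more than \<open>2 k\<close> of them. A maximal separated set therefore yields
  \<open>2 k\<close> balls that cover all but \<open>\<epsilon> n\<close> vertices.

  The greedy algorithm for \<open>k\<close>-center with outliers, which triples the radius, covers at least as
  many vertices as the best \<open>2 k\<close> balls of squared radius \<open>\<rho>\<close>; its sets have squared diameter at most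
  \<open>36 \<rho> = \<delta>\<close>. It needs neither eigenvalues nor coins.\<close>

section \<open>Positive semidefinite kernels\<close>

text \<open>The kernel replaces the vectors by unit vectors whose inner products decay with the
  distance. For 2k + 1 points that are pairwise more than \<rho> apart, the Gram matrix is bounded
  by 11/8, whatever the dimension of the original vectors, so a dimension count against k - 1
  eigenvectors becomes possible. The price of the decay is t = ln(8k)/\<rho>; this is how the
  logarithm of k enters. The constant 36 is 4 times 9: tripling a radius multiplies its square by 9,
  and passing from radius to diameter multiplies it by 4. The constant 2304 is 8 times 36 times 8:
  the first 8 comes from the trace bound and an averaging argument, 36 from \<rho>, and the last 8
  from ln(8k) \<le> 8 (ln k)^2 for k \<ge> 2. The balls obtained from the spectrum are therefore
  never computed: they only compete with the greedy choice, which needs nothing but comparisons of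
  rational squared distances with \<delta>.\<close>

definition kernel_form :: "nat \<Rightarrow> (nat \<Rightarrow> nat \<Rightarrow> real) \<Rightarrow> (nat \<Rightarrow> real) \<Rightarrow> (nat \<Rightarrow> real) \<Rightarrow> real" where
  "kernel_form n K f g = (\<Sum>u<n. \<Sum>v<n. K u v * f u * g v)"

lemma kernel_form_linear:
  "kernel_form n K (\<lambda>u. f u + c * g u) h = kernel_form n K f h + c * kernel_form n K g h"
  unfolding kernel_form_def sum_distrib_left sum.distrib[symmetric]
  by (intro sum.cong refl) (simp add: algebra_simps)

lemma kernel_form_sum:
  "kernel_form n K (\<lambda>u. \<Sum>i\<in>I. c i * g i u) h = (\<Sum>i\<in>I. c i * kernel_form n K (g i) h)"
proof -
  have "kernel_form n K (\<lambda>u. \<Sum>i\<in>I. c i * g i u) h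
      = (\<Sum>u<n. \<Sum>v<n. \<Sum>i\<in>I. c i * (K u v * g i u * h v))"
    unfolding kernel_form_def
    by (intro sum.cong refl) (simp add: sum_distrib_left sum_distrib_right mult_ac)
  also have "\<dots> = (\<Sum>u<n. \<Sum>i\<in>I. \<Sum>v<n. c i * (K u v * g i u * h v))"
    by (intro sum.cong refl sum.swap)
  also have "\<dots> = (\<Sum>i\<in>I. \<Sum>u<n. \<Sum>v<n. c i * (K u v * g i u * h v))"
    by (rule sum.swap)
  finally show ?thesis by (simp only: kernel_form_def sum_distrib_left)
qed

locale psd_kernel =
  fixes n :: nat and K :: "nat \<Rightarrow> nat \<Rightarrow> real"
  assumes sym: "K u v = K v u"
    and psd: "0 \<le> kernel_form n K f f"
begin

abbreviation B where "B \<equiv> kernel_form n K"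

lemma commute: "B f g = B g f"
proof -
  have "B f g = (\<Sum>v<n. \<Sum>u<n. K u v * f u * g v)"
    unfolding kernel_form_def by (rule sum.swap)
  also have "\<dots> = B g f"
    unfolding kernel_form_def by (intro sum.cong refl) (simp add: sym[of _ u for u] mult_ac)
  finally show ?thesis .
qed

lemma linear_right: "B h (\<lambda>u. f u + c * g u) = B h f + c * B h g"
  by (simp add: commute[of h] kernel_form_linear)

lemma quadratic_expand:
  "B (\<lambda>u. f u + c * g u) (\<lambda>u. f u + c * g u) = B f f + 2 * c * B f g + c\<^sup>2 * B g g"
proof -
  have "B g f = B f g" by (rule commute)
  then show ?thesis
    by (simp add: kernel_form_linear linear_right power2_eq_square algebra_simps)
qed

text \<open>If \<open>B w w = 0\<close>, the form along \<open>g + c w\<close> is affine in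
  \<open>c\<close>, and an affine function bounded below has slope 0. The case does arise: vertices
  with equal vectors make the kernel singular.\<close>

lemma null_vector:
  assumes "B w w = 0"
  shows "B g w = 0"
proof (rule ccontr)
  assume ne: "B g w \<noteq> 0"
  define c where "c = - (B g g + 1) / (2 * B g w)"
  have "0 \<le> B (\<lambda>u. g u + c * w u) (\<lambda>u. g u + c * w u)" by (rule psd)
  also have "\<dots> = -1" unfolding quadratic_expand using ne assms by (simp add: c_def field_simps)
  finally show False by simp
qed

text \<open>A Bessel-type bound: vectors whose Gram matrix is at most \<open>M\<close> lose at most \<open>M\<close> of their
  total energy for each dimension of a subspace from which their distance is measured.\<close>

lemma distance_to_span:
  fixes a :: "'i \<Rightarrow> nat \<Rightarrow> real"
  assumes M: "0 \<le> M" and bessel: "\<And>w. (\<Sum>v\<in>S. (B (a v) w)\<^sup>2) \<le> M * B w w"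
  shows "(\<Sum>v\<in>S. B (\<lambda>u. a v u - (\<Sum>i<d. c v i * w i u)) (\<lambda>u. a v u - (\<Sum>i<d. c v i * w i u)))
     \<ge> (\<Sum>v\<in>S. B (a v) (a v)) - real d * M"
  using bessel
proof (induction d arbitrary: a w)
  case 0
  then show ?case by simp
next
  case (Suc d)
  define g where "g v u = a v u - (\<Sum>i<d. c v i * w i u)" for v u
  have g_Suc: "(\<lambda>u. a v u - (\<Sum>i<Suc d. c v i * w i u)) = (\<lambda>u. g v u + (- c v d) * w d u)" for v
    by (simp add: g_def fun_eq_iff)
  define b where "b = B (w d) (w d)"
  show ?case
  proof (cases "b = 0")
    case True
    \<comment> \<open>A null vector changes no distance, so this dimension costs nothing, and the
      allowance \<open>M\<close> for it is given away.\<close>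
    have "B (\<lambda>u. g v u + (- c v d) * w d u) (\<lambda>u. g v u + (- c v d) * w d u) = B (g v) (g v)" for v
      using null_vector[of "w d" "g v"] True unfolding quadratic_expand b_def by simp
    moreover have "(\<Sum>v\<in>S. B (g v) (g v)) \<ge> (\<Sum>v\<in>S. B (a v) (a v)) - real d * M"
      using Suc.IH[of a w] Suc.prems unfolding g_def by simp
    ultimately show ?thesis unfolding g_Suc using M by (simp add: algebra_simps)
  next
    case False
    then have b: "b > 0" using psd[of "w d"] unfolding b_def by simp
    \<comment> \<open>\<open>p\<close> is the \<open>B\<close>-orthogonal projection along
      \<open>w d\<close>. It is self-adjoint, so in the Bessel bound it can be moved to the test
      vector, where it only decreases \<open>B h h\<close>; the projected family therefore satisfies
      the hypothesis with the same \<open>M\<close>.\<close>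
    define p where "p f u = f u + (- (B f (w d) / b)) * w d u" for f u
    have pp: "B (p f) (p f) = B f f - (B f (w d))\<^sup>2 / b" for f
      using b unfolding p_def quadratic_expand b_def[symmetric]
      by (simp add: power2_eq_square field_simps)
    have pf: "B (p f) h = B f h - B f (w d) / b * B (w d) h" for f h
      unfolding p_def kernel_form_linear by simp
    have p_adj: "B (p f) h = B f (p h)" for f h
    proof -
      have "B f (p h) = B f h - B h (w d) / b * B f (w d)"
        unfolding p_def linear_right by simp
      then show ?thesis unfolding pf by (simp add: commute[of "w d" h])
    qed
    have bes: "(\<Sum>v\<in>S. (B (p (a v)) h)\<^sup>2) \<le> M * B h h" for h
    proof -
      have "(\<Sum>v\<in>S. (B (p (a v)) h)\<^sup>2) = (\<Sum>v\<in>S. (B (a v) (p h))\<^sup>2)" by (simp add: p_adj)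
      also have "\<dots> \<le> M * B (p h) (p h)" by (rule Suc.prems)
      also have "\<dots> \<le> M * B h h" using M b by (intro mult_left_mono) (simp_all add: pp)
      finally show ?thesis .
    qed
    have IH: "(\<Sum>v\<in>S. B (\<lambda>u. p (a v) u - (\<Sum>i<d. c v i * p (w i) u)) (\<lambda>u. p (a v) u - (\<Sum>i<d. c v i * p (w i) u)))
        \<ge> (\<Sum>v\<in>S. B (p (a v)) (p (a v))) - real d * M"
      by (rule Suc.IH) (rule bes)
    \<comment> \<open>Projection is linear, so the residual of \<open>p (a v)\<close> with respect
      to the vectors \<open>p (w i)\<close>, with unchanged coefficients, is the projected
      residual.\<close>
    have pg: "(\<lambda>u. p (a v) u - (\<Sum>i<d. c v i * p (w i) u)) = p (g v)" for v
    proof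
      fix u
      have eq: "g v = (\<lambda>u. a v u + (-1) * (\<Sum>i<d. c v i * w i u))" by (simp add: g_def fun_eq_iff)
      have "B (g v) (w d) = B (a v) (w d) - (\<Sum>i<d. c v i * B (w i) (w d))"
        unfolding eq kernel_form_linear kernel_form_sum by simp
      moreover have "(\<Sum>i<d. c v i * p (w i) u)
          = (\<Sum>i<d. c v i * w i u) - (\<Sum>i<d. c v i * B (w i) (w d)) / b * w d u"
        unfolding p_def
        by (simp add: sum_subtractf sum_distrib_left sum_distrib_right sum_divide_distrib algebra_simps)
      moreover have "g v u = a v u - (\<Sum>i<d. c v i * w i u)" by (simp add: g_def)
      ultimately show "p (a v) u - (\<Sum>i<d. c v i * p (w i) u) = p (g v) u"
        unfolding p_def by (simp only:) (simp add: diff_divide_distrib algebra_simps)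
    qed
    have "(\<Sum>v\<in>S. B (a v) (a v)) - M \<le> (\<Sum>v\<in>S. B (p (a v)) (p (a v)))"
    proof -
      have "(\<Sum>v\<in>S. (B (a v) (w d))\<^sup>2) / b \<le> M"
        using Suc.prems[of "w d"] b by (simp add: b_def[symmetric] field_simps)
      then show ?thesis by (simp add: pp sum_subtractf sum_divide_distrib)
    qed
    \<comment> \<open>Among all translates of \<open>g v\<close> by multiples of \<open>w d\<close>,
      the projection has the least form, whatever \<open>c v d\<close> is: the difference is a
      square divided by \<open>b\<close>.\<close>
    moreover have "B (p (g v)) (p (g v))
        \<le> B (\<lambda>u. g v u + (- c v d) * w d u) (\<lambda>u. g v u + (- c v d) * w d u)" for v
    proof -
      have "0 \<le> (B (g v) (w d) - c v d * b)\<^sup>2 / b" using b by simp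
      also have "\<dots> = (B (g v) (w d))\<^sup>2 / b - 2 * c v d * B (g v) (w d) + (c v d)\<^sup>2 * b"
        using b by (simp add: power2_eq_square field_simps)
      finally show ?thesis unfolding pp quadratic_expand b_def[symmetric] by simp
    qed
    then have "(\<Sum>v\<in>S. B (p (g v)) (p (g v)))
      \<le> (\<Sum>v\<in>S. B (\<lambda>u. g v u + (- c v d) * w d u) (\<lambda>u. g v u + (- c v d) * w d u))"
      by (intro sum_mono)
    ultimately show ?thesis using IH unfolding g_Suc pg by (simp add: algebra_simps)
  qed
qed

definition unit :: "nat \<Rightarrow> nat \<Rightarrow> real" where "unit v u = of_bool (u = v)"

lemma form_unit: "u < n \<Longrightarrow> v < n \<Longrightarrow> B (unit u) (unit v) = K u v"
proof -
  assume uv: "u < n" "v < n"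
  have "B (unit u) (unit v) = (\<Sum>a<n. \<Sum>b<n. if b = v then if a = u then K u v else 0 else 0)"
    unfolding kernel_form_def unit_def by (intro sum.cong refl) auto
  also have "\<dots> = K u v" using uv by simp
  finally show ?thesis .
qed

text \<open>A row-sum bound for the Gram matrix: by
  \<open>2 * y u * y v \<le> (y u)\<^sup>2 + (y v)\<^sup>2\<close> the combination \<open>f\<close>
  of the unit vectors has \<open>B f f \<le> M * Y\<close>. Since \<open>B f w = Y\<close>,
  positivity at \<open>w - f / M\<close> turns this into a bound for arbitrary \<open>w\<close>; the
  coefficient 1 / M is the one that minimizes the resulting quadratic.\<close>

lemma bessel_near_orthonormal:
  assumes S: "S \<subseteq> {..<n}" and diag: "\<And>v. v \<in> S \<Longrightarrow> K v v = 1"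
    and off: "\<And>u v. u \<in> S \<Longrightarrow> v \<in> S \<Longrightarrow> u \<noteq> v \<Longrightarrow> 0 \<le> K u v \<and> K u v \<le> \<eta>" and eta: "0 \<le> \<eta>"
  shows "(\<Sum>v\<in>S. (B (unit v) w)\<^sup>2) \<le> (1 + real (card S) * \<eta>) * B w w"
proof -
  have fin: "finite S" using S finite_subset by blast
  define y where "y v = B (unit v) w" for v
  define Y where "Y = (\<Sum>v\<in>S. (y v)\<^sup>2)"
  define f where "f u = (\<Sum>v\<in>S. y v * unit v u)" for u
  define M where "M = 1 + real (card S) * \<eta>"
  have M: "M > 0" using eta by (simp add: M_def add_pos_nonneg)
  have fB: "B f h = (\<Sum>v\<in>S. y v * B (unit v) h)" for h
    unfolding f_def kernel_form_sum ..
  have fw: "B f w = Y"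
    unfolding fB Y_def by (simp add: y_def power2_eq_square)
  have "B f f = (\<Sum>u\<in>S. y u * (\<Sum>v\<in>S. y v * K u v))"
  proof -
    have "B f f = (\<Sum>u\<in>S. y u * B (unit u) f)"
      by (rule fB)
    also have "\<dots> = (\<Sum>u\<in>S. y u * (\<Sum>v\<in>S. y v * K u v))"
    proof (intro sum.cong refl arg_cong2[where f="(*)"])
      fix u assume u: "u \<in> S"
      have "B (unit u) f = B f (unit u)" by (rule commute)
      also have "\<dots> = (\<Sum>v\<in>S. y v * B (unit v) (unit u))"
        by (rule fB)
      also have "\<dots> = (\<Sum>v\<in>S. y v * K u v)"
        using S u by (intro sum.cong refl arg_cong2[where f="(*)"]) (metis form_unit sym lessThan_iff subsetD)
      finally show "B (unit u) f = (\<Sum>v\<in>S. y v * K u v)" .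
    qed
    finally show ?thesis .
  qed
  also have "\<dots> \<le> (\<Sum>u\<in>S. \<Sum>v\<in>S. (if u = v then (y u)\<^sup>2 else 0) + \<eta> * ((y u)\<^sup>2 + (y v)\<^sup>2) / 2)"
    unfolding sum_distrib_left
  proof (intro sum_mono)
    fix u v assume uv: "u \<in> S" "v \<in> S"
    show "y u * (y v * K u v) \<le> (if u = v then (y u)\<^sup>2 else 0) + \<eta> * ((y u)\<^sup>2 + (y v)\<^sup>2) / 2"
    proof (cases "u = v")
      case True
      then show ?thesis using diag[OF uv(1)] eta by (simp add: power2_eq_square)
    next
      case False
      have "y u * y v \<le> ((y u)\<^sup>2 + (y v)\<^sup>2) / 2"
        using sum_squares_bound[of "y u" "y v"] by simp
      then have "(y u * y v) * K u v \<le> ((y u)\<^sup>2 + (y v)\<^sup>2) / 2 * K u v"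
        using off[OF uv False] by (intro mult_right_mono) auto
      also have "\<dots> \<le> ((y u)\<^sup>2 + (y v)\<^sup>2) / 2 * \<eta>"
        using off[OF uv False] by (intro mult_left_mono) auto
      finally show ?thesis using False by (simp add: mult_ac)
    qed
  qed
  also have "\<dots> = M * Y"
    using fin by (simp add: sum.distrib M_def Y_def sum_distrib_left[symmetric] sum_divide_distrib[symmetric]
      algebra_simps)
  finally have ff: "B f f \<le> M * Y" .
  have "0 \<le> B (\<lambda>u. w u + (- (1 / M)) * f u) (\<lambda>u. w u + (- (1 / M)) * f u)" by (rule psd)
  also have "\<dots> = B w w - 2 / M * Y + (1 / M)\<^sup>2 * B f f"
    unfolding quadratic_expand by (simp add: commute[of w f] fw)
  also have "\<dots> \<le> B w w - 2 / M * Y + (1 / M)\<^sup>2 * (M * Y)"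
    using ff by (intro add_left_mono mult_left_mono) auto
  also have "\<dots> = B w w - Y / M"
    using M by (simp add: power2_eq_square field_simps)
  finally show ?thesis
    using M unfolding Y_def y_def M_def by (simp add: field_simps)
qed

end

section \<open>Positive semidefiniteness of the Gaussian kernel\<close>

lemma kernel_form_rank_one:
  "(\<Sum>u<n. \<Sum>v<n. p u * p v * (K u v) * f u * f v) = kernel_form n K (\<lambda>u. p u * f u) (\<lambda>u. p u * f u)"
  unfolding kernel_form_def by (intro sum.cong refl) (simp add: mult_ac)

text \<open>Schur's product theorem for powers of a Gram matrix: one factor is split into rank one
  matrices over the coordinates \<open>j\<close>, and each summand is the form of the lower power at
  the rescaled vector \<open>y u j * f u\<close>.\<close>

lemma gram_power_psd:
  fixes y :: "nat \<Rightarrow> nat \<Rightarrow> real"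
  shows "0 \<le> kernel_form n (\<lambda>u v. (\<Sum>j<m. y u j * y v j) ^ i) f f"
proof (induction i arbitrary: f)
  case 0
  have "kernel_form n (\<lambda>u v. (\<Sum>j<m. y u j * y v j) ^ 0) f f = (\<Sum>u<n. f u)\<^sup>2"
    unfolding kernel_form_def power2_eq_square sum_product by simp
  then show ?case by simp
next
  case (Suc i)
  define H where "H u v = (\<Sum>j<m. y u j * y v j) ^ i" for u v
  have "kernel_form n (\<lambda>u v. (\<Sum>j<m. y u j * y v j) ^ Suc i) f f
      = (\<Sum>u<n. \<Sum>v<n. \<Sum>j<m. y u j * y v j * H u v * f u * f v)"
    unfolding kernel_form_def power_Suc H_def[symmetric] by (simp only: sum_distrib_right)
  also have "\<dots> = (\<Sum>u<n. \<Sum>j<m. \<Sum>v<n. y u j * y v j * H u v * f u * f v)"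
    by (intro sum.cong refl sum.swap)
  also have "\<dots> = (\<Sum>j<m. \<Sum>u<n. \<Sum>v<n. y u j * y v j * H u v * f u * f v)"
    by (rule sum.swap)
  also have "\<dots> \<ge> 0"
    by (rule sum_nonneg) (simp only: kernel_form_rank_one H_def Suc.IH)
  finally show ?case .
qed

text \<open>The exponential series has nonnegative coefficients, so the form is a convergent sum of
  the nonnegative forms of the powers.\<close>

lemma exp_gram_psd:
  fixes y :: "nat \<Rightarrow> nat \<Rightarrow> real"
  shows "0 \<le> kernel_form n (\<lambda>u v. exp (\<Sum>j<m. y u j * y v j)) f f"
proof -
  let ?G = "\<lambda>u v. \<Sum>j<m. y u j * y v j"
  have "(\<lambda>i. (\<Sum>u<n. \<Sum>v<n. (?G u v ^ i /\<^sub>R fact i) * f u * f v)) sums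
      (\<Sum>u<n. \<Sum>v<n. exp (?G u v) * f u * f v)"
    by (intro sums_sum sums_mult2 exp_converges)
  moreover have "(\<Sum>u<n. \<Sum>v<n. (?G u v ^ i /\<^sub>R fact i) * f u * f v) = kernel_form n (\<lambda>u v. ?G u v ^ i) f f /\<^sub>R fact i" for i
    unfolding kernel_form_def scaleR_sum_right by (simp add: mult.assoc)
  ultimately have lim: "(\<lambda>i. kernel_form n (\<lambda>u v. ?G u v ^ i) f f /\<^sub>R fact i) sums
      kernel_form n (\<lambda>u v. exp (?G u v)) f f"
    by (simp add: kernel_form_def)
  have nonneg: "0 \<le> kernel_form n (\<lambda>u v. ?G u v ^ i) f f /\<^sub>R fact i" for i
    using gram_power_psd[where n = n and m = m and y = y and i = i and f = f] by simp
  show ?thesis by (rule sums_le[OF nonneg sums_zero lim])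
qed

text \<open>Expanding the square gives \<open>p u * p v\<close> times the exponential of
  \<open>2 * t\<close> times the Gram matrix: \<open>p\<close> rescales the test vector, and
  \<open>sqrt (2 * t)\<close> is absorbed into the vectors.\<close>

lemma gaussian_psd:
  fixes y :: "nat \<Rightarrow> nat \<Rightarrow> real"
  assumes "0 \<le> t"
  shows "psd_kernel n (\<lambda>u v. exp (- t * (\<Sum>j<m. (y u j - y v j)\<^sup>2)))"
proof
  fix u v f
  show "exp (- t * (\<Sum>j<m. (y u j - y v j)\<^sup>2)) = exp (- t * (\<Sum>j<m. (y v j - y u j)\<^sup>2))"
    by (simp only: power2_commute[of "y u j" "y v j" for j])
  define p where "p u = exp (- t * (\<Sum>j<m. (y u j)\<^sup>2))" for u
  define z where "z u j = sqrt (2 * t) * y u j" for u j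
  have "exp (- t * (\<Sum>j<m. (y u j - y v j)\<^sup>2)) = p u * p v * exp (\<Sum>j<m. z u j * z v j)" for u v
  proof -
    have summand: "- t * (y u j - y v j)\<^sup>2 = - t * (y u j)\<^sup>2 + - t * (y v j)\<^sup>2 + z u j * z v j" for j
    proof -
      have "z u j * z v j = (sqrt (2 * t) * sqrt (2 * t)) * (y u j * y v j)"
        unfolding z_def by (simp only: mult_ac)
      then have "z u j * z v j = 2 * t * (y u j * y v j)" using assms by simp
      then show ?thesis by (simp add: power2_diff algebra_simps)
    qed
    have "- t * (\<Sum>j<m. (y u j - y v j)\<^sup>2)
        = - t * (\<Sum>j<m. (y u j)\<^sup>2) + - t * (\<Sum>j<m. (y v j)\<^sup>2) + (\<Sum>j<m. z u j * z v j)"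
      unfolding sum_distrib_left summand sum.distrib ..
    then show ?thesis by (simp only: p_def exp_add)
  qed
  then have "kernel_form n (\<lambda>u v. exp (- t * (\<Sum>j<m. (y u j - y v j)\<^sup>2))) f f
      = kernel_form n (\<lambda>u v. exp (\<Sum>j<m. z u j * z v j)) (\<lambda>u. p u * f u) (\<lambda>u. p u * f u)"
    unfolding kernel_form_rank_one[symmetric] by (simp add: kernel_form_def)
  then show "0 \<le> kernel_form n (\<lambda>u v. exp (- t * (\<Sum>j<m. (y u j - y v j)\<^sup>2))) f f"
    by (simp add: exp_gram_psd)
qed

section \<open>The spectral theorem for real symmetric matrices\<close>

text \<open>Over the complex numbers an eigenvector z = x + iy exists. By symmetry, two evaluations
  of \<open>(A *\<^sub>v y) \<bullet> x\<close> give Im c (|x|^2 + |y|^2) = 0, so the eigenvalue is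
  real, and whichever of x and y is nonzero is a real eigenvector.\<close>

lemma real_symmetric_eigenvector:
  fixes A :: "real mat"
  assumes A: "A \<in> carrier_mat n n" and sym: "A\<^sup>T = A" and n: "n > 0"
  shows "\<exists>v a. v \<in> carrier_vec n \<and> v \<bullet> v = 1 \<and> A *\<^sub>v v = a \<cdot>\<^sub>v v"
proof -
  let ?C = "map_mat complex_of_real A"
  have C: "?C \<in> carrier_mat n n" using A by simp
  obtain c where "eigenvalue ?C c"
    using spectrum_non_empty[OF C n] by (auto simp: spectrum_def)
  then obtain z where "eigenvector ?C z c" unfolding eigenvalue_def by blast
  then have z: "z \<in> carrier_vec n" "z \<noteq> 0\<^sub>v n" and Cz: "?C *\<^sub>v z = c \<cdot>\<^sub>v z"
    using A by (auto simp: eigenvector_def)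
  define x where "x = map_vec Re z"
  define y where "y = map_vec Im z"
  have x: "x \<in> carrier_vec n" and y: "y \<in> carrier_vec n" using z by (auto simp: x_def y_def)
  have entry: "(\<Sum>j<n. complex_of_real (A $$ (i, j)) * z $ j) = c * z $ i" if "i < n" for i
  proof -
    have "(?C *\<^sub>v z) $ i = (c \<cdot>\<^sub>v z) $ i" by (simp add: Cz)
    then show ?thesis
      using that z A by (auto simp: scalar_prod_def lessThan_atLeast0)
  qed
  have Ax: "A *\<^sub>v x = Re c \<cdot>\<^sub>v x - Im c \<cdot>\<^sub>v y"
  proof (rule eq_vecI)
    fix i assume "i < dim_vec (Re c \<cdot>\<^sub>v x - Im c \<cdot>\<^sub>v y)"
    then have i: "i < n" using y by simp
    have "(A *\<^sub>v x) $ i = Re (\<Sum>j<n. complex_of_real (A $$ (i, j)) * z $ j)"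
      using i A z by (simp add: scalar_prod_def x_def lessThan_atLeast0)
    then show "(A *\<^sub>v x) $ i = (Re c \<cdot>\<^sub>v x - Im c \<cdot>\<^sub>v y) $ i"
      using i z unfolding entry[OF i] by (simp add: x_def y_def)
  qed (use A y in auto)
  have Ay: "A *\<^sub>v y = Im c \<cdot>\<^sub>v x + Re c \<cdot>\<^sub>v y"
  proof (rule eq_vecI)
    fix i assume "i < dim_vec (Im c \<cdot>\<^sub>v x + Re c \<cdot>\<^sub>v y)"
    then have i: "i < n" using y by simp
    have "(A *\<^sub>v y) $ i = Im (\<Sum>j<n. complex_of_real (A $$ (i, j)) * z $ j)"
      using i A z by (simp add: scalar_prod_def y_def lessThan_atLeast0)
    then show "(A *\<^sub>v y) $ i = (Im c \<cdot>\<^sub>v x + Re c \<cdot>\<^sub>v y) $ i"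
      using i z unfolding entry[OF i] by (simp add: x_def y_def add.commute)
  qed (use A y in auto)
  have pos: "0 < x \<bullet> x + y \<bullet> y"
  proof -
    have "x \<bullet> x + y \<bullet> y = (\<Sum>i<n. (cmod (z $ i))\<^sup>2)"
      unfolding cmod_power2 sum.distrib
      using z by (simp add: scalar_prod_def x_def y_def power2_eq_square lessThan_atLeast0)
    moreover have "\<exists>i<n. z $ i \<noteq> 0" using z by (auto simp: vec_eq_iff)
    then obtain i where "i < n" "z $ i \<noteq> 0" by blast
    then have "0 < (\<Sum>i<n. (cmod (z $ i))\<^sup>2)"
      by (intro sum_pos2[of _ i]) auto
    ultimately show ?thesis by simp
  qed
  have "(A *\<^sub>v y) \<bullet> x = y \<bullet> (A *\<^sub>v x)"
    using transpose_vec_mult_scalar[OF A x y] sym by simp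
  moreover have "(A *\<^sub>v y) \<bullet> x = Im c * (x \<bullet> x) + Re c * (y \<bullet> x)"
    unfolding Ay using x y by (simp add: add_scalar_prod_distrib[where n = n])
  moreover have "y \<bullet> (A *\<^sub>v x) = Re c * (y \<bullet> x) - Im c * (y \<bullet> y)"
    unfolding Ax using x y by (simp add: scalar_prod_minus_distrib[where n = n])
  ultimately have "Im c * (x \<bullet> x + y \<bullet> y) = 0" by (simp add: algebra_simps)
  then have "Im c = 0" using pos by simp
  have nonneg: "0 \<le> scalar_prod w w" for w :: "real vec" by (simp add: scalar_prod_def sum_nonneg)
  have "\<exists>w \<in> carrier_vec n. 0 < scalar_prod w w \<and> A *\<^sub>v w = Re c \<cdot>\<^sub>v w"
  proof (cases "0 < scalar_prod x x")
    case True
    have "A *\<^sub>v x = Re c \<cdot>\<^sub>v x" 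
      unfolding Ax \<open>Im c = 0\<close> using x y by (intro eq_vecI) auto
    then show ?thesis using True x by blast
  next
    case False
    then have "0 < scalar_prod y y" using pos nonneg[of x] by linarith
    moreover have "A *\<^sub>v y = Re c \<cdot>\<^sub>v y" 
      unfolding Ay \<open>Im c = 0\<close> using x y by (intro eq_vecI) auto
    ultimately show ?thesis using y by blast
  qed
  then obtain w where w: "w \<in> carrier_vec n" "0 < scalar_prod w w" "A *\<^sub>v w = Re c \<cdot>\<^sub>v w" by blast
  define v where "v = (1 / sqrt (scalar_prod w w)) \<cdot>\<^sub>v w"
  have "v \<in> carrier_vec n" using w by (simp add: v_def)
  moreover have "scalar_prod v v = 1" using w by (simp add: v_def)
  moreover have "A *\<^sub>v v = Re c \<cdot>\<^sub>v v"
    unfolding v_def mult_mat_vec[OF A w(1)] w(3) smult_smult_assoc by (simp only: mult.commute)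
  ultimately show ?thesis by blast
qed

text \<open>The reflection in the hyperplane orthogonal to the difference of the two unit vectors
  exchanges them. Being symmetric and its own inverse, it can play both conjugating matrices in the
  deflation below.\<close>

lemma householder:
  fixes v :: "real vec"
  assumes v: "v \<in> carrier_vec n" and unit: "v \<bullet> v = 1" and n: "n > 0"
  shows "\<exists>H. H \<in> carrier_mat n n \<and> H\<^sup>T = H \<and> H * H = 1\<^sub>m n \<and> H *\<^sub>v unit_vec n 0 = v"
proof (cases "v = unit_vec n 0")
  case True
  then show ?thesis by (intro exI[of _ "1\<^sub>m n"]) auto
next
  case False
  define w where "w i = of_bool (i = 0) - v $ i" for i
  define s where "s = (\<Sum>i<n. w i * w i)"
  define H where "H = mat n n (\<lambda>(i, j). of_bool (i = j) - 2 / s * w i * w j)"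
  have vv: "(\<Sum>i<n. v $ i * v $ i) = 1"
    using unit v by (simp add: scalar_prod_def lessThan_atLeast0)
  have "s = (\<Sum>i<n. (if i = 0 then 1 - 2 * v $ 0 else 0) + v $ i * v $ i)"
    unfolding s_def w_def by (intro sum.cong refl) (auto simp: algebra_simps)
  \<comment> \<open>Both vectors have norm 1, so the squared norm of their difference is 2 - 2 v_0.
    Hence \<open>2 / s * w 0\<close> equals 1, which is why \<open>H\<close> sends the first basis
    vector exactly to \<open>v\<close>.\<close>
  then have s: "s = 2 * w 0" using n vv by (simp add: sum.distrib w_def)
  have s_pos: "s \<noteq> 0"
  proof
    assume "s = 0"
    then have "w i * w i = 0" if "i < n" for i
      using that unfolding s_def by (subst (asm) sum_nonneg_eq_0_iff) auto
    then have "v $ i = of_bool (i = 0)" if "i < n" for i using that by (simp add: w_def)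
    then have "v = unit_vec n 0" using v n by (intro eq_vecI) auto
    then show False using False by simp
  qed
  have H: "H \<in> carrier_mat n n" by (simp add: H_def)
  moreover have "H\<^sup>T = H" by (rule eq_matI) (auto simp: H_def)
  moreover have "H * H = 1\<^sub>m n"
  proof (rule eq_matI)
    fix i j assume "i < dim_row (1\<^sub>m n :: real mat)" "j < dim_col (1\<^sub>m n :: real mat)"
    then have ij: "i < n" "j < n" by auto
    have "(H * H) $$ (i, j) = (\<Sum>k<n. (of_bool (i = k) - 2 / s * w i * w k) * (of_bool (k = j) - 2 / s * w k * w j))"
      using ij by (simp add: H_def scalar_prod_def lessThan_atLeast0)
    also have "\<dots> = (\<Sum>k<n. (if k = i then of_bool (i = j) - 2 / s * w i * w j else 0)
        - (if k = j then 2 / s * w i * w j else 0) + (2 / s * w i) * (2 / s * w j) * (w k * w k))"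
      by (intro sum.cong refl) (auto simp: algebra_simps)
    also have "\<dots> = of_bool (i = j) - 2 / s * w i * w j - 2 / s * w i * w j + (2 / s * w i) * (2 / s * w j) * s"
    proof -
      have "(\<Sum>k<n. c * (w k * w k)) = c * s" for c by (simp add: s_def sum_distrib_left)
      then show ?thesis using ij by (simp only: sum.distrib sum_subtractf) simp
    qed
    also have "\<dots> = of_bool (i = j)" using s_pos by (simp add: field_simps)
    finally show "(H * H) $$ (i, j) = 1\<^sub>m n $$ (i, j)" using ij by simp
  qed (auto simp: H_def)
  moreover have "H *\<^sub>v unit_vec n 0 = v"
  proof (rule eq_vecI)
    fix i assume "i < dim_vec v"
    then have i: "i < n" using v by simp
    have "(H *\<^sub>v unit_vec n 0) $ i = H $$ (i, 0)" using i n by (simp add: H_def)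
    also have "\<dots> = v $ i" using i n s s_pos by (simp add: H_def w_def[of i])
    finally show "(H *\<^sub>v unit_vec n 0) $ i = v $ i" .
  qed (use v in \<open>auto simp: H_def\<close>)
  ultimately show ?thesis by blast
qed

text \<open>Deflation: after conjugation by a Householder reflection a unit eigenvector becomes the
  first basis vector, so the first column is \<open>a\<close> times that vector; symmetry clears the
  first row as well and leaves a symmetric block of size \<open>n\<close>.\<close>

lemma real_symmetric_diagonalizable:
  fixes A :: "real mat"
  assumes "A \<in> carrier_mat n n" and "A\<^sup>T = A"
  shows "\<exists>D U. similar_mat_wit A D U (U\<^sup>T) \<and> diagonal_mat D"
  using assms
proof (induction n arbitrary: A)
  case 0
  then have "similar_mat_wit A A (1\<^sub>m 0) ((1\<^sub>m 0)\<^sup>T)"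
    by (intro similar_mat_witI[where n = 0]) auto
  moreover have "diagonal_mat A" using 0 by (simp add: diagonal_mat_def)
  ultimately show ?case by blast
next
  case (Suc n)
  note A = Suc.prems(1)
  obtain v a where v: "v \<in> carrier_vec (Suc n)" "scalar_prod v v = 1" "A *\<^sub>v v = a \<cdot>\<^sub>v v"
    using real_symmetric_eigenvector[OF Suc.prems] by blast
  obtain H where H: "H \<in> carrier_mat (Suc n) (Suc n)" and HT: "H\<^sup>T = H"
    and HH: "H * H = 1\<^sub>m (Suc n)" and He: "H *\<^sub>v unit_vec (Suc n) 0 = v"
    using householder[OF v(1,2)] by blast
  define A' where "A' = H * A * H"
  have HA: "H * A \<in> carrier_mat (Suc n) (Suc n)" using H A by simp
  have A': "A' \<in> carrier_mat (Suc n) (Suc n)" using HA H by (simp add: A'_def)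
  have A'T: "A'\<^sup>T = A'"
    unfolding A'_def transpose_mult[OF HA H] transpose_mult[OF H A] HT Suc.prems(2)
    using H A by (simp add: assoc_mult_mat[OF H A H])
  have AA': "similar_mat_wit A A' H H"
  proof (rule similar_mat_witI[OF HH HH _ A A' H H])
    have "H * A' * H = H * (H * A * H) * H" by (simp add: A'_def)
    also have "\<dots> = H * (H * A * (H * H))"
      using assoc_mult_mat[OF HA H H] assoc_mult_mat[OF H A' H] by (simp add: A'_def)
    also have "\<dots> = (H * H) * A" by (simp only: HH right_mult_one_mat[OF HA] assoc_mult_mat[OF H H A, symmetric])
    also have "\<dots> = A" unfolding HH using A by (rule left_mult_one_mat)
    finally show "A = H * A' * H" by (rule HOL.sym)
  qed
  have e0: "unit_vec (Suc n) 0 \<in> carrier_vec (Suc n)" by simp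
  have "A' *\<^sub>v unit_vec (Suc n) 0 = a \<cdot>\<^sub>v unit_vec (Suc n) 0"
  proof -
    have "A' *\<^sub>v unit_vec (Suc n) 0 = H *\<^sub>v (A *\<^sub>v (H *\<^sub>v unit_vec (Suc n) 0))"
      unfolding A'_def assoc_mult_mat_vec[OF HA H e0] He assoc_mult_mat_vec[OF H A v(1)] ..
    also have "\<dots> = a \<cdot>\<^sub>v (H *\<^sub>v v)" by (simp add: He v(3) mult_mat_vec[OF H v(1)])
    also have "H *\<^sub>v v = (H * H) *\<^sub>v unit_vec (Suc n) 0"
      unfolding assoc_mult_mat_vec[OF H H e0] He ..
    finally show ?thesis using e0 by (simp add: HH)
  qed
  then have col0: "A' $$ (i, 0) = (if i = 0 then a else 0)" if "i < Suc n" for i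
  proof -
    have "(A' *\<^sub>v unit_vec (Suc n) 0) $ i = A' $$ (i, 0)" using that A' by simp
    then show ?thesis
      using that \<open>A' *\<^sub>v unit_vec (Suc n) 0 = _\<close> by (cases "i = 0") simp_all
  qed
  have A'_sym: "A' $$ (i, j) = A' $$ (j, i)" if "i < Suc n" "j < Suc n" for i j
  proof -
    have "A'\<^sup>T $$ (j, i) = A' $$ (i, j)" using that A' by simp
    then show ?thesis unfolding A'T ..
  qed
  have row0: "A' $$ (0, i) = (if i = 0 then a else 0)" if "i < Suc n" for i
    using A'_sym[of 0 i] col0[of i] that by simp
  define A3 where "A3 = mat n n (\<lambda>(i, j). A' $$ (Suc i, Suc j))"
  have A3: "A3 \<in> carrier_mat n n" by (simp add: A3_def)
  have A3T: "A3\<^sup>T = A3" by (intro eq_matI) (auto simp: A3_def intro: A'_sym)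
  obtain D U where DU: "similar_mat_wit A3 D U (U\<^sup>T)" and D: "diagonal_mat D"
    using Suc.IH[OF A3 A3T] by blast
  note DU' = similar_mat_witD2[OF A3 DU]
  let ?a = "mat 1 1 (\<lambda>_. a)"
  have block: "A' = four_block_mat ?a (0\<^sub>m 1 n) (0\<^sub>m n 1) A3"
    using A' by (intro eq_matI) (auto simp: A3_def col0 row0 not_less Suc_diff_Suc)
  let ?P = "four_block_mat (1\<^sub>m 1) (0\<^sub>m 1 n) (0\<^sub>m n 1) U"
  let ?Q = "four_block_mat (1\<^sub>m 1) (0\<^sub>m 1 n) (0\<^sub>m n 1) (U\<^sup>T)"
  let ?D = "four_block_mat ?a (0\<^sub>m 1 n) (0\<^sub>m n 1) D"
  have "similar_mat_wit A' ?D ?P ?Q"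
    unfolding block
    by (rule similar_mat_wit_four_block[OF similar_mat_wit_refl[of ?a 1] DU _ _ _ A3]) (use DU' in auto)
  from similar_mat_wit_trans[OF AA' this] have sim: "similar_mat_wit A ?D (H * ?P) (?Q * H)" .
  have QH: "?Q * H = (H * ?P)\<^sup>T"
  proof -
    have "?P \<in> carrier_mat (Suc n) (Suc n)"
      using four_block_carrier_mat[of "1\<^sub>m 1" 1 1 U n n "0\<^sub>m 1 n" "0\<^sub>m n 1"] DU' by simp
    moreover have "?P\<^sup>T = ?Q"
      by (subst transpose_four_block_mat[of _ 1 1 _ n _ n]) (use DU' in auto)
    ultimately show ?thesis by (simp add: transpose_mult[OF H] HT)
  qed
  have "diagonal_mat ?D"
    using D DU'(5) unfolding diagonal_mat_def by (auto simp: less_Suc_eq_0_disj) blast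
  with sim show ?case unfolding QH by blast
qed

text \<open>The permutation \<open>p\<close> sorts the diagonal of \<open>D\<close>, and the columns
  of \<open>U\<close> are reordered with it, so the index of an eigenvector agrees with the position
  of its eigenvalue in the sorted list of roots. Orthonormality and completeness are the two
  identities of the orthogonal matrix \<open>U\<close>.\<close>

lemma spectral_decomposition:
  fixes A :: "real mat"
  assumes A: "A \<in> carrier_mat n n" and sym: "A\<^sup>T = A"
  obtains e :: "nat \<Rightarrow> nat \<Rightarrow> real" and \<mu> :: "nat \<Rightarrow> real" where
    "\<And>i j. i < n \<Longrightarrow> j < n \<Longrightarrow> (\<Sum>u<n. e i u * e j u) = of_bool (i = j)"
    "\<And>u v. u < n \<Longrightarrow> v < n \<Longrightarrow> (\<Sum>i<n. e i u * e i v) = of_bool (u = v)"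
    "\<And>u v. u < n \<Longrightarrow> v < n \<Longrightarrow> A $$ (u, v) = (\<Sum>i<n. \<mu> i * e i u * e i v)"
    "\<And>i j. i \<le> j \<Longrightarrow> j < n \<Longrightarrow> \<mu> i \<le> \<mu> j"
    "sorted_list_of_multiset (proots (char_poly A)) = map \<mu> [0..<n]"
proof -
  obtain D U where DU: "similar_mat_wit A D U (U\<^sup>T)" and diag: "diagonal_mat D"
    using real_symmetric_diagonalizable[OF assms] by blast
  note w = similar_mat_witD2[OF A DU]
  define es where "es = sort (diag_mat D)"
  have len: "length (diag_mat D) = n" using w by (simp add: diag_mat_def)
  have "mset es = mset (diag_mat D)" by (simp add: es_def)
  then obtain p where p: "p permutes {..<n}" and es: "permute_list p (diag_mat D) = es"
    using mset_eq_permutation len by metis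
  have pn: "p i < n \<longleftrightarrow> i < n" for i using permutes_in_image[OF p] by simp
  have es_nth: "es ! i = D $$ (p i, p i)" if "i < n" for i
  proof -
    have "es ! i = diag_mat D ! p i" unfolding es[symmetric]
      using p that len by (intro permute_list_nth) auto
    then show ?thesis using that pn w by (simp add: diag_mat_def)
  qed
  define e where "e i u = U $$ (u, p i)" for i u
  have 1: "(\<Sum>u<n. e i u * e j u) = of_bool (i = j)" if ij: "i < n" "j < n" for i j
  proof -
    have "(U\<^sup>T * U) $$ (p i, p j) = (\<Sum>u<n. e i u * e j u)"
      using ij pn w(6) by (simp add: scalar_prod_def e_def lessThan_atLeast0)
    moreover have "p i = p j \<longleftrightarrow> i = j" using permutes_inj[OF p] by (auto dest: injD)
    moreover have "(U\<^sup>T * U) $$ (p i, p j) = of_bool (p i = p j)" using ij pn unfolding w(2) by simp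
    ultimately show ?thesis by simp
  qed
  have reindex: "(\<Sum>i<n. f (p i)) = (\<Sum>i<n. f i)" for f :: "nat \<Rightarrow> real"
    using sum.permute[OF p, of f] by (simp add: o_def)
  have 2: "(\<Sum>i<n. e i u * e i v) = of_bool (u = v)" if uv: "u < n" "v < n" for u v
  proof -
    have "(U * U\<^sup>T) $$ (u, v) = (\<Sum>i<n. U $$ (u, i) * U $$ (v, i))"
      using uv w(6) by (simp add: scalar_prod_def lessThan_atLeast0)
    also have "\<dots> = (\<Sum>i<n. e i u * e i v)"
      unfolding e_def by (rule reindex[symmetric, where f = "\<lambda>i. U $$ (u, i) * U $$ (v, i)"])
    finally have "1\<^sub>m n $$ (u, v) = (\<Sum>i<n. e i u * e i v)" unfolding w(1) .
    moreover have "1\<^sub>m n $$ (u, v) = (of_bool (u = v) :: real)" using uv by simp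
    ultimately show ?thesis by simp
  qed
  have 3: "A $$ (u, v) = (\<Sum>i<n. es ! i * e i u * e i v)" if uv: "u < n" "v < n" for u v
  proof -
    have UD: "(U * D) $$ (u, i) = U $$ (u, i) * D $$ (i, i)" if i: "i < n" for i
    proof -
      have "(U * D) $$ (u, i) = (\<Sum>j<n. U $$ (u, j) * D $$ (j, i))"
        using uv i w(5,6) by (simp add: scalar_prod_def lessThan_atLeast0)
      also have "\<dots> = (\<Sum>j<n. if j = i then U $$ (u, i) * D $$ (i, i) else 0)"
        using diag w(5) i by (intro sum.cong refl) (auto simp: diagonal_mat_def)
      finally show ?thesis using i by simp
    qed
    have "A $$ (u, v) = (U * D * U\<^sup>T) $$ (u, v)" unfolding w(3)[symmetric] ..
    also have "\<dots> = (\<Sum>i<n. (U * D) $$ (u, i) * U $$ (v, i))"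
      using uv w(5,6) by (simp add: scalar_prod_def lessThan_atLeast0 del: assoc_mult_mat)
    also have "\<dots> = (\<Sum>i<n. D $$ (i, i) * U $$ (u, i) * U $$ (v, i))"
      by (intro sum.cong refl) (simp add: UD mult_ac)
    also have "\<dots> = (\<Sum>i<n. D $$ (p i, p i) * U $$ (u, p i) * U $$ (v, p i))"
      by (rule reindex[symmetric, where f = "\<lambda>i. D $$ (i, i) * U $$ (u, i) * U $$ (v, i)"])
    also have "\<dots> = (\<Sum>i<n. es ! i * e i u * e i v)"
      by (intro sum.cong refl) (simp add: es_nth e_def)
    finally show ?thesis .
  qed
  have len_es: "length es = n" by (simp add: es_def len)
  have 4: "es ! i \<le> es ! j" if "i \<le> j" "j < n" for i j
    using sorted_nth_mono[of es i j] that len_es by (simp add: es_def)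
  have "char_poly A = char_poly D"
    using DU by (intro char_poly_similar) (auto simp: similar_mat_def)
  also have "\<dots> = (\<Prod>a\<leftarrow>diag_mat D. [:- a, 1:])"
    using diag w(5) by (intro char_poly_upper_triangular[of _ n]) (auto simp: diagonal_mat_def upper_triangular_def)
  finally have cp: "char_poly A = (\<Prod>a\<leftarrow>diag_mat D. [:- a, 1:])" .
  have "proots (\<Prod>a\<leftarrow>xs. [:- a, 1:]) = mset xs" for xs :: "real list"
  proof (induction xs)
    case (Cons a xs)
    have "(\<Prod>a\<leftarrow>xs. [:- a, 1:]) \<noteq> (0 :: real poly)" by (auto simp: prod_list_zero_iff)
    then have "proots ([:- a, 1:] * (\<Prod>a\<leftarrow>xs. [:- a, 1:])) = {#a#} + mset xs"
      by (subst proots_mult) (auto simp: Cons.IH)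
    then show ?case by simp
  qed simp
  then have "sorted_list_of_multiset (proots (char_poly A)) = es"
    by (simp add: cp es_def sorted_list_of_multiset_mset)
  also have "es = map (\<lambda>i. es ! i) [0..<n]" by (rule nth_equalityI) (simp_all add: len_es)
  finally have 5: "sorted_list_of_multiset (proots (char_poly A)) = map (\<lambda>i. es ! i) [0..<n]" .
  show thesis by (rule that[OF 1 2 3 4 5])
qed

section \<open>Greedy covering\<close>

text \<open>A greedy run picks a ball \<open>R v\<close> with the most uncovered points, but then removes the larger
  set \<open>C v\<close>.\<close>

fun greedy :: "(nat \<Rightarrow> nat set) \<Rightarrow> (nat \<Rightarrow> nat set) \<Rightarrow> nat \<Rightarrow> nat set \<Rightarrow> nat list \<Rightarrow> bool" where
  "greedy R C n U [] \<longleftrightarrow> True"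
| "greedy R C n U (v # vs) \<longleftrightarrow>
     v < n \<and> (\<forall>w<n. card (R w \<inter> U) \<le> card (R v \<inter> U)) \<and> greedy R C n (U - C v) vs"

text \<open>The program finds the centers from left to right, while \<open>greedy\<close> and the
  charging induction peel off the first one. This form extends a loop invariant by one
  round.\<close>

lemma greedy_snoc:
  "greedy R C n U (vs @ [v]) \<longleftrightarrow> greedy R C n U vs \<and>
     v < n \<and> (\<forall>w<n. card (R w \<inter> (U - \<Union>(C ` set vs))) \<le> card (R v \<inter> (U - \<Union>(C ` set vs))))"
proof (induction vs arbitrary: U)
  case (Cons a vs)
  have "U - C a - \<Union>(C ` set vs) = U - \<Union>(C ` set (a # vs))" by auto
  then show ?case by (simp add: Cons.IH)
qed simp

lemma greedy_centers: "greedy R C n U vs \<Longrightarrow> set vs \<subseteq> {..<n}"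
  by (induction vs arbitrary: U) auto

text \<open>The charging argument of Charikar, Khuller, Mount and Narasimhan for the \<open>k\<close>-center problem
  with outliers: if the ball \<open>R v\<close> picked first meets an uncovered point of an optimal ball, then
  \<open>C v\<close> swallows that optimal ball; otherwise \<open>R v\<close> gains at least as many points as any optimal
  ball loses.\<close>

lemma greedy_covers:
  assumes "finite U" and "greedy R C n U vs" and "length ws = length vs" and "set ws \<subseteq> {..<n}"
    and RC: "\<And>v. R v \<subseteq> C v"
    and meet: "\<And>v w. v < n \<Longrightarrow> w < n \<Longrightarrow> R v \<inter> R w \<noteq> {} \<Longrightarrow> R w \<subseteq> C v"
  shows "card (U \<inter> \<Union>(R ` set ws)) \<le> card (U \<inter> \<Union>(C ` set vs))"
  using assms(1-4)
proof (induction vs arbitrary: U ws)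
  case Nil
  then show ?case by simp
next
  case (Cons v vs)
  define G where "G = R v \<inter> U"
  define D where "D = C v \<inter> U"
  have fin: "finite A" if "A \<subseteq> U" for A using that Cons.prems(1) finite_subset by blast
  have GD: "G \<subseteq> D" using RC[of v] by (auto simp: G_def D_def)
  have v: "v < n" and best: "\<And>w. w < n \<Longrightarrow> card (R w \<inter> U) \<le> card G"
    and run: "greedy R C n (U - C v) vs"
    using Cons.prems(2) by (auto simp: G_def)
  \<comment> \<open>An optimal ball that meets the new gain \<open>G\<close> is dropped if there is
    one, otherwise an arbitrary one. Centers may repeat, so \<open>w\<close> can still occur in
    \<open>ws'\<close>.\<close>
  obtain w ws' where perm: "set ws = insert w (set ws')" and len: "length ws' = length vs"
    and w: "(\<exists>w'\<in>set ws. R w' \<inter> G \<noteq> {}) \<longrightarrow> R w \<inter> G \<noteq> {}"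
  proof (cases "\<exists>w'\<in>set ws. R w' \<inter> G \<noteq> {}")
    case True
    then obtain w where w: "w \<in> set ws" "R w \<inter> G \<noteq> {}" by blast
    obtain us zs where "ws = us @ w # zs" using split_list[OF w(1)] by blast
    then show ?thesis
      using that[of w "us @ zs"] Cons.prems(3) w(2) by simp
  next
    case False
    then show ?thesis
      using that[of "hd ws" "tl ws"] Cons.prems(3) by (cases ws) simp_all
  qed
  have wn: "w < n" "set ws' \<subseteq> {..<n}" using Cons.prems(4) perm by auto
  define O' where "O' = \<Union>(R ` set ws')"
  have IH: "card ((U - C v) \<inter> O') \<le> card ((U - C v) \<inter> \<Union>(C ` set vs))"
    unfolding O'_def using Cons.prems(1) run len wn(2) by (intro Cons.IH) auto
  have split: "card (U \<inter> \<Union>(C ` set (v # vs))) = card D + card ((U - C v) \<inter> \<Union>(C ` set vs))"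
  proof -
    have "U \<inter> \<Union>(C ` set (v # vs)) = D \<union> ((U - C v) \<inter> \<Union>(C ` set vs))"
      by (auto simp: D_def)
    moreover have "D \<inter> ((U - C v) \<inter> \<Union>(C ` set vs)) = {}" by (auto simp: D_def)
    ultimately show ?thesis by (simp add: card_Un_disjoint fin D_def Int_lower2 Diff_Int_distrib2)
  qed
  have "card (U \<inter> \<Union>(R ` set ws)) \<le> card D + card ((U - C v) \<inter> O')"
  proof (cases "R w \<inter> G = {}")
    case False
    then have "R w \<subseteq> C v" using meet[OF v wn(1)] by (auto simp: G_def)
    then have "U \<inter> \<Union>(R ` set ws) \<subseteq> D \<union> ((U - C v) \<inter> O')"
      unfolding perm O'_def D_def by auto
    then have "card (U \<inter> \<Union>(R ` set ws)) \<le> card (D \<union> ((U - C v) \<inter> O'))"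
      by (intro card_mono fin) (auto simp: D_def)
    also have "\<dots> \<le> card D + card ((U - C v) \<inter> O')" by (rule card_Un_le)
    finally show ?thesis .
  next
    case True
    have disj: "R w' \<inter> G = {}" if "w' \<in> set ws" for w' using w that True by blast
    \<comment> \<open>No optimal ball meets \<open>G\<close>, so what they cover inside
      \<open>C v\<close> lies in \<open>D - G\<close>. The dropped ball has at most
      \<open>card G\<close> uncovered points by the greedy choice, and \<open>G\<close> compensates
      for these.\<close>
    have "U \<inter> \<Union>(R ` set ws) \<subseteq> (R w \<inter> U) \<union> (D - G) \<union> ((U - C v) \<inter> O')"
      using disj unfolding perm O'_def D_def G_def by blast
    then have "card (U \<inter> \<Union>(R ` set ws)) \<le> card ((R w \<inter> U) \<union> (D - G) \<union> ((U - C v) \<inter> O'))"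
      by (intro card_mono fin) (auto simp: D_def)
    also have "\<dots> \<le> card (R w \<inter> U) + card (D - G) + card ((U - C v) \<inter> O')"
      by (meson add_le_mono1 card_Un_le le_trans)
    also have "card (R w \<inter> U) \<le> card G" by (rule best[OF wn(1)])
    also have "card G + card (D - G) = card D"
      using GD by (simp add: card_Diff_subset card_mono fin D_def G_def)
    finally show ?thesis by simp
  qed
  with IH split show ?case by linarith
qed

section \<open>Spectral clustering of a regular graph\<close>

lemma normalized_laplacian_carrier: "normalized_laplacian n r E \<in> carrier_mat n n"
  unfolding normalized_laplacian_def adjacency_matrix_def
  by (intro minus_carrier_mat smult_carrier_mat mat_carrier)

lemma normalized_laplacian_entry:
  "u < n \<Longrightarrow> v < n \<Longrightarrow>
    normalized_laplacian n r E $$ (u, v) = of_bool (u = v) - of_bool ((u, v) \<in> E) / real r"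
  by (simp add: normalized_laplacian_def adjacency_matrix_def)

lemma normalized_laplacian_sym:
  assumes "regular_graph n r E"
  shows "(normalized_laplacian n r E)\<^sup>T = normalized_laplacian n r E"
proof (rule eq_matI)
  fix u v assume "u < dim_row (normalized_laplacian n r E)" "v < dim_col (normalized_laplacian n r E)"
  then have "u < n" "v < n" using normalized_laplacian_carrier[of n r E] by auto
  moreover have "(v, u) \<in> E \<longleftrightarrow> (u, v) \<in> E" using assms by (auto simp: regular_graph_def sym_def)
  ultimately show "(normalized_laplacian n r E)\<^sup>T $$ (u, v) = normalized_laplacian n r E $$ (u, v)"
    using normalized_laplacian_carrier[of n r E] by (auto simp: normalized_laplacian_entry)
qed (use normalized_laplacian_carrier[of n r E] in auto)

lemma sum_over_edges:
  fixes F :: "nat \<Rightarrow> nat \<Rightarrow> real"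
  assumes "regular_graph n r E"
  shows "(\<Sum>(u, v)\<in>E. F u v) = (\<Sum>u<n. \<Sum>v\<in>E `` {u}. F u v)"
proof -
  have "E \<subseteq> {..<n} \<times> {..<n}" using assms by (simp add: regular_graph_def)
  then have E: "E = Sigma {..<n} (\<lambda>u. E `` {u})" and fin: "\<And>u. finite (E `` {u})"
    by (auto intro: finite_subset[of _ "{..<n}"])
  show ?thesis by (subst (1) E) (simp add: sum.Sigma fin)
qed

lemma sum_over_edges_fst:
  assumes "regular_graph n r E"
  shows "(\<Sum>(u, v)\<in>E. f u) = real r * (\<Sum>u<n. f u)"
  unfolding sum_over_edges[OF assms] sum_distrib_left
  using assms by (intro sum.cong refl) (simp add: regular_graph_def)

lemma sum_over_edges_snd:
  assumes "regular_graph n r E"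
  shows "(\<Sum>(u, v)\<in>E. f v) = real r * (\<Sum>u<n. f u)"
proof -
  have "(\<Sum>(u, v)\<in>E. f v) = (\<Sum>(u, v)\<in>E. f u)"
    using assms
    by (intro sum.reindex_bij_witness[of _ prod.swap prod.swap]) (auto simp: regular_graph_def sym_def)
  then show ?thesis by (simp add: sum_over_edges_fst[OF assms])
qed

text \<open>\<open>F\<close> is arbitrary because two choices matter: \<open>f u * f v\<close> gives
  the quadratic form, and a kernel gives the trace of \<open>K L\<close>.\<close>

lemma laplacian_sum:
  assumes G: "regular_graph n r E"
  shows "(\<Sum>u<n. \<Sum>v<n. normalized_laplacian n r E $$ (u, v) * F u v)
    = (\<Sum>u<n. F u u) - (\<Sum>(u, v)\<in>E. F u v) / real r"
proof -
  have sub: "E `` {u} \<subseteq> {..<n}" for u using G by (auto simp: regular_graph_def)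
  have "(\<Sum>v<n. normalized_laplacian n r E $$ (u, v) * F u v) = F u u - (\<Sum>v\<in>E `` {u}. F u v) / real r"
    if "u < n" for u
  proof -
    have "(\<Sum>v<n. normalized_laplacian n r E $$ (u, v) * F u v)
        = (\<Sum>v<n. (if v = u then F u u else 0) - (if v \<in> E `` {u} then F u v else 0) / real r)"
      using that by (intro sum.cong refl) (auto simp: normalized_laplacian_entry algebra_simps)
    also have "\<dots> = F u u - (\<Sum>v<n. if v \<in> E `` {u} then F u v else 0) / real r"
      using that by (simp add: sum_subtractf sum_divide_distrib)
    also have "(\<Sum>v<n. if v \<in> E `` {u} then F u v else 0) = (\<Sum>v\<in>E `` {u}. F u v)"
      unfolding sum.inter_restrict[OF finite_lessThan, symmetric] Int_absorb1[OF sub] ..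
    finally show ?thesis .
  qed
  then show ?thesis
    by (simp add: sum_over_edges[OF G] sum_subtractf sum_divide_distrib)
qed

lemma laplacian_quadratic_form:
  assumes G: "regular_graph n r E"
  shows "(\<Sum>u<n. \<Sum>v<n. normalized_laplacian n r E $$ (u, v) * (f u * f v))
    = (\<Sum>(u, v)\<in>E. (f u - f v)\<^sup>2) / (2 * real r)"
proof -
  have r: "real r > 0" using G by (simp add: regular_graph_def)
  have "(\<Sum>(u, v)\<in>E. (f u - f v)\<^sup>2) = (\<Sum>(u, v)\<in>E. (f u)\<^sup>2) + (\<Sum>(u, v)\<in>E. (f v)\<^sup>2) - 2 * (\<Sum>(u, v)\<in>E. f u * f v)"
    unfolding sum.distrib[symmetric] sum_subtractf[symmetric] sum_distrib_left
    by (intro sum.cong refl) (auto simp: power2_diff)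
  also have "\<dots> = 2 * real r * (\<Sum>u<n. f u * f u) - 2 * (\<Sum>(u, v)\<in>E. f u * f v)"
    unfolding sum_over_edges_fst[OF G] sum_over_edges_snd[OF G, of "\<lambda>v. (f v)\<^sup>2"]
    by (simp add: power2_eq_square)
  finally have eq: "(\<Sum>(u, v)\<in>E. (f u - f v)\<^sup>2)
      = 2 * real r * (\<Sum>u<n. f u * f u) - 2 * (\<Sum>(u, v)\<in>E. f u * f v)" .
  show ?thesis unfolding laplacian_sum[OF G] eq using r by (simp add: diff_divide_distrib)
qed

text \<open>The third conclusion is the spectral decomposition paired with an arbitrary matrix
  \<open>F\<close>. For \<open>F u v = e i u * e i v\<close> the pairing is \<open>\<mu> i\<close>,
  and the quadratic form exhibits it as a sum of squares, hence nonnegative.\<close>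

lemma laplacian_eigenbasis:
  assumes G: "regular_graph n r E"
  obtains e :: "nat \<Rightarrow> nat \<Rightarrow> real" and \<mu> :: "nat \<Rightarrow> real" where
    "\<And>i j. i < n \<Longrightarrow> j < n \<Longrightarrow> (\<Sum>u<n. e i u * e j u) = of_bool (i = j)"
    "\<And>u v. u < n \<Longrightarrow> v < n \<Longrightarrow> (\<Sum>i<n. e i u * e i v) = of_bool (u = v)"
    "\<And>F. (\<Sum>u<n. \<Sum>v<n. normalized_laplacian n r E $$ (u, v) * F u v)
       = (\<Sum>i<n. \<mu> i * (\<Sum>u<n. \<Sum>v<n. F u v * e i u * e i v))"
    "\<And>i j. i \<le> j \<Longrightarrow> j < n \<Longrightarrow> \<mu> i \<le> \<mu> j"
    "\<And>i. i < n \<Longrightarrow> 0 \<le> \<mu> i"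
    "\<And>k. 1 \<le> k \<Longrightarrow> k \<le> n \<Longrightarrow> laplacian_eigenvalue n r E k = \<mu> (k - 1)"
proof -
  let ?L = "normalized_laplacian n r E"
  obtain e \<mu> where ON: "\<And>i j. i < n \<Longrightarrow> j < n \<Longrightarrow> (\<Sum>u<n. e i u * e j u) = of_bool (i = j)"
    and cmpl: "\<And>u v. u < n \<Longrightarrow> v < n \<Longrightarrow> (\<Sum>i<n. e i u * e i v) = of_bool (u = v)"
    and L: "\<And>u v. u < n \<Longrightarrow> v < n \<Longrightarrow> ?L $$ (u, v) = (\<Sum>i<n. \<mu> i * e i u * e i v)"
    and mono: "\<And>i j. i \<le> j \<Longrightarrow> j < n \<Longrightarrow> \<mu> i \<le> \<mu> j"
    and roots: "sorted_list_of_multiset (proots (char_poly ?L)) = map \<mu> [0..<n]"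
    by (rule spectral_decomposition[OF normalized_laplacian_carrier normalized_laplacian_sym[OF G]]) (rule that)
  have L_sum: "(\<Sum>u<n. \<Sum>v<n. ?L $$ (u, v) * F u v)
       = (\<Sum>i<n. \<mu> i * (\<Sum>u<n. \<Sum>v<n. F u v * e i u * e i v))" for F
  proof -
    have "(\<Sum>u<n. \<Sum>v<n. ?L $$ (u, v) * F u v)
        = (\<Sum>u<n. \<Sum>v<n. \<Sum>i<n. \<mu> i * (F u v * e i u * e i v))"
      by (intro sum.cong refl) (simp add: L sum_distrib_left mult_ac)
    also have "\<dots> = (\<Sum>u<n. \<Sum>i<n. \<Sum>v<n. \<mu> i * (F u v * e i u * e i v))"
      by (intro sum.cong refl sum.swap)
    also have "\<dots> = (\<Sum>i<n. \<Sum>u<n. \<Sum>v<n. \<mu> i * (F u v * e i u * e i v))"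
      by (rule sum.swap)
    finally show ?thesis by (simp add: sum_distrib_left)
  qed
  have nonneg: "0 \<le> \<mu> i" if i: "i < n" for i
  proof -
    have "(\<Sum>u<n. \<Sum>v<n. ?L $$ (u, v) * (e i u * e i v))
       = (\<Sum>j<n. \<mu> j * (\<Sum>u<n. e i u * e j u)\<^sup>2)"
      unfolding L_sum power2_eq_square sum_product by (intro sum.cong refl) (simp add: mult_ac)
    also have "\<dots> = (\<Sum>j<n. if j = i then \<mu> i else 0)"
      using i by (intro sum.cong refl) (auto simp: ON)
    also have "\<dots> = \<mu> i" using i by simp
    finally have "\<mu> i = (\<Sum>(u, v)\<in>E. (e i u - e i v)\<^sup>2) / (2 * real r)"
      unfolding laplacian_quadratic_form[OF G] by (rule HOL.sym)
    then show ?thesis by (simp add: sum_nonneg case_prod_unfold)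
  qed
  have ev: "laplacian_eigenvalue n r E k = \<mu> (k - 1)" if "1 \<le> k" "k \<le> n" for k
    using that by (simp add: laplacian_eigenvalue_def roots)
  show thesis by (rule that[OF ON cmpl L_sum mono nonneg ev])
qed

text \<open>The constant function has energy 0. If all eigenvalues were positive, it would be
  orthogonal to the whole eigenbasis, against Parseval's identity. This excludes
  \<open>k = 1\<close>, where \<open>ln k = 0\<close> reduces the eigenvalue condition to positivity
  of the first eigenvalue.\<close>

lemma laplacian_eigenvalue_1:
  assumes G: "regular_graph n r E" and n: "1 \<le> n"
  shows "laplacian_eigenvalue n r E 1 \<le> 0"
proof (rule ccontr)
  assume neg: "\<not> laplacian_eigenvalue n r E 1 \<le> 0"
  let ?L = "normalized_laplacian n r E"
  obtain e \<mu> where cmpl: "\<And>u v. u < n \<Longrightarrow> v < n \<Longrightarrow> (\<Sum>i<n. e i u * e i v) = of_bool (u = v)"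
    and L_sum: "\<And>F. (\<Sum>u<n. \<Sum>v<n. ?L $$ (u, v) * F u v)
       = (\<Sum>i<n. \<mu> i * (\<Sum>u<n. \<Sum>v<n. F u v * e i u * e i v))"
    and mono: "\<And>i j. i \<le> j \<Longrightarrow> j < n \<Longrightarrow> \<mu> i \<le> \<mu> j"
    and ev: "\<And>k. 1 \<le> k \<Longrightarrow> k \<le> n \<Longrightarrow> laplacian_eigenvalue n r E k = \<mu> (k - 1)"
    by (rule laplacian_eigenbasis[OF G]) (rule that)
  define s where "s i = (\<Sum>u<n. e i u)\<^sup>2" for i
  have pos: "0 < \<mu> i" if "i < n" for i
    using mono[of 0 i] that neg ev[of 1] n by simp
  have s_eq: "s i = (\<Sum>u<n. \<Sum>v<n. (1 * 1) * e i u * e i v)" for i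
    by (simp add: s_def power2_eq_square sum_product)
  have "(\<Sum>i<n. \<mu> i * s i) = (\<Sum>u<n. \<Sum>v<n. ?L $$ (u, v) * ((\<lambda>_. 1) u * (\<lambda>_. 1) v))"
    unfolding L_sum s_eq ..
  also have "\<dots> = 0" unfolding laplacian_quadratic_form[OF G, of "\<lambda>_. 1"] by simp
  finally have "(\<Sum>i<n. \<mu> i * s i) = 0" .
  moreover have "0 \<le> \<mu> i * s i" if "i < n" for i using pos[OF that] by (simp add: s_def)
  ultimately have "\<mu> i * s i = 0" if "i < n" for i
    using that by (subst (asm) sum_nonneg_eq_0_iff) auto
  then have "s i = 0" if "i < n" for i using that pos[of i] by fastforce
  then have "(\<Sum>i<n. s i) = 0" by simp
  moreover have "(\<Sum>i<n. s i) = real n"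
  proof -
    have "(\<Sum>i<n. s i) = (\<Sum>i<n. \<Sum>u<n. \<Sum>v<n. e i u * e i v)" by (simp add: s_eq)
    also have "\<dots> = (\<Sum>u<n. \<Sum>i<n. \<Sum>v<n. e i u * e i v)" by (rule sum.swap)
    also have "\<dots> = (\<Sum>u<n. \<Sum>v<n. \<Sum>i<n. e i u * e i v)" by (intro sum.cong refl sum.swap)
    also have "\<dots> = (\<Sum>u<n. \<Sum>v<n. of_bool (u = v))" by (intro sum.cong refl) (simp add: cmpl)
    also have "\<dots> = (\<Sum>u<n. \<Sum>v<n. if v = u then 1 else 0)" by (intro sum.cong refl) auto
    also have "\<dots> = real n" by simp
    finally show ?thesis .
  qed
  ultimately show False using n by simp
qed

section \<open>From the spectrum to a cover by few balls\<close>

lemma kernel_form_cong: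
  assumes "\<And>u. u < n \<Longrightarrow> f u = f' u" and "\<And>u. u < n \<Longrightarrow> g u = g' u"
  shows "kernel_form n K f g = kernel_form n K f' g'"
  unfolding kernel_form_def using assms by (intro sum.cong refl) auto

text \<open>The residuals of the unit vectors after removing the low eigenvectors have small total energy,
  since the trace of \<open>K L\<close> is an average over the edges.\<close>

lemma (in psd_kernel) high_frequency_energy:
  assumes G: "regular_graph n r E" and K1: "\<And>u. u < n \<Longrightarrow> K u u = 1"
    and k: "1 \<le> k" "k \<le> n"
  obtains e :: "nat \<Rightarrow> nat \<Rightarrow> real" where
    "laplacian_eigenvalue n r E k *
       (\<Sum>v<n. B (\<lambda>u. unit v u - (\<Sum>i<k-1. e i v * e i u)) (\<lambda>u. unit v u - (\<Sum>i<k-1. e i v * e i u)))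
     \<le> (\<Sum>(u, v)\<in>E. 1 - K u v) / real r"
proof -
  let ?L = "normalized_laplacian n r E"
  obtain e \<mu> where ON: "\<And>i j. i < n \<Longrightarrow> j < n \<Longrightarrow> (\<Sum>u<n. e i u * e j u) = of_bool (i = j)"
    and cmpl: "\<And>u v. u < n \<Longrightarrow> v < n \<Longrightarrow> (\<Sum>i<n. e i u * e i v) = of_bool (u = v)"
    and L_sum: "\<And>F. (\<Sum>u<n. \<Sum>v<n. ?L $$ (u, v) * F u v)
       = (\<Sum>i<n. \<mu> i * (\<Sum>u<n. \<Sum>v<n. F u v * e i u * e i v))"
    and mono: "\<And>i j. i \<le> j \<Longrightarrow> j < n \<Longrightarrow> \<mu> i \<le> \<mu> j"
    and nonneg: "\<And>i. i < n \<Longrightarrow> 0 \<le> \<mu> i"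
    and ev: "\<And>k. 1 \<le> k \<Longrightarrow> k \<le> n \<Longrightarrow> laplacian_eigenvalue n r E k = \<mu> (k - 1)"
    by (rule laplacian_eigenbasis[OF G]) (rule that)
  \<comment> \<open>Indices start at 0, so the \<open>k\<close>-th smallest eigenvalue is
    \<open>\<mu> (k - 1)\<close>, and \<open>I\<close> indexes the eigenvectors from the
    \<open>k\<close>-th on.\<close>
  define I where "I = {k-1..<n}"
  have In: "i < n" if "i \<in> I" for i using that by (simp add: I_def)
  define q where "q v u = unit v u - (\<Sum>i<k-1. e i v * e i u)" for v u
  have q: "q v u = (\<Sum>i\<in>I. e i v * e i u)" if "u < n" "v < n" for u v
  proof -
    have "{..<n} = {..<k-1} \<union> I" "{..<k-1} \<inter> I = {}" using k by (auto simp: I_def)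
    then have "(\<Sum>i<n. e i v * e i u) = (\<Sum>i<k-1. e i v * e i u) + (\<Sum>i\<in>I. e i v * e i u)"
      by (simp add: sum.union_disjoint I_def)
    then show ?thesis using cmpl[OF that(2,1)] by (auto simp: q_def unit_def)
  qed
  \<comment> \<open>The eigenvectors are orthonormal for the standard inner product, not for
    \<open>B\<close>. Summing over all \<open>v\<close> removes the mixed terms nevertheless, since
    the coefficients \<open>e i v\<close> are themselves entries of the eigenvectors.\<close>
  have "(\<Sum>v<n. B (q v) (q v)) = (\<Sum>v<n. \<Sum>i\<in>I. \<Sum>j\<in>I. (e i v * e j v) * B (e i) (e j))"
  proof (intro sum.cong refl)
    fix v assume "v \<in> {..<n}"
    then have v: "v < n" by simp
    define s where "s u = (\<Sum>i\<in>I. e i v * e i u)" for u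
    have s: "B s h = (\<Sum>i\<in>I. e i v * B (e i) h)" for h
      unfolding s_def by (rule kernel_form_sum)
    have "B (q v) (q v) = B s s"
      unfolding s_def using q v by (intro kernel_form_cong) auto
    also have "\<dots> = (\<Sum>i\<in>I. e i v * B s (e i))" unfolding s[of s] commute[of "e _" s] ..
    also have "\<dots> = (\<Sum>i\<in>I. \<Sum>j\<in>I. (e i v * e j v) * B (e i) (e j))"
      unfolding s sum_distrib_left
      by (intro sum.cong refl) (simp add: commute[of "e j" "e i" for i j] mult.assoc)
    finally show "B (q v) (q v) = (\<Sum>i\<in>I. \<Sum>j\<in>I. (e i v * e j v) * B (e i) (e j))" .
  qed
  also have "\<dots> = (\<Sum>i\<in>I. \<Sum>v<n. \<Sum>j\<in>I. (e i v * e j v) * B (e i) (e j))" by (rule sum.swap)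
  also have "\<dots> = (\<Sum>i\<in>I. \<Sum>j\<in>I. \<Sum>v<n. (e i v * e j v) * B (e i) (e j))"
    by (intro sum.cong refl sum.swap)
  also have "\<dots> = (\<Sum>i\<in>I. \<Sum>j\<in>I. if j = i then B (e i) (e i) else 0)"
    by (intro sum.cong refl) (auto simp: sum_distrib_right[symmetric] ON In)
  also have "\<dots> = (\<Sum>i\<in>I. B (e i) (e i))" by (simp add: I_def)
  finally have trace: "(\<Sum>v<n. B (q v) (q v)) = (\<Sum>i\<in>I. B (e i) (e i))" .
  have "\<mu> (k - 1) * (\<Sum>i\<in>I. B (e i) (e i)) \<le> (\<Sum>i\<in>I. \<mu> i * B (e i) (e i))"
    unfolding sum_distrib_left
    by (intro sum_mono mult_right_mono psd mono) (auto simp: I_def)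
  also have "\<dots> \<le> (\<Sum>i<n. \<mu> i * B (e i) (e i))"
    using nonneg psd by (intro sum_mono2) (auto simp: I_def)
  also have "\<dots> = (\<Sum>u<n. \<Sum>v<n. ?L $$ (u, v) * K u v)"
    unfolding L_sum kernel_form_def ..
  also have "\<dots> = (\<Sum>(u, v)\<in>E. 1 - K u v) / real r"
  proof -
    have "(\<Sum>u<n. K u u) = (\<Sum>u<n. 1)" using K1 by (intro sum.cong) auto
    moreover have "(\<Sum>(u, v)\<in>E. 1 - K u v) = (\<Sum>(u, v)\<in>E. 1) - (\<Sum>(u, v)\<in>E. K u v)"
      by (simp add: sum_subtractf case_prod_unfold)
    moreover have "(\<Sum>(u, v)\<in>E. 1) = real r * (\<Sum>u<n. 1)"
      using sum_over_edges_fst[OF G, of "\<lambda>_. 1"] by simp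
    ultimately show ?thesis
      using G unfolding laplacian_sum[OF G] by (simp add: diff_divide_distrib regular_graph_def)
  qed
  finally have "laplacian_eigenvalue n r E k * (\<Sum>v<n. B (q v) (q v)) \<le> (\<Sum>(u, v)\<in>E. 1 - K u v) / real r"
    unfolding trace ev[OF k] .
  then show thesis unfolding q_def by (rule that)
qed

text \<open>Of the total energy 2k + 1 of 2k + 1 unit vectors, a span of dimension k - 1 can absorb
  at most (k - 1) 11/8, while closeness to the span would leave at most (2k + 1)/4; these are
  incompatible.\<close>

lemma (in psd_kernel) separated_set_small:
  fixes w c :: "nat \<Rightarrow> nat \<Rightarrow> real"
  assumes S: "S \<subseteq> {..<n}" and k: "1 \<le> k"
    and diag: "\<And>v. v \<in> S \<Longrightarrow> K v v = 1"
    and off: "\<And>u v. u \<in> S \<Longrightarrow> v \<in> S \<Longrightarrow> u \<noteq> v \<Longrightarrow> 0 \<le> K u v \<and> K u v \<le> 1 / (8 * real k)"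
    and close: "\<And>v. v \<in> S \<Longrightarrow>
      B (\<lambda>u. unit v u - (\<Sum>i<k-1. c i v * w i u)) (\<lambda>u. unit v u - (\<Sum>i<k-1. c i v * w i u)) \<le> 1 / 4"
  shows "card S \<le> 2 * k"
proof (rule ccontr)
  assume "\<not> card S \<le> 2 * k"
  \<comment> \<open>The Bessel constant grows with the cardinality, so the set is first cut down to
    2k + 1 points. Then it is 1 + (2k + 1)/(8k), which is at most 11/8 as soon as k \<ge> 1.\<close>
  then obtain S' where S': "S' \<subseteq> S" "card S' = 2 * k + 1"
    by (metis Suc_eq_plus1 not_less_eq_eq obtain_subset_with_card_n)
  define M where "M = 1 + real (card S') * (1 / (8 * real k))"
  have "M = 1 + (2 * real k + 1) / (8 * real k)" by (simp add: M_def S'(2))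
  also have "\<dots> \<le> 11 / 8" using k by (simp add: field_simps)
  finally have M: "M \<le> 11 / 8" .
  have bes: "(\<Sum>v\<in>S'. (B (unit v) h)\<^sup>2) \<le> M * B h h" for h
    unfolding M_def
  proof (rule bessel_near_orthonormal)
    show "S' \<subseteq> {..<n}" using S S'(1) by blast
    show "K v v = 1" if "v \<in> S'" for v using diag that S'(1) by blast
    show "0 \<le> K u v \<and> K u v \<le> 1 / (8 * real k)" if "u \<in> S'" "v \<in> S'" "u \<noteq> v" for u v
      by (rule off) (use that S'(1) in blast)+
  qed simp
  have "(\<Sum>v\<in>S'. B (unit v) (unit v)) - real (k - 1) * M
    \<le> (\<Sum>v\<in>S'. B (\<lambda>u. unit v u - (\<Sum>i<k-1. c i v * w i u)) (\<lambda>u. unit v u - (\<Sum>i<k-1. c i v * w i u)))"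
    using distance_to_span[where a = unit and c = "\<lambda>v i. c i v" and w = w and d = "k - 1", OF _ bes]
    by (simp add: M_def)
  also have "\<dots> \<le> (\<Sum>v\<in>S'. 1 / 4)" using S' close by (intro sum_mono) auto
  finally have "(\<Sum>v\<in>S'. B (unit v) (unit v)) - real (k - 1) * M \<le> real (card S') / 4" by simp
  moreover have "(\<Sum>v\<in>S'. B (unit v) (unit v)) = (\<Sum>v\<in>S'. 1)"
  proof (intro sum.cong refl)
    fix v assume v: "v \<in> S'"
    then have "v < n" using S S' by auto
    then show "B (unit v) (unit v) = 1" using form_unit[of v v] diag v S' by auto
  qed
  moreover have "real (k - 1) * M \<le> real (k - 1) * (11 / 8)" using M by (intro mult_left_mono) auto
  ultimately show False using k by (simp add: S'(2) of_nat_diff field_simps)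
qed

lemma maximal_separated_subset:
  assumes "finite A" and refl: "\<And>v. v \<in> A \<Longrightarrow> near v v" and sym: "\<And>u v. near u v \<Longrightarrow> near v u"
  obtains S where "S \<subseteq> A" "\<And>u v. u \<in> S \<Longrightarrow> v \<in> S \<Longrightarrow> u \<noteq> v \<Longrightarrow> \<not> near u v"
    "\<And>v. v \<in> A \<Longrightarrow> \<exists>u\<in>S. near u v"
proof -
  define F where "F = {S. S \<subseteq> A \<and> (\<forall>u\<in>S. \<forall>v\<in>S. u \<noteq> v \<longrightarrow> \<not> near u v)}"
  have "finite F" using assms(1) by (simp add: F_def)
  moreover have "{} \<in> F" by (simp add: F_def)
  ultimately obtain S where S: "S \<in> F" and max: "\<And>S'. S' \<in> F \<Longrightarrow> S \<subseteq> S' \<Longrightarrow> S' = S"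
    using finite_has_maximal[of F] by blast
  have cover: "\<exists>u\<in>S. near u v" if v: "v \<in> A" for v
  proof (rule ccontr)
    assume far: "\<not> (\<exists>u\<in>S. near u v)"
    then have "insert v S \<in> F" using S v sym by (auto simp: F_def)
    then have "v \<in> S" using max by blast
    then show False using far refl[OF v] by blast
  qed
  show thesis
    by (rule that[of S]) (use S cover in \<open>auto simp: F_def\<close>)
qed

abbreviation sq_dist :: "nat \<Rightarrow> (nat \<Rightarrow> nat \<Rightarrow> real) \<Rightarrow> nat \<Rightarrow> nat \<Rightarrow> real" where
  "sq_dist m y u v \<equiv> \<Sum>j<m. (y u j - y v j)\<^sup>2"

text \<open>The residuals have total energy at most 2 n t E / \<lambda>, where E is the energy and
  \<lambda> the eigenvalue. The factor 8 in \<open>large\<close> makes this at most \<epsilon> n /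
  4, and Markov's inequality at the threshold 1/4 leaves at most \<epsilon> n bad vertices. The
  centers are a maximal separated set among the good vertices, so every good vertex is near a
  center.\<close>

lemma few_balls_cover:
  assumes G: "regular_graph n r E" and k: "2 \<le> k" "k \<le> n" and rho: "0 < \<rho>" and eps: "0 < \<epsilon>"
    and large: "8 * ln (8 * real k) * energy n r E (sq_dist m y) < laplacian_eigenvalue n r E k * \<epsilon> * \<rho>"
  shows "\<exists>ws. length ws = 2 * k \<and> set ws \<subseteq> {..<n} \<and>
    (1 - \<epsilon>) * real n \<le> real (card ({..<n} \<inter> (\<Union>w\<in>set ws. {v. sq_dist m y w v \<le> \<rho>})))"
proof -
  define d where "d = sq_dist m y"
  have d_sym: "d u v = d v u" for u v unfolding d_def by (simp only: power2_commute[of "y u j" "y v j" for j])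
  have d0: "d v v = 0" and d_nonneg: "0 \<le> d u v" for u v by (simp_all add: d_def sum_nonneg)
  define t where "t = ln (8 * real k) / \<rho>"
  have t: "0 \<le> t" using rho k by (simp add: t_def)
  define K where "K u v = exp (- t * d u v)" for u v
  interpret psd_kernel n K unfolding K_def d_def by (rule gaussian_psd[OF t])
  have K1: "K u u = 1" for u by (simp add: K_def d0)
  let ?ev = "laplacian_eigenvalue n r E k"
  have r: "0 < r" using G by (simp add: regular_graph_def)
  have en: "0 \<le> energy n r E d"
    unfolding energy_def by (intro mult_nonneg_nonneg sum_nonneg) (auto simp: d_nonneg)
  obtain e where e: "?ev *
       (\<Sum>v<n. B (\<lambda>u. unit v u - (\<Sum>i<k-1. e i v * e i u)) (\<lambda>u. unit v u - (\<Sum>i<k-1. e i v * e i u)))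
     \<le> (\<Sum>(u, v)\<in>E. 1 - K u v) / real r"
    using high_frequency_energy[OF G K1, of k] k by auto
  define R where "R v = B (\<lambda>u. unit v u - (\<Sum>i<k-1. e i v * e i u)) (\<lambda>u. unit v u - (\<Sum>i<k-1. e i v * e i u))" for v
  have R_nonneg: "0 \<le> R v" for v unfolding R_def by (rule psd)
  have "(\<Sum>(u, v)\<in>E. 1 - K u v) \<le> (\<Sum>(u, v)\<in>E. t * d u v)"
  proof (intro sum_mono, clarify)
    fix u v
    show "1 - K u v \<le> t * d u v" using exp_ge_add_one_self[of "- t * d u v"] by (simp add: K_def)
  qed
  also have "\<dots> = 2 * real r * real n * t * energy n r E d"
    using r k by (simp add: energy_def sum_distrib_left case_prod_unfold)
  finally have "(\<Sum>(u, v)\<in>E. 1 - K u v) / real r \<le> 2 * real n * t * energy n r E d"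
    using r by (simp add: field_simps)
  with e have e': "?ev * (\<Sum>v<n. R v) \<le> 2 * real n * t * energy n r E d" by (simp add: R_def)
  have lam: "0 < ?ev"
  proof -
    have "0 \<le> 8 * ln (8 * real k) * energy n r E d" using k en by simp
    then have "0 < ?ev * (\<epsilon> * \<rho>)" using large by (simp add: d_def mult.assoc)
    then show ?thesis by (rule zero_less_mult_pos2) (use eps rho in simp)
  qed
  have "2 * real n * t * energy n r E d \<le> ?ev * (real n * \<epsilon> / 4)"
  proof -
    have "8 * t * energy n r E d \<le> ?ev * \<epsilon>"
      using large rho by (simp add: t_def d_def field_simps)
    then have "(real n / 4) * (8 * t * energy n r E d) \<le> (real n / 4) * (?ev * \<epsilon>)"
      by (intro mult_left_mono) auto
    then show ?thesis by (simp add: mult_ac)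
  qed
  with e' lam have total: "(\<Sum>v<n. R v) \<le> real n * \<epsilon> / 4"
    by (meson mult_le_cancel_left_pos order_trans)
  define A where "A = {v. v < n \<and> R v \<le> 1 / 4}"
  have fin: "finite A" and An: "A \<subseteq> {..<n}" by (auto simp: A_def)
  have "real (card ({..<n} - A)) * (1 / 4) = (\<Sum>v\<in>{..<n} - A. 1 / 4)" by simp
  also have "\<dots> \<le> (\<Sum>v\<in>{..<n} - A. R v)" by (intro sum_mono) (auto simp: A_def)
  also have "\<dots> \<le> (\<Sum>v<n. R v)" using R_nonneg by (intro sum_mono2) auto
  finally have "real (card ({..<n} - A)) \<le> \<epsilon> * real n" using total by (simp add: mult.commute)
  then have cardA: "(1 - \<epsilon>) * real n \<le> real (card A)"
    using fin An card_mono[of "{..<n}" A] by (simp add: card_Diff_subset of_nat_diff algebra_simps)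
  obtain S where S: "S \<subseteq> A" and sep: "\<And>u v. u \<in> S \<Longrightarrow> v \<in> S \<Longrightarrow> u \<noteq> v \<Longrightarrow> \<not> d u v \<le> \<rho>"
    and near: "\<And>v. v \<in> A \<Longrightarrow> \<exists>u\<in>S. d u v \<le> \<rho>"
    using maximal_separated_subset[OF fin, of "\<lambda>u v. d u v \<le> \<rho>"] rho d_sym d0 by (metis less_imp_le)
  have "K u v \<le> 1 / (8 * real k)" if "u \<in> S" "v \<in> S" "u \<noteq> v" for u v
  proof -
    have "t * \<rho> \<le> t * d u v" using sep[OF that] t by (intro mult_left_mono) auto
    then have "K u v \<le> exp (- ln (8 * real k))" using rho by (simp add: K_def t_def)
    then show ?thesis using k by (simp add: exp_minus inverse_eq_divide)
  qed
  then have "card S \<le> 2 * k"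
    using S An k(1)
    by (intro separated_set_small[where c = e and w = e]) (auto simp: K1 A_def R_def, auto simp: K_def)
  moreover have finS: "finite S" using S fin finite_subset by blast
  ultimately obtain vs where vs: "set vs = S" "length vs \<le> 2 * k"
    by (metis distinct_card finite_distinct_list)
  \<comment> \<open>The list is padded to length exactly \<open>2 * k\<close> with vertex 0, which
    exists because \<open>2 \<le> k \<le> n\<close>.\<close>
  define ws where "ws = vs @ replicate (2 * k - length vs) 0"
  have "S \<subseteq> {..<n}" using S An by blast
  then have ws: "length ws = 2 * k" "set ws \<subseteq> {..<n}" "S \<subseteq> set ws"
    using vs k by (auto simp: ws_def)
  have "A \<subseteq> {..<n} \<inter> (\<Union>w\<in>set ws. {v. d w v \<le> \<rho>})"
    using An near ws(3) by blast
  then have "card A \<le> card ({..<n} \<inter> (\<Union>w\<in>set ws. {v. d w v \<le> \<rho>}))"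
    by (intro card_mono) auto
  then have "(1 - \<epsilon>) * real n \<le> real (card ({..<n} \<inter> (\<Union>w\<in>set ws. {v. d w v \<le> \<rho>})))"
    using cardA by linarith
  then show ?thesis using ws(1,2) unfolding d_def by blast
qed

section \<open>Weakest preconditions with running time\<close>

abbreviation seq_infix :: "com \<Rightarrow> com \<Rightarrow> com" (infixr \<open>;;\<close> 60) where "c1 ;; c2 \<equiv> Seq c1 c2"

text \<open>A total-correctness assertion whose postcondition also receives the running time, so
  that time bounds and functional properties are proved together. The unchanged \<open>bs\<close>
  restricts it to runs that toss no coins.\<close>

definition runs ::
    "com \<Rightarrow> (nat \<Rightarrow> int) \<Rightarrow> (nat \<Rightarrow> int) \<Rightarrow> (nat \<Rightarrow> (nat \<Rightarrow> int) \<Rightarrow> (nat \<Rightarrow> int) \<Rightarrow> bool) \<Rightarrow> bool" where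
  "runs c R M Q \<longleftrightarrow> (\<forall>bs. \<exists>t R' M'. exec c (R, M, bs) t (R', M', bs) \<and> Q t R' M')"

lemma runs_mono:
  "runs c R M Q \<Longrightarrow> (\<And>t R' M'. Q t R' M' \<Longrightarrow> Q' t R' M') \<Longrightarrow> runs c R M Q'"
  unfolding runs_def by blast

lemma runs_Const: "Q 1 (R(i := c)) M \<Longrightarrow> runs (Const i c) R M Q"
  unfolding runs_def by (blast intro: exec.Const)

lemma runs_Add: "Q 1 (R(i := R j + R l)) M \<Longrightarrow> runs (Add i j l) R M Q"
  unfolding runs_def by (blast intro: exec.Add)

lemma runs_Sub: "Q 1 (R(i := R j - R l)) M \<Longrightarrow> runs (Sub i j l) R M Q"
  unfolding runs_def by (blast intro: exec.Sub)

lemma runs_Half: "Q 1 (R(i := R j div 2)) M \<Longrightarrow> runs (Half i j) R M Q"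
  unfolding runs_def by (blast intro: exec.Half)

lemma runs_Load: "Q 1 (R(i := M (nat (R j)))) M \<Longrightarrow> runs (Load i j) R M Q"
  unfolding runs_def by (blast intro: exec.Load)

lemma runs_Store: "Q 1 R (M(nat (R i) := R j)) \<Longrightarrow> runs (Store i j) R M Q"
  unfolding runs_def by (blast intro: exec.Store)

lemma runs_Seq:
  "runs c1 R M (\<lambda>t1 R' M'. runs c2 R' M' (\<lambda>t2. Q (t1 + t2))) \<Longrightarrow> runs (c1 ;; c2) R M Q"
  unfolding runs_def by (blast intro: exec.Seq)

lemma runs_IfPos:
  assumes "R i > 0 \<Longrightarrow> runs c1 R M (\<lambda>t. Q (t + 1))" and "R i \<le> 0 \<Longrightarrow> runs c2 R M (\<lambda>t. Q (t + 1))"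
  shows "runs (IfPos i c1 c2) R M Q"
proof (cases "R i > 0")
  case True
  then show ?thesis using assms(1) unfolding runs_def by (blast intro: exec.IfTrue)
next
  case False
  then have "R i \<le> 0" by simp
  then show ?thesis using assms(2) unfolding runs_def by (blast intro: exec.IfFalse)
qed

lemma runs_WhilePos_done: "R i \<le> 0 \<Longrightarrow> Q 1 R M \<Longrightarrow> runs (WhilePos i c) R M Q"
  unfolding runs_def by (blast intro: exec.WhileFalse)

lemma runs_WhilePos_step:
  assumes "R i > 0"
    and "runs c R M (\<lambda>t1 R' M'. runs (WhilePos i c) R' M' (\<lambda>t2. Q (t1 + t2 + 1)))"
  shows "runs (WhilePos i c) R M Q"
  using assms unfolding runs_def by (blast intro: exec.WhileTrue)

text \<open>\<open>I j\<close> holds after \<open>j\<close> iterations, and their number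
  \<open>N\<close> is known in advance. The bound counts one test per iteration and the final
  failing test.\<close>

lemma runs_WhilePos:
  assumes step: "\<And>j R M. j < N \<Longrightarrow> I j R M \<Longrightarrow> R i > 0 \<and> runs c R M (\<lambda>t R' M'. t \<le> T \<and> I (Suc j) R' M')"
    and exit: "\<And>R M. I N R M \<Longrightarrow> R i \<le> 0"
    and init: "I 0 R M"
    and post: "\<And>t R' M'. t \<le> N * (T + 1) + 1 \<Longrightarrow> I N R' M' \<Longrightarrow> Q t R' M'"
  shows "runs (WhilePos i c) R M Q"
proof -
  have "runs (WhilePos i c) R M (\<lambda>t R' M'. t \<le> d * (T + 1) + 1 \<and> I N R' M')"
    if "d \<le> N" "I (N - d) R M" for d R M
    using that
  proof (induction d arbitrary: R M)
    case 0
    then show ?case using exit by (intro runs_WhilePos_done) auto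
  next
    case (Suc d)
    have j: "N - Suc d < N" "Suc (N - Suc d) = N - d" using Suc.prems(1) by auto
    have pos: "R i > 0" and body: "runs c R M (\<lambda>t R' M'. t \<le> T \<and> I (N - d) R' M')"
      using step[OF j(1) Suc.prems(2)] unfolding j(2) by auto
    show ?case
    proof (rule runs_WhilePos_step[where R = R and i = i, OF pos], rule runs_mono[OF body], elim conjE)
      fix t1 R' M' assume t1: "t1 \<le> T" and "I (N - d) R' M'"
      then have "runs (WhilePos i c) R' M' (\<lambda>t R' M'. t \<le> d * (T + 1) + 1 \<and> I N R' M')"
        using Suc.prems(1) by (intro Suc.IH) auto
      then show "runs (WhilePos i c) R' M'
          (\<lambda>t2 R' M'. t1 + t2 + 1 \<le> Suc d * (T + 1) + 1 \<and> I N R' M')"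
        by (rule runs_mono) (use t1 in auto)
    qed
  qed
  from this[of N R M] have "runs (WhilePos i c) R M (\<lambda>t R' M'. t \<le> N * (T + 1) + 1 \<and> I N R' M')"
    using init by simp
  then show ?thesis by (rule runs_mono) (use post in blast)
qed

lemmas runs_basic = runs_Seq runs_Const runs_Add runs_Sub runs_Half runs_Load runs_Store

text \<open>Multiplication by shift and add. The registers 40 to 43 are scratch registers; they are cleared
  at the end, so that the effect on the registers is a function of their previous contents.\<close>

definition Mul :: "nat \<Rightarrow> nat \<Rightarrow> com" where
  "Mul x y =
     Const 40 0 ;; Sub 41 40 y ;; IfPos 41 (Sub x 40 x) (Sub 41 40 41) ;;
     WhilePos 41 (Half 42 41 ;; Sub 43 41 42 ;; Sub 43 43 42 ;;
       IfPos 43 (Add 40 40 x) (Const 43 0) ;; Add x x x ;; Half 41 41) ;;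
     Const 41 0 ;; Add x 40 41 ;; Const 40 0 ;; Const 42 0 ;; Const 43 0"

text \<open>Each bit of the multiplier costs 7 units for the loop body and 1 for the test; the
  remaining 10 pay for the sign, the last test and the clean-up.\<close>

definition mul_time :: "int \<Rightarrow> nat" where "mul_time y = 8 * nat (bitlen \<bar>y\<bar>) + 10"

text \<open>Each iteration preserves \<open>R 40 + R x * R 41\<close>: the low bit of register 41,
  isolated in register 43, decides whether \<open>R x\<close> is added, then \<open>R x\<close> is
  doubled and register 41 halved, so the bit length falls by one.\<close>

lemma runs_mul_loop:
  assumes x: "x < 40" and "R 41 \<ge> 0"
  shows "runs (WhilePos 41 (Half 42 41 ;; Sub 43 41 42 ;; Sub 43 43 42 ;;
       IfPos 43 (Add 40 40 x) (Const 43 0) ;; Add x x x ;; Half 41 41)) R M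
     (\<lambda>t R' M'. t \<le> 8 * nat (bitlen (R 41)) + 1 \<and> M' = M \<and> R' 40 = R 40 + R x * R 41 \<and>
       (\<forall>i. i \<noteq> x \<longrightarrow> i \<notin> {40, 41, 42, 43} \<longrightarrow> R' i = R i))"
    (is "runs ?loop R M (?Q R)")
  using assms(2)
proof (induction "nat (R 41)" arbitrary: R rule: less_induct)
  case less
  show ?case
  proof (cases "R 41 = 0")
    case True
    then show ?thesis by (intro runs_WhilePos_done) auto
  next
    case False
    then have pos: "R 41 > 0" using less.prems by simp
    define y where "y = R 41"
    have y: "y > 0" using pos by (simp add: y_def)
    have bits: "nat (bitlen y) = Suc (nat (bitlen (y div 2)))"
      using y bitlen_nonneg[of "y div 2"] by (subst compute_bitlen) simp
    have parity: "y = 2 * (y div 2) + (y - y div 2 - y div 2)" by simp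
    have bit: "y - y div 2 - y div 2 = (if y - y div 2 - y div 2 > 0 then 1 else 0)"
      by auto
    define R1 where "R1 = R(42 := y div 2, 43 := 0,
        40 := R 40 + (if y - y div 2 - y div 2 > 0 then R x else 0), x := R x + R x, 41 := y div 2)"
    \<comment> \<open>The two branches leave different values in register 43. It is overwritten
      before it is next read, so agreement elsewhere suffices.\<close>
    have continue: "runs ?loop R' M (\<lambda>t2. ?Q R (t1 + t2 + 1))"
      if R': "\<forall>i. i \<noteq> 43 \<longrightarrow> R' i = R1 i" and t1: "t1 \<le> 7" for R' t1
    proof -
      have R'41: "R' 41 = y div 2" and R'40: "R' 40 = R1 40" and R'x: "R' x = R x + R x"
        using R' x by (auto simp: R1_def)
      have dec: "nat (R' 41) < nat (R 41)" and nn: "0 \<le> R' 41"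
        using y by (auto simp: R'41 y_def)
      show ?thesis
      proof (rule runs_mono[OF less.hyps[of R', OF dec nn]], elim conjE, intro conjI)
        fix t2 R2 M2
        assume t2: "t2 \<le> 8 * nat (bitlen (R' 41)) + 1" and M2: "M2 = M"
          and R40: "R2 40 = R' 40 + R' x * R' 41"
          and frame: "\<forall>i. i \<noteq> x \<longrightarrow> i \<notin> {40, 41, 42, 43} \<longrightarrow> R2 i = R' i"
        show "t1 + t2 + 1 \<le> 8 * nat (bitlen (R 41)) + 1"
          using t1 t2 bits by (simp add: R'41 y_def)
        show "M2 = M" by (rule M2)
        have "R2 40 = R 40 + R x * (2 * (y div 2) + (if y - y div 2 - y div 2 > 0 then 1 else 0))"
          using x unfolding R40 R'40 R'x R'41 by (simp add: R1_def algebra_simps)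
        also have "\<dots> = R 40 + R x * y" unfolding bit[symmetric] parity[symmetric] ..
        finally show "R2 40 = R 40 + R x * R 41" by (simp add: y_def)
        show "\<forall>i. i \<noteq> x \<longrightarrow> i \<notin> {40, 41, 42, 43} \<longrightarrow> R2 i = R i"
          using frame R' by (auto simp: R1_def)
      qed
    qed
    show ?thesis
      by (rule runs_WhilePos_step[where R = R and i = 41, OF pos], intro runs_basic runs_IfPos;
          rule continue) (use x in \<open>auto simp: R1_def y_def\<close>)
  qed
qed

text \<open>The sign of the multiplier is transferred to \<open>x\<close> beforehand, so that the
  loop runs on the absolute value of \<open>R y\<close>.\<close>

lemma runs_Mul:
  assumes xy: "x < 40" "y < 40"
    and Q: "\<And>t. t \<le> mul_time (R y) \<Longrightarrow> Q t (R(40 := 0, 41 := 0, 42 := 0, 43 := 0, x := R x * R y)) M"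
  shows "runs (Mul x y) R M Q"
proof -
  let ?loop = "WhilePos 41 (Half 42 41 ;; Sub 43 41 42 ;; Sub 43 43 42 ;;
       IfPos 43 (Add 40 40 x) (Const 43 0) ;; Add x x x ;; Half 41 41)"
  have after: "runs (?loop ;; Const 41 0 ;; Add x 40 41 ;; Const 40 0 ;; Const 42 0 ;; Const 43 0) R1 M Q1"
    if R1: "R1 41 = \<bar>R y\<bar>" "R1 40 = 0" "R1 x * \<bar>R y\<bar> = R x * R y"
      and frame1: "\<forall>i. i \<noteq> x \<longrightarrow> i \<notin> {40, 41, 42, 43} \<longrightarrow> R1 i = R i"
      and Q1: "\<And>t. t \<le> 8 * nat (bitlen \<bar>R y\<bar>) + 6 \<Longrightarrow> Q1 t (R(40 := 0, 41 := 0, 42 := 0, 43 := 0, x := R x * R y)) M"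
    for R1 Q1
  proof (rule runs_Seq, rule runs_mono[OF runs_mul_loop[of x R1, OF xy(1)]])
    show "0 \<le> R1 41" by (simp add: R1(1))
    fix t R2 M2
    assume "t \<le> 8 * nat (bitlen (R1 41)) + 1 \<and> M2 = M \<and> R2 40 = R1 40 + R1 x * R1 41 \<and>
       (\<forall>i. i \<noteq> x \<longrightarrow> i \<notin> {40, 41, 42, 43} \<longrightarrow> R2 i = R1 i)"
    then have t: "t \<le> 8 * nat (bitlen (R1 41)) + 1" and M2: "M2 = M" and R2: "R2 40 = R1 40 + R1 x * R1 41"
       "\<forall>i. i \<noteq> x \<longrightarrow> i \<notin> {40, 41, 42, 43} \<longrightarrow> R2 i = R1 i" by blast+
    have regs: "R2(41 := 0, x := (R2(41 := 0)) 40 + (R2(41 := 0)) 41, 40 := 0, 42 := 0, 43 := 0)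
        = R(40 := 0, 41 := 0, 42 := 0, 43 := 0, x := R x * R y)"
      using xy R1 R2 frame1 by (auto simp: fun_eq_iff)
    show "runs (Const 41 0 ;; Add x 40 41 ;; Const 40 0 ;; Const 42 0 ;; Const 43 0) R2 M2 (\<lambda>t2. Q1 (t + t2))"
      by (intro runs_basic, unfold regs M2, rule Q1) (use t R1(1) in simp)
  qed
  show ?thesis
    unfolding Mul_def
    by (rule runs_Seq, rule runs_Const, rule runs_Seq, rule runs_Sub, rule runs_Seq, rule runs_IfPos;
        rule runs_Sub, rule after)
      (use xy in \<open>auto simp: mul_time_def intro!: Q\<close>)
qed

section \<open>The matrix of near pairs\<close>

text \<open>The difference of two coordinates \<open>p / q\<close> and \<open>p' / q'\<close> is \<open>(p q' - p' q) / (q q')\<close>. Registers 16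
  and 17 hold numerator and denominator of the squared distance. Only input numbers are used as
  multipliers, hence each multiplication takes time linear in the input length.\<close>

definition coord_step :: com where
  "coord_step =
     Load 19 14 ;; Add 14 14 1 ;; Load 20 14 ;; Add 14 14 1 ;;
     Load 21 15 ;; Add 15 15 1 ;; Load 22 15 ;; Add 15 15 1 ;;
     Mul 16 20 ;; Mul 16 20 ;; Mul 16 22 ;; Mul 16 22 ;;
     Add 23 17 0 ;; Mul 23 19 ;; Mul 23 22 ;; Add 24 17 0 ;; Mul 24 21 ;; Mul 24 20 ;; Sub 23 23 24 ;;
     Add 24 23 0 ;; Mul 23 19 ;; Mul 23 22 ;; Mul 24 21 ;; Mul 24 20 ;; Sub 23 23 24 ;;
     Add 16 16 23 ;; Mul 17 20 ;; Mul 17 20 ;; Mul 17 22 ;; Mul 17 22 ;; Sub 18 18 1"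

text \<open>With \<open>d = P / Q\<close> and \<open>\<delta> = dn / dd\<close>, the signs of \<open>4 P dd - Q dn\<close> and \<open>36 P dd - Q dn\<close> are tested.\<close>

definition pair_finish :: com where
  "pair_finish =
     Mul 16 6 ;; Mul 17 5 ;; Add 16 16 16 ;; Add 16 16 16 ;; Sub 23 16 17 ;;
     Const 24 0 ;; IfPos 23 (Const 23 0) (Const 24 1) ;;
     Add 23 16 16 ;; Add 23 23 23 ;; Add 23 23 23 ;; Add 23 23 16 ;; Sub 23 23 17 ;;
     IfPos 23 (Const 23 0) (Add 24 24 1) ;; Store 26 24 ;; Add 26 26 1 ;; Sub 27 27 1"

text \<open>Register 25 keeps the address of vector \<open>u\<close>, so 14 restarts for every pair
  while 15 runs once through all vectors. At the end of a row register 14 stands behind vector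
  \<open>u\<close>, which is the next value of 25; no address has to be multiplied out.\<close>

definition pair_step :: com where
  "pair_step = Add 14 25 0 ;; Const 16 0 ;; Const 17 1 ;; Add 18 4 0 ;; WhilePos 18 coord_step ;; pair_finish"

definition row_step :: com where
  "row_step = Add 15 7 0 ;; Add 27 2 0 ;; WhilePos 27 pair_step ;; Add 25 14 0 ;; Sub 28 28 1"

definition build_matrix :: com where
  "build_matrix = Add 26 8 0 ;; Add 25 7 0 ;; Add 28 2 0 ;; WhilePos 28 row_step"

locale cover_input =
  fixes n m k :: nat and dn dd :: int and a b :: "nat \<Rightarrow> nat \<Rightarrow> int" and M0 :: "nat \<Rightarrow> int" and T :: nat
  assumes num: "\<And>v j. v < n \<Longrightarrow> j < m \<Longrightarrow> M0 (8 + n * n + 2 * (v * m + j)) = a v j"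
    and den: "\<And>v j. v < n \<Longrightarrow> j < m \<Longrightarrow> M0 (8 + n * n + 2 * (v * m + j) + 1) = b v j"
    and den_pos: "\<And>v j. v < n \<Longrightarrow> j < m \<Longrightarrow> b v j > 0"
    and dd_pos: "dd > 0"
    and time_a: "\<And>v j. v < n \<Longrightarrow> j < m \<Longrightarrow> mul_time (a v j) \<le> T"
    and time_b: "\<And>v j. v < n \<Longrightarrow> j < m \<Longrightarrow> mul_time (b v j) \<le> T"
    and time_d: "mul_time dn \<le> T" "mul_time dd \<le> T"
begin

definition y :: "nat \<Rightarrow> nat \<Rightarrow> real" where "y v j = real_of_int (a v j) / real_of_int (b v j)"

abbreviation "data_base \<equiv> 8 + n * n"
text \<open>The input ends at 8 + n^2 + 2nm. The matrix starts n^2 cells later because the output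
  takes 2kn \<le> 2n^2 cells from address 0 and must not reach it.\<close>

abbreviation "matrix_base \<equiv> 8 + 2 * (n * n + n * m)"
abbreviation "cov_base \<equiv> 8 + 2 * (n * n + n * m) + n * n"

definition env :: "(nat \<Rightarrow> int) \<Rightarrow> bool" where
  "env R \<longleftrightarrow> R 0 = 0 \<and> R 1 = 1 \<and> R 2 = int n \<and> R 3 = int k \<and> R 4 = int m \<and> R 5 = dn \<and> R 6 = dd \<and>
     R 7 = int data_base \<and> R 8 = int matrix_base \<and> R 9 = int cov_base"

lemma env_update: "10 \<le> i \<Longrightarrow> env (R(i := z)) \<longleftrightarrow> env R"
  by (auto simp: env_def)

definition coord_inv where
  "coord_inv M1 R0 u v j R M \<longleftrightarrow> M = M1 \<and> env R \<and> R 14 = int (data_base + 2 * (u * m + j)) \<and>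
     R 15 = int (data_base + 2 * (v * m + j)) \<and> R 18 = int m - int j \<and> R 17 > 0 \<and>
     real_of_int (R 16) = sq_dist j y u v * real_of_int (R 17) \<and> (\<forall>i\<in>{25, 26, 27, 28}. R i = R0 i)"

text \<open>With P / Q in registers 16 and 17, the new denominator is Q (q q')^2 and the new
  numerator P (q q')^2 + Q (p q' - p' q)^2. The square is formed by distributing twice over the
  difference, which itself is no input number. This takes 16 multiplications and 15 other
  instructions.\<close>

lemma coord_step_inv:
  assumes u: "u < n" and v: "v < n" and j: "j < m" and M1: "\<And>i. i < matrix_base \<Longrightarrow> M1 i = M0 i"
    and inv: "coord_inv M1 R0 u v j R M"
  shows "runs coord_step R M (\<lambda>t R' M'. t \<le> 16 * T + 15 \<and> coord_inv M1 R0 u v (Suc j) R' M')"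
proof -
  have M: "M = M1" and R: "R 0 = 0" "R (Suc 0) = 1" and env: "env R"
    and R1415: "R 14 = int (data_base + 2 * (u * m + j))" "R 15 = int (data_base + 2 * (v * m + j))"
    and R18: "R 18 = int m - int j" and R17: "R 17 > 0"
    and R16: "real_of_int (R 16) = sq_dist j y u v * real_of_int (R 17)"
    and frame: "\<forall>i\<in>{25, 26, 27, 28}. R i = R0 i"
    using inv by (simp_all add: coord_inv_def env_def)
  have bound: "w * m + j < n * m" if "w < n" for w
  proof -
    have "w * m + j < Suc w * m" using j by simp
    also have "\<dots> \<le> n * m" using that by (intro mult_le_mono1) simp
    finally show ?thesis .
  qed
  have load: "M1 (nat (R 14)) = a u j" "M1 (nat (R 14 + 1)) = b u j"
    "M1 (nat (R 15)) = a v j" "M1 (nat (R 15 + 1)) = b v j"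
    using M1[of "data_base + 2 * (u * m + j)"] M1[of "data_base + 2 * (u * m + j) + 1"]
      M1[of "data_base + 2 * (v * m + j)"] M1[of "data_base + 2 * (v * m + j) + 1"]
      num[OF u j] den[OF u j] num[OF v j] den[OF v j] bound[OF u] bound[OF v]
    by (simp_all add: R1415 nat_add_distrib nat_mult_distrib)
  have b: "b u j > 0" "b v j > 0" using den_pos u v j by auto
  have pos: "0 < R 17 * b u j * b u j * b v j * b v j" using R17 b by simp
  \<comment> \<open>The left-hand side follows the order in which the program forms the
    products.\<close>
  have eq: "real_of_int (R 16) * real_of_int (b u j) * real_of_int (b u j) * real_of_int (b v j) * real_of_int (b v j) +
      ((real_of_int (R 17) * real_of_int (a u j) * real_of_int (b v j) -
        real_of_int (R 17) * real_of_int (a v j) * real_of_int (b u j)) * real_of_int (a u j) * real_of_int (b v j) -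
       (real_of_int (R 17) * real_of_int (a u j) * real_of_int (b v j) -
        real_of_int (R 17) * real_of_int (a v j) * real_of_int (b u j)) * real_of_int (a v j) * real_of_int (b u j))
    = (sq_dist j y u v + (y u j - y v j)\<^sup>2) *
      (real_of_int (R 17) * real_of_int (b u j) * real_of_int (b u j) * real_of_int (b v j) * real_of_int (b v j))"
    unfolding R16 y_def using b by (simp add: power2_eq_square field_simps)
  show ?thesis
    unfolding coord_step_def M
    apply (((rule runs_basic | (rule runs_Mul, simp, simp)), (simp add: R load)?)+)
    apply (intro conjI)
    subgoal using time_a[OF u j] time_a[OF v j] time_b[OF u j] time_b[OF v j] by linarith
    subgoal
      unfolding coord_inv_def
      using env frame pos eq by (simp add: env_def) (simp add: R1415 R18 algebra_simps)
    done
qed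

abbreviation cls :: "nat \<Rightarrow> nat \<Rightarrow> int" where
  "cls u v \<equiv> of_bool (4 * sq_dist m y u v \<le> real_of_int dn / real_of_int dd) +
     of_bool (36 * sq_dist m y u v \<le> real_of_int dn / real_of_int dd)"

definition filled :: "nat \<Rightarrow> nat \<Rightarrow> int" where
  "filled c i = (if matrix_base \<le> i \<and> i < matrix_base + c
     then cls ((i - matrix_base) div n) ((i - matrix_base) mod n) else M0 i)"

lemma filled_Suc:
  assumes "v < n"
  shows "(filled (u * n + v))(matrix_base + (u * n + v) := cls u v) = filled (Suc (u * n + v))"
proof
  fix i
  have "(u * n + v) div n = u" "(u * n + v) mod n = v" using assms by auto
  then show "((filled (u * n + v))(matrix_base + (u * n + v) := cls u v)) i = filled (Suc (u * n + v)) i"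
    by (auto simp: filled_def less_Suc_eq)
qed

definition row_inv where
  "row_inv u v R M \<longleftrightarrow> M = filled (u * n + v) \<and> env R \<and> R 25 = int (data_base + 2 * (u * m)) \<and>
     R 15 = int (data_base + 2 * (v * m)) \<and> R 26 = int (matrix_base + (u * n + v)) \<and>
     R 27 = int n - int v \<and> R 28 = int n - int u \<and> (0 < v \<longrightarrow> R 14 = int (data_base + 2 * (Suc u * m)))"

text \<open>The program reaches 36 P dd from 4 P dd by three doublings and one addition, as 32 + 4.
  The four goals left by symbolic execution are the outcomes of the two tests.\<close>

lemma pair_finish_inv:
  assumes u: "u < n" and v: "v < n" and inv: "coord_inv (filled (u * n + v)) R0 u v m R M"
    and R0: "R0 25 = int (data_base + 2 * (u * m))" "R0 26 = int (matrix_base + (u * n + v))"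
      "R0 27 = int n - int v" "R0 28 = int n - int u"
  shows "runs pair_finish R M (\<lambda>t R' M'. t \<le> 2 * T + 20 \<and> row_inv u (Suc v) R' M')"
proof -
  have M: "M = filled (u * n + v)" and env: "env R"
    and R: "R (Suc 0) = 1" "R 6 = dd" "R 5 = dn"
    and R': "R 26 = int (matrix_base + (u * n + v))" "R 14 = int (data_base + 2 * (u * m + m))" "R 15 = int (data_base + 2 * (v * m + m))"
      "R 25 = int (data_base + 2 * (u * m))" "R 27 = int n - int v" "R 28 = int n - int u"
    and R17: "R 17 > 0" and R16: "real_of_int (R 16) = sq_dist m y u v * real_of_int (R 17)"
    using inv R0 by (simp_all add: coord_inv_def env_def)
  have comp: "R 17 * dn < c * (dd * R 16) \<longleftrightarrow> \<not> real_of_int c * sq_dist m y u v \<le> real_of_int dn / real_of_int dd" for c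
  proof -
    have "R 17 * dn < c * (dd * R 16) \<longleftrightarrow> real_of_int (R 17 * dn) < real_of_int (c * (dd * R 16))"
      by (simp only: of_int_less_iff)
    also have "\<dots> \<longleftrightarrow> real_of_int (R 17) * real_of_int dn
        < real_of_int (R 17) * (real_of_int c * sq_dist m y u v * real_of_int dd)"
      by (simp add: R16 mult_ac)
    also have "\<dots> \<longleftrightarrow> \<not> real_of_int c * sq_dist m y u v \<le> real_of_int dn / real_of_int dd"
      using R17 dd_pos by (simp add: field_simps not_le)
    finally show ?thesis .
  qed
  have D: "0 \<le> sq_dist m y u v" by (simp add: sum_nonneg)
  have fin: "row_inv u (Suc v) R2 ((filled (u * n + v))(nat (R 26) := z))"
    if "z = cls u v" "env R2" "R2 26 = R 26 + 1" "R2 27 = R 27 - 1" "\<forall>i\<in>{14, 15, 25, 28}. R2 i = R i" for R2 z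
  proof -
    have "(filled (u * n + v))(nat (R 26) := z) = filled (u * n + Suc v)"
      unfolding that(1) R' nat_int filled_Suc[OF v] by simp
    then show ?thesis using that(2-5) by (simp add: row_inv_def R' algebra_simps)
  qed
  show ?thesis
    unfolding pair_finish_def M
    apply (((rule runs_basic runs_IfPos | (rule runs_Mul, simp, simp)), (simp add: R)?)+)
    subgoal using time_d comp[of 4] comp[of 36] env D by (intro conjI fin) (auto simp: env_update)
    apply (((rule runs_basic runs_IfPos), (simp add: R)?)+)
    subgoal using time_d comp[of 4] comp[of 36] env D by (intro conjI fin) (auto simp: env_update)
    apply (((rule runs_basic runs_IfPos), (simp add: R)?)+)
    subgoal using time_d comp[of 4] comp[of 36] env D by (intro conjI fin) (auto simp: env_update)
    apply (((rule runs_basic runs_IfPos), (simp add: R)?)+)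
    subgoal using time_d comp[of 4] comp[of 36] env D by (intro conjI fin) (auto simp: env_update)
    done
qed

lemma pair_step_inv:
  assumes u: "u < n" and v: "v < n" and inv: "row_inv u v R M"
  shows "runs pair_step R M (\<lambda>t R' M'. t \<le> m * (16 * T + 16) + 2 * T + 25 \<and> row_inv u (Suc v) R' M')"
proof -
  have M: "M = filled (u * n + v)" and env: "env R" and R: "R 0 = 0" "R (Suc 0) = 1" "R 4 = int m"
    and R': "R 25 = int (data_base + 2 * (u * m))" "R 15 = int (data_base + 2 * (v * m))"
     "R 26 = int (matrix_base + (u * n + v))" "R 27 = int n - int v" "R 28 = int n - int u"
    using inv by (simp_all add: row_inv_def env_def)
  have data: "filled (u * n + v) i = M0 i" if "i < matrix_base" for i
    using that by (simp add: filled_def)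
  let ?R = "R(14 := R 25, 16 := 0, 17 := 1, 18 := int m)"
  have init: "coord_inv (filled (u * n + v)) R u v 0 ?R (filled (u * n + v))"
    using env by (simp add: coord_inv_def env_def R')
  have loop: "runs (WhilePos 18 coord_step ;; pair_finish) ?R (filled (u * n + v))
      (\<lambda>t R' M'. t \<le> m * (16 * T + 16) + 2 * T + 21 \<and> row_inv u (Suc v) R' M')"
  proof (rule runs_Seq, rule runs_WhilePos[where N = m and T = "16 * T + 15" and I = "coord_inv (filled (u * n + v)) R u v"])
    fix j R1 M1 assume j: "j < m" and I: "coord_inv (filled (u * n + v)) R u v j R1 M1"
    show "R1 18 > 0 \<and> runs coord_step R1 M1 (\<lambda>t R' M'. t \<le> 16 * T + 15 \<and> coord_inv (filled (u * n + v)) R u v (Suc j) R' M')"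
      using coord_step_inv[OF u v j data I] I j by (simp add: coord_inv_def)
  next
    fix R1 M1 assume "coord_inv (filled (u * n + v)) R u v m R1 M1"
    then show "R1 18 \<le> 0" by (simp add: coord_inv_def)
  next
    fix t R1 M1 assume t: "t \<le> m * (16 * T + 15 + 1) + 1" and I: "coord_inv (filled (u * n + v)) R u v m R1 M1"
    show "runs pair_finish R1 M1 (\<lambda>t2 R' M'. t + t2 \<le> m * (16 * T + 16) + 2 * T + 21 \<and> row_inv u (Suc v) R' M')"
      by (rule runs_mono[OF pair_finish_inv[OF u v I]]) (use t R' in \<open>auto simp: algebra_simps\<close>)
  qed (rule init)
  show ?thesis
    unfolding pair_step_def M
    apply (rule runs_Seq, rule runs_Add, rule runs_Seq, rule runs_Const, rule runs_Seq, rule runs_Const, rule runs_Seq, rule runs_Add)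
    apply (simp add: R)
    apply (rule runs_mono[OF loop])
    apply simp
    done
qed

definition matrix_inv where
  "matrix_inv u R M \<longleftrightarrow> M = filled (u * n) \<and> env R \<and> R 25 = int (data_base + 2 * (u * m)) \<and>
     R 26 = int (matrix_base + u * n) \<and> R 28 = int n - int u"

definition row_time :: nat where "row_time = n * (m * (16 * T + 16) + 2 * T + 26) + 6"

lemma row_step_inv:
  assumes u: "u < n" and inv: "matrix_inv u R M"
  shows "runs row_step R M (\<lambda>t R' M'. t \<le> row_time \<and> matrix_inv (Suc u) R' M')"
proof -
  have M: "M = filled (u * n)" and env: "env R" and R: "R 0 = 0" "R 2 = int n" "R 7 = int data_base"
    and R': "R 25 = int (data_base + 2 * (u * m))" "R 26 = int (matrix_base + u * n)" "R 28 = int n - int u"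
    using inv by (simp_all add: matrix_inv_def env_def)
  show ?thesis
    unfolding row_step_def M
  proof (rule runs_Seq, rule runs_Add, rule runs_Seq, rule runs_Add, rule runs_Seq,
      rule runs_WhilePos[where N = n and T = "m * (16 * T + 16) + 2 * T + 25" and I = "row_inv u"])
    fix j R1 M1 assume j: "j < n" and I: "row_inv u j R1 M1"
    show "R1 27 > 0 \<and> runs pair_step R1 M1 (\<lambda>t R' M'. t \<le> m * (16 * T + 16) + 2 * T + 25 \<and> row_inv u (Suc j) R' M')"
      using pair_step_inv[OF u j I] I j by (simp add: row_inv_def)
  next
    fix R1 M1 assume "row_inv u n R1 M1"
    then show "R1 27 \<le> 0" by (simp add: row_inv_def)
  next
    show "row_inv u 0 (R(15 := R 7 + R 0, 27 := (R(15 := R 7 + R 0)) 2 + (R(15 := R 7 + R 0)) 0)) (filled (u * n))"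
      using env by (simp add: row_inv_def R R' env_def)
  next
    fix t R1 M1
    assume t: "t \<le> n * (m * (16 * T + 16) + 2 * T + 25 + 1) + 1" and I: "row_inv u n R1 M1"
    have R1: "R1 0 = 0" "R1 (Suc 0) = 1" "R1 14 = int (data_base + 2 * (Suc u * m))"
        "R1 26 = int (matrix_base + (u * n + n))" "R1 28 = int n - int u" "env R1" "M1 = filled (u * n + n)"
      using I u by (auto simp: row_inv_def env_def)
    show "runs (Add 25 14 0 ;; Sub 28 28 1) R1 M1 (\<lambda>t2 R' M'. 1 + (1 + (t + t2)) \<le> row_time \<and> matrix_inv (Suc u) R' M')"
      by (intro runs_basic) (use t R1 in \<open>auto simp: matrix_inv_def env_def row_time_def algebra_simps\<close>)
  qed
qed

lemma build_matrix:
  assumes env: "env R"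
  shows "runs build_matrix R M0 (\<lambda>t R' M'. t \<le> n * (row_time + 1) + 4 \<and> env R' \<and> M' = filled (n * n))"
  unfolding build_matrix_def
proof (rule runs_Seq, rule runs_Add, rule runs_Seq, rule runs_Add, rule runs_Seq, rule runs_Add,
    rule runs_WhilePos[where N = n and T = row_time and I = matrix_inv])
  fix j R1 M1 assume j: "j < n" and I: "matrix_inv j R1 M1"
  show "R1 28 > 0 \<and> runs row_step R1 M1 (\<lambda>t R' M'. t \<le> row_time \<and> matrix_inv (Suc j) R' M')"
    using row_step_inv[OF j I] I j by (simp add: matrix_inv_def)
next
  fix R1 M1 assume "matrix_inv n R1 M1"
  then show "R1 28 \<le> 0" by (simp add: matrix_inv_def)
next
  have "filled 0 = M0" by (auto simp: filled_def)
  then show "matrix_inv 0 (R(26 := R 8 + R 0, 25 := (R(26 := R 8 + R 0)) 7 + (R(26 := R 8 + R 0)) 0,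
      28 := (R(26 := R 8 + R 0, 25 := (R(26 := R 8 + R 0)) 7 + (R(26 := R 8 + R 0)) 0)) 2 +
        (R(26 := R 8 + R 0, 25 := (R(26 := R 8 + R 0)) 7 + (R(26 := R 8 + R 0)) 0)) 0)) M0"
    using env by (simp add: matrix_inv_def env_def)
next
  fix t R1 M1 assume "t \<le> n * (row_time + 1) + 1" "matrix_inv n R1 M1"
  then show "1 + (1 + (1 + t)) \<le> n * (row_time + 1) + 4 \<and> env R1 \<and> M1 = filled (n * n)"
    by (simp add: matrix_inv_def)
qed

end

section \<open>The greedy algorithm as a program\<close>

text \<open>A matrix entry is 2 for a pair within squared distance \<open>\<delta> / 36\<close>, 1 within \<open>\<delta> / 4\<close>, and 0
  otherwise. Register 36 walks along a row of the matrix and register 37 along the marks of the covered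
  vertices; entry minus mark exceeds 1 exactly if the vertex is uncovered and in the small ball. Since
  register 31 starts at \<open>-1\<close>, some candidate is always chosen. The output area may overwrite the input,
  but stays below the matrix.\<close>

definition count_step :: com where
  "count_step = Load 39 36 ;; Load 44 37 ;; Sub 39 39 1 ;; Sub 39 39 44 ;;
     IfPos 39 (Add 35 35 1) (Const 39 0) ;; Add 36 36 1 ;; Add 37 37 1 ;; Sub 38 38 1"

definition candidate_finish :: com where
  "candidate_finish = Sub 39 35 31 ;; IfPos 39 (Add 31 35 0 ;; Add 32 33 0) (Const 39 0) ;;
     Add 33 36 0 ;; Sub 34 34 1"

definition candidate_step :: com where
  "candidate_step = Const 35 0 ;; Add 36 33 0 ;; Add 37 9 0 ;; Add 38 2 0 ;; WhilePos 38 count_step ;;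
     candidate_finish"

definition output_step :: com where
  "output_step = Load 39 36 ;; IfPos 39 (Store 30 1 ;; Store 37 1) (Store 30 0) ;;
     Add 36 36 1 ;; Add 37 37 1 ;; Add 30 30 1 ;; Sub 38 38 1"

definition output_ball :: com where
  "output_ball = Add 36 32 0 ;; Add 37 9 0 ;; Add 38 2 0 ;; WhilePos 38 output_step ;; Sub 29 29 1"

definition round_step :: com where
  "round_step = Const 31 (-1) ;; Add 33 8 0 ;; Add 34 2 0 ;; WhilePos 34 candidate_step ;; output_ball"

definition greedy_cover :: com where
  "greedy_cover = Const 30 0 ;; Add 29 3 3 ;; WhilePos 29 round_step"

context cover_input
begin

text \<open>As lengths, the radii are sqrt \<delta> / 6 and sqrt \<delta> / 2: the factor three of
  the charging argument, with the larger radius equal to half of the permitted diameter.\<close>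

definition near :: "nat \<Rightarrow> nat set" where
  "near v = {u. u < n \<and> 36 * sq_dist m y v u \<le> real_of_int dn / real_of_int dd}"

definition wide :: "nat \<Rightarrow> nat set" where
  "wide v = {u. u < n \<and> 4 * sq_dist m y v u \<le> real_of_int dn / real_of_int dd}"

abbreviation covered :: "nat list \<Rightarrow> nat set" where "covered vs \<equiv> \<Union>(wide ` set vs)"

lemma near_wide: "near v \<subseteq> wide v"
proof
  fix u assume "u \<in> near v"
  moreover have "0 \<le> sq_dist m y v u" by (simp add: sum_nonneg)
  ultimately show "u \<in> wide v" unfolding near_def wide_def by auto
qed

lemma cls_sets: "u < n \<Longrightarrow> cls v u = of_bool (u \<in> wide v) + of_bool (u \<in> near v)"
  by (simp add: near_def wide_def)

text \<open>\<open>vs\<close> is a ghost list: memory holds the characteristic vectors of the chosen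
  balls but not their centers. The last conjunct ties it to the abstract greedy run.\<close>

definition greedy_state :: "nat list \<Rightarrow> (nat \<Rightarrow> int) \<Rightarrow> bool" where
  "greedy_state vs M \<longleftrightarrow>
     (\<forall>v<n. \<forall>u<n. M (matrix_base + (v * n + u)) = of_bool (u \<in> wide v) + of_bool (u \<in> near v)) \<and>
     (\<forall>u<n. M (cov_base + u) = of_bool (u \<in> covered vs)) \<and>
     (\<forall>i<length vs. \<forall>u<n. M (i * n + u) = of_bool (u \<in> wide (vs ! i))) \<and>
     greedy near wide n {..<n} vs"

abbreviation gain :: "nat list \<Rightarrow> nat \<Rightarrow> nat" where
  "gain vs v \<equiv> card (near v \<inter> ({..<n} - covered vs))"

definition count_inv where
  "count_inv vs M1 R0 v j R M \<longleftrightarrow> M = M1 \<and> env R \<and> R 36 = int (matrix_base + (v * n + j)) \<and>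
     R 37 = int (cov_base + j) \<and> R 38 = int n - int j \<and>
     R 35 = int (card (near v \<inter> ({..<j} - covered vs))) \<and> (\<forall>i\<in>{29, 30, 31, 32, 33, 34}. R i = R0 i)"

lemma count_step_inv:
  assumes v: "v < n" and j: "j < n" and st: "greedy_state vs M1" and inv: "count_inv vs M1 R0 v j R M"
  shows "runs count_step R M (\<lambda>t R' M'. t \<le> 9 \<and> count_inv vs M1 R0 v (Suc j) R' M')"
proof -
  have M: "M = M1" and env: "env R" and R: "R (Suc 0) = 1"
    and R': "R 36 = int (matrix_base + (v * n + j))" "R 37 = int (cov_base + j)" "R 38 = int n - int j"
      "R 35 = int (card (near v \<inter> ({..<j} - covered vs)))"
      "R 29 = R0 29" "R 30 = R0 30" "R 31 = R0 31" "R 32 = R0 32" "R 33 = R0 33" "R 34 = R0 34"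
    using inv by (simp_all add: count_inv_def env_def)
  have loaded: "M1 (nat (R 36)) = of_bool (j \<in> wide v) + of_bool (j \<in> near v)"
    "M1 (nat (R 37)) = of_bool (j \<in> covered vs)"
    using st v j unfolding R' nat_int greedy_state_def by blast+
  define c where "c = M1 (nat (R 36))"
  define d where "d = M1 (nat (R 37))"
  note load = c_def[symmetric] d_def[symmetric]
  have test: "1 + d < c \<longleftrightarrow> j \<in> near v \<and> j \<notin> covered vs"
    unfolding c_def d_def loaded using near_wide by auto
  have set: "near v \<inter> ({..<Suc j} - covered vs) = (if j \<in> near v \<and> j \<notin> covered vs
      then insert j (near v \<inter> ({..<j} - covered vs)) else near v \<inter> ({..<j} - covered vs))"
    by (auto simp: less_Suc_eq)
  have card: "card (near v \<inter> ({..<Suc j} - covered vs)) =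
      card (near v \<inter> ({..<j} - covered vs)) + of_bool (j \<in> near v \<and> j \<notin> covered vs)"
    unfolding set by auto
  show ?thesis
    unfolding count_step_def M
    apply (((rule runs_basic runs_IfPos), (simp add: R load)?)+)
    subgoal using env R' card test by (simp add: count_inv_def env_update algebra_simps)
    apply (((rule runs_basic runs_IfPos), (simp add: R load)?)+)
    subgoal using env R' card test by (simp add: count_inv_def env_update algebra_simps)
    done
qed

text \<open>The best candidate is remembered by the address of its matrix row rather than by its
  number; \<open>output_ball\<close> starts reading there.\<close>

definition best_before :: "nat list \<Rightarrow> nat \<Rightarrow> (nat \<Rightarrow> int) \<Rightarrow> bool" where
  "best_before vs v R \<longleftrightarrow> (v = 0 \<and> R 31 = -1) \<or>
     (\<exists>w<n. R 32 = int (matrix_base + w * n) \<and> R 31 = int (gain vs w) \<and> (\<forall>w'<v. gain vs w' \<le> gain vs w))"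

definition candidate_inv where
  "candidate_inv vs M1 R0 v R M \<longleftrightarrow> M = M1 \<and> env R \<and> R 33 = int (matrix_base + v * n) \<and>
     R 34 = int n - int v \<and> (\<forall>i\<in>{29, 30}. R i = R0 i) \<and> best_before vs v R"

text \<open>Counting has moved register 36 to the end of row \<open>v\<close>, which is the start of
  the next row; copying it into register 33 advances the candidate.\<close>

lemma candidate_finish_inv:
  assumes v: "v < n" and inv: "count_inv vs M1 R v n R1 M" and R: "candidate_inv vs M1 R0 v R M1"
  shows "runs candidate_finish R1 M (\<lambda>t R' M'. t \<le> 6 \<and> candidate_inv vs M1 R0 (Suc v) R' M')"
proof -
  have M: "M = M1" and env: "env R1" and R1: "R1 0 = 0" "R1 (Suc 0) = 1"
    and R': "R1 35 = int (gain vs v)" "R1 33 = int (matrix_base + v * n)" "R1 36 = int (matrix_base + (v * n + n))"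
       "R1 34 = int n - int v" "R1 29 = R0 29" "R1 30 = R0 30" and best: "best_before vs v R1"
    using inv R by (simp_all add: count_inv_def candidate_inv_def env_def best_before_def)
  have take: "best_before vs (Suc v) R2"
    if "R1 31 < int (gain vs v)" "R2 31 = int (gain vs v)" "R2 32 = R1 33" for R2
    using best that v unfolding best_before_def R' by (force simp: less_Suc_eq)
  have keep: "best_before vs (Suc v) R2"
    if "int (gain vs v) \<le> R1 31" "R2 31 = R1 31" "R2 32 = R1 32" for R2
    using best that unfolding best_before_def by (auto simp: less_Suc_eq)
  show ?thesis
    unfolding candidate_finish_def M
    apply (((rule runs_basic runs_IfPos), (simp add: R1)?)+)
    subgoal using env R' by (auto simp: candidate_inv_def env_update algebra_simps intro!: take)
    apply (((rule runs_basic runs_IfPos), (simp add: R1)?)+)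
    subgoal using env R' by (auto simp: candidate_inv_def env_update algebra_simps intro!: keep)
    done
qed

lemma candidate_step_inv:
  assumes v: "v < n" and st: "greedy_state vs M1" and inv: "candidate_inv vs M1 R0 v R M"
  shows "runs candidate_step R M (\<lambda>t R' M'. t \<le> 10 * n + 11 \<and> candidate_inv vs M1 R0 (Suc v) R' M')"
proof -
  have M: "M = M1" and env: "env R" and R: "R 0 = 0" "R 2 = int n" "R 9 = int cov_base"
    and R': "R 33 = int (matrix_base + v * n)"
    using inv by (simp_all add: candidate_inv_def env_def)
  let ?R = "R(35 := 0, 36 := R 33, 37 := R 9, 38 := R 2)"
  have loop: "runs (WhilePos 38 count_step ;; candidate_finish) ?R M1
      (\<lambda>t R' M'. t \<le> 10 * n + 7 \<and> candidate_inv vs M1 R0 (Suc v) R' M')"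
  proof (rule runs_Seq, rule runs_WhilePos[where N = n and T = 9 and I = "count_inv vs M1 R v"])
    fix j R1 M2 assume j: "j < n" and I: "count_inv vs M1 R v j R1 M2"
    show "R1 38 > 0 \<and> runs count_step R1 M2 (\<lambda>t R' M'. t \<le> 9 \<and> count_inv vs M1 R v (Suc j) R' M')"
      using count_step_inv[OF v j st I] I j by (simp add: count_inv_def)
  next
    fix R1 M2 assume "count_inv vs M1 R v n R1 M2"
    then show "R1 38 \<le> 0" by (simp add: count_inv_def)
  next
    show "count_inv vs M1 R v 0 ?R M1"
      using env by (simp add: count_inv_def env_update R R')
  next
    fix t R1 M2 assume t: "t \<le> n * (9 + 1) + 1" and I: "count_inv vs M1 R v n R1 M2"
    show "runs candidate_finish R1 M2 (\<lambda>t2 R' M'. t + t2 \<le> 10 * n + 7 \<and> candidate_inv vs M1 R0 (Suc v) R' M')"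
      by (rule runs_mono[OF candidate_finish_inv[OF v I inv[unfolded M]]]) (use t in auto)
  qed
  show ?thesis
    unfolding candidate_step_def M
    apply (rule runs_Seq, rule runs_Const, rule runs_Seq, rule runs_Add, rule runs_Seq, rule runs_Add, rule runs_Seq, rule runs_Add)
    apply (simp add: R(1) del: One_nat_def)
    apply (rule runs_mono[OF loop])
    apply simp
    done
qed

text \<open>Marks are only ever added, so apart from the block being written and the newly marked
  vertices the memory \<open>M1\<close> from the start of the round persists.\<close>

definition output_mem :: "nat \<Rightarrow> nat \<Rightarrow> (nat \<Rightarrow> int) \<Rightarrow> nat \<Rightarrow> nat \<Rightarrow> int" where
  "output_mem i v M1 j p = (if i * n \<le> p \<and> p < i * n + j then of_bool (p - i * n \<in> wide v)
     else if cov_base \<le> p \<and> p < cov_base + j \<and> p - cov_base \<in> wide v then 1 else M1 p)"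

definition output_inv where
  "output_inv i v M1 R0 j R M \<longleftrightarrow> M = output_mem i v M1 j \<and> env R \<and> R 36 = int (matrix_base + (v * n + j)) \<and>
     R 37 = int (cov_base + j) \<and> R 38 = int n - int j \<and> R 30 = int (i * n + j) \<and> R 29 = R0 29"

lemma output_region:
  assumes "i < 2 * k" and "k \<le> n"
  shows "i * n + n \<le> 2 * (n * n)"
proof -
  have "Suc i * n \<le> (2 * n) * n" using assms by (intro mult_le_mono1) simp
  then show ?thesis by simp
qed

lemma matrix_region:
  assumes "v < n" and "j < n"
  shows "v * n + j < n * n"
proof -
  have "v * n + j < Suc v * n" using assms by simp
  also have "\<dots> \<le> n * n" using assms by (intro mult_le_mono1) simp
  finally show ?thesis .
qed

lemma output_step_inv:
  assumes v: "v < n" and j: "j < n" and st: "greedy_state vs M1" and i: "i < 2 * k" "k \<le> n"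
    and inv: "output_inv i v M1 R0 j R M"
  shows "runs output_step R M (\<lambda>t R' M'. t \<le> 8 \<and> output_inv i v M1 R0 (Suc j) R' M')"
proof -
  have M: "M = output_mem i v M1 j" and env: "env R" and R: "R 0 = 0" "R (Suc 0) = 1"
    and R': "R 36 = int (matrix_base + (v * n + j))" "R 37 = int (cov_base + j)" "R 38 = int n - int j"
      "R 30 = int (i * n + j)" "R 29 = R0 29"
    using inv by (simp_all add: output_inv_def env_def)
  have oR: "i * n + n \<le> 2 * (n * n)" by (rule output_region[OF i])
  have mR: "v * n + j < n * n" by (rule matrix_region[OF v j])
  have "M1 (matrix_base + (v * n + j)) = of_bool (j \<in> wide v) + of_bool (j \<in> near v)"
    using st v j unfolding greedy_state_def by blast
  then have loaded: "output_mem i v M1 j (nat (R 36)) = of_bool (j \<in> wide v) + of_bool (j \<in> near v)"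
    using oR mR j unfolding R' nat_int output_mem_def by simp
  define c where "c = output_mem i v M1 j (nat (R 36))"
  note load = c_def[symmetric]
  have test: "0 < c \<longleftrightarrow> j \<in> wide v"
    unfolding c_def loaded using near_wide[of v] by auto
  have yes: "(output_mem i v M1 j)(nat (R 30) := 1, nat (R 37) := 1) = output_mem i v M1 (Suc j)" if "j \<in> wide v"
  proof
    fix p
    consider "p = i * n + j" | "p = cov_base + j" | "p \<noteq> i * n + j" "p \<noteq> cov_base + j" by blast
    then show "((output_mem i v M1 j)(nat (R 30) := 1, nat (R 37) := 1)) p = output_mem i v M1 (Suc j) p"
      using oR j that unfolding R' nat_int by cases (auto simp: output_mem_def)
  qed
  have no: "(output_mem i v M1 j)(nat (R 30) := 0) = output_mem i v M1 (Suc j)" if "j \<notin> wide v"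
  proof
    fix p
    consider "p = i * n + j" | "p = cov_base + j" | "p \<noteq> i * n + j" "p \<noteq> cov_base + j" by blast
    then show "((output_mem i v M1 j)(nat (R 30) := 0)) p = output_mem i v M1 (Suc j) p"
      using oR j that unfolding R' nat_int by cases (auto simp: output_mem_def)
  qed
  show ?thesis
    unfolding output_step_def M
    apply (((rule runs_basic runs_IfPos), (simp add: R load)?)+)
    subgoal using env R' test yes by (simp add: output_inv_def env_update algebra_simps)
    apply (((rule runs_basic runs_IfPos), (simp add: R load)?)+)
    subgoal using env R' test no by (simp add: output_inv_def env_update algebra_simps)
    done
qed

lemma greedy_state_snoc:
  assumes st: "greedy_state vs M1" and v: "v < n" and best: "\<And>w. w < n \<Longrightarrow> gain vs w \<le> gain vs v"
    and i: "length vs < 2 * k" "k \<le> n"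
  shows "greedy_state (vs @ [v]) (output_mem (length vs) v M1 n)"
  unfolding greedy_state_def
proof (intro conjI allI impI)
  let ?M = "output_mem (length vs) v M1 n"
  have oR: "length vs * n + n \<le> 2 * (n * n)" by (rule output_region[OF i])
  show "?M (matrix_base + (w * n + u)) = of_bool (u \<in> wide w) + of_bool (u \<in> near w)"
    if "w < n" "u < n" for w u
    using st that oR matrix_region[OF that] unfolding greedy_state_def output_mem_def by simp
  show "?M (cov_base + u) = of_bool (u \<in> covered (vs @ [v]))" if "u < n" for u
    using st that oR unfolding greedy_state_def output_mem_def by auto
  show "?M (i * n + u) = of_bool (u \<in> wide ((vs @ [v]) ! i))" if "i < length (vs @ [v])" "u < n" for i u
  proof (cases "i = length vs")
    case True
    then show ?thesis using that by (simp add: output_mem_def)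
  next
    case False
    then have "i < length vs" using that by simp
    moreover have "i * n + u < length vs * n"
    proof -
      have "i * n + u < Suc i * n" using that by simp
      also have "\<dots> \<le> length vs * n" using \<open>i < length vs\<close> by (intro mult_le_mono1) simp
      finally show ?thesis .
    qed
    ultimately show ?thesis
      using st that oR unfolding greedy_state_def output_mem_def by (simp add: nth_append)
  qed
  show "greedy near wide n {..<n} (vs @ [v])"
    using st v best unfolding greedy_snoc greedy_state_def by blast
qed

definition round_inv where
  "round_inv i R M \<longleftrightarrow> env R \<and> R 29 = 2 * int k - int i \<and> R 30 = int (i * n) \<and>
     (\<exists>vs. length vs = i \<and> greedy_state vs M)"

lemma output_ball_inv:
  assumes st: "greedy_state vs M1" and i: "length vs < 2 * k" "k \<le> n" and n: "0 < n"
    and inv: "candidate_inv vs M1 R0 n R M"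
    and R0: "R0 29 = 2 * int k - int (length vs)" "R0 30 = int (length vs * n)"
  shows "runs output_ball R M (\<lambda>t R' M'. t \<le> 9 * n + 5 \<and> round_inv (Suc (length vs)) R' M')"
proof -
  have M: "M = M1" and env: "env R" and R: "R 0 = 0" "R 2 = int n" "R 9 = int cov_base"
    and R': "R 29 = 2 * int k - int (length vs)" "R 30 = int (length vs * n)" and bb: "best_before vs n R"
    using inv R0 by (simp_all add: candidate_inv_def env_def)
  obtain v where v: "v < n" and R32: "R 32 = int (matrix_base + v * n)"
    and best: "\<And>w. w < n \<Longrightarrow> gain vs w \<le> gain vs v"
    using bb n unfolding best_before_def by blast
  let ?I = "output_inv (length vs) v M1 R"
  let ?R = "R(36 := R 32, 37 := R 9, 38 := R 2)"
  have loop: "runs (WhilePos 38 output_step ;; Sub 29 29 1) ?R M1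
      (\<lambda>t R' M'. t \<le> 9 * n + 2 \<and> round_inv (Suc (length vs)) R' M')"
  proof (rule runs_Seq, rule runs_WhilePos[where N = n and T = 8 and I = ?I])
    fix j R1 M2 assume j: "j < n" and I: "?I j R1 M2"
    show "R1 38 > 0 \<and> runs output_step R1 M2 (\<lambda>t R' M'. t \<le> 8 \<and> ?I (Suc j) R' M')"
      using output_step_inv[OF v j st i I] I j by (simp add: output_inv_def)
  next
    fix R1 M2 assume "?I n R1 M2"
    then show "R1 38 \<le> 0" by (simp add: output_inv_def)
  next
    have "output_mem (length vs) v M1 0 = M1" by (auto simp: output_mem_def)
    then show "?I 0 ?R M1" using env by (simp add: output_inv_def env_update R R' R32)
  next
    fix t R1 M2 assume t: "t \<le> n * (8 + 1) + 1" and I: "?I n R1 M2"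
    have "greedy_state (vs @ [v]) M2"
      using greedy_state_snoc[OF st v best i] I by (simp add: output_inv_def)
    then have "\<exists>vs'. length vs' = Suc (length vs) \<and> greedy_state vs' M2"
      by (intro exI[of _ "vs @ [v]"]) simp
    then show "runs (Sub 29 29 1) R1 M2 (\<lambda>t2 R' M'. t + t2 \<le> 9 * n + 2 \<and> round_inv (Suc (length vs)) R' M')"
      using t I by (intro runs_Sub) (auto simp: round_inv_def output_inv_def env_update R' env_def)
  qed
  show ?thesis
    unfolding output_ball_def M
    apply (rule runs_Seq, rule runs_Add, rule runs_Seq, rule runs_Add, rule runs_Seq, rule runs_Add)
    apply (simp add: R(1) del: One_nat_def)
    apply (rule runs_mono[OF loop])
    apply simp
    done
qed

definition round_time :: nat where "round_time = n * (10 * n + 12) + 9 * n + 9"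

lemma round_step_inv:
  assumes i: "i < 2 * k" "k \<le> n" and n: "0 < n" and inv: "round_inv i R M"
  shows "runs round_step R M (\<lambda>t R' M'. t \<le> round_time \<and> round_inv (Suc i) R' M')"
proof -
  obtain vs where vs: "length vs = i" and st: "greedy_state vs M" using inv by (auto simp: round_inv_def)
  have env: "env R" and R: "R 0 = 0" "R 2 = int n" "R 8 = int matrix_base"
    and R': "R 29 = 2 * int k - int (length vs)" "R 30 = int (length vs * n)"
    using inv vs by (simp_all add: round_inv_def env_def)
  let ?I = "candidate_inv vs M R"
  let ?R = "R(31 := -1, 33 := R 8, 34 := R 2)"
  have loop: "runs (WhilePos 34 candidate_step ;; output_ball) ?R M
      (\<lambda>t R' M'. t \<le> n * (10 * n + 12) + 9 * n + 6 \<and> round_inv (Suc i) R' M')"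
  proof (rule runs_Seq, rule runs_WhilePos[where N = n and T = "10 * n + 11" and I = ?I])
    fix j R1 M2 assume j: "j < n" and I: "?I j R1 M2"
    show "R1 34 > 0 \<and> runs candidate_step R1 M2 (\<lambda>t R' M'. t \<le> 10 * n + 11 \<and> ?I (Suc j) R' M')"
      using candidate_step_inv[OF j st I] I j by (simp add: candidate_inv_def)
  next
    fix R1 M2 assume "?I n R1 M2"
    then show "R1 34 \<le> 0" by (simp add: candidate_inv_def)
  next
    show "?I 0 ?R M" using env by (simp add: candidate_inv_def best_before_def env_update R)
  next
    fix t R1 M2 assume t: "t \<le> n * (10 * n + 11 + 1) + 1" and I: "?I n R1 M2"
    show "runs output_ball R1 M2 (\<lambda>t2 R' M'. t + t2 \<le> n * (10 * n + 12) + 9 * n + 6 \<and> round_inv (Suc i) R' M')"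
      by (rule runs_mono[OF output_ball_inv[OF st i(1)[folded vs] i(2) n I R']]) (use t vs in \<open>auto simp: algebra_simps\<close>)
  qed
  show ?thesis
    unfolding round_step_def
    apply (rule runs_Seq, rule runs_Const, rule runs_Seq, rule runs_Add, rule runs_Seq, rule runs_Add)
    apply (simp add: R(1) del: One_nat_def)
    apply (rule runs_mono[OF loop])
    apply (simp add: round_time_def)
    done
qed

lemma greedy_cover:
  assumes k: "k \<le> n" and n: "0 < n" and env: "env R" and st: "greedy_state [] M"
  shows "runs greedy_cover R M
    (\<lambda>t R' M'. t \<le> 2 * k * (round_time + 1) + 3 \<and> (\<exists>vs. length vs = 2 * k \<and> greedy_state vs M'))"
proof -
  have R: "R 3 = int k" using env by (simp add: env_def)
  let ?R = "R(30 := 0, 29 := 2 * R 3)"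
  have loop: "runs (WhilePos 29 round_step) ?R M
      (\<lambda>t R' M'. t \<le> 2 * k * (round_time + 1) + 1 \<and> (\<exists>vs. length vs = 2 * k \<and> greedy_state vs M'))"
  proof (rule runs_WhilePos[where N = "2 * k" and T = round_time and I = round_inv])
    fix j R1 M2 assume j: "j < 2 * k" and I: "round_inv j R1 M2"
    show "R1 29 > 0 \<and> runs round_step R1 M2 (\<lambda>t R' M'. t \<le> round_time \<and> round_inv (Suc j) R' M')"
      using round_step_inv[OF j k n I] I j by (simp add: round_inv_def)
  next
    fix R1 M2 assume "round_inv (2 * k) R1 M2"
    then show "R1 29 \<le> 0" by (simp add: round_inv_def)
  next
    show "round_inv 0 ?R M" using env st by (simp add: round_inv_def env_update R)
  qed (auto simp: round_inv_def)
  show ?thesis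
    unfolding greedy_cover_def
    apply (rule runs_Seq, rule runs_Const, rule runs_Seq, rule runs_Add)
    apply simp
    apply (rule runs_mono[OF loop])
    apply simp
    done
qed

end

section \<open>The complete program\<close>

definition prologue :: com where
  "prologue = Const 1 1 ;; Load 2 0 ;; Const 10 2 ;; Load 3 10 ;; Const 10 3 ;; Load 4 10 ;;
     Const 10 6 ;; Load 5 10 ;; Const 10 7 ;; Load 6 10 ;; Add 11 2 0 ;; Mul 11 2 ;; Add 13 4 0 ;; Mul 13 2 ;;
     Const 7 8 ;; Add 8 11 13 ;; Add 8 8 8 ;; Add 8 8 7 ;; Add 9 8 11 ;; Add 7 7 11"

definition cover_program :: com where "cover_program = prologue ;; build_matrix ;; greedy_cover"

text \<open>Through \<open>fresh\<close> the zeros behind the input enter: the marks of covered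
  vertices need no initialization.\<close>

locale cover_run = cover_input +
  assumes k: "k \<le> n" and n: "0 < n"
    and header: "M0 0 = int n" "M0 2 = int k" "M0 3 = int m" "M0 6 = dn" "M0 7 = dd"
    and time_n: "mul_time (int n) \<le> T"
    and fresh: "\<And>i. 8 + n * n + 2 * (n * m) \<le> i \<Longrightarrow> M0 i = 0"
begin

lemma prologue: "runs prologue (\<lambda>_. 0) M0 (\<lambda>t R' M'. t \<le> 2 * T + 18 \<and> env R' \<and> M' = M0)"
  unfolding prologue_def
  apply (((rule runs_basic | (rule runs_Mul, simp, simp)), (simp add: header)?)+)
  using time_n by (simp add: env_def algebra_simps)

lemma greedy_state_start: "greedy_state [] (filled (n * n))"
proof -
  have "filled (n * n) (matrix_base + (v * n + u)) = of_bool (u \<in> wide v) + of_bool (u \<in> near v)"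
    if "v < n" "u < n" for v u
  proof -
    have "(v * n + u) div n = v" "(v * n + u) mod n = u" using that by auto
    then show ?thesis
      using matrix_region[OF that] cls_sets[OF that(2), of v] by (simp add: filled_def)
  qed
  moreover have "filled (n * n) (cov_base + u) = 0" if "u < n" for u
    using fresh[of "cov_base + u"] by (simp add: filled_def)
  ultimately show ?thesis by (simp add: greedy_state_def)
qed

definition total_time :: nat where
  "total_time = 2 * T + 18 + (n * (row_time + 1) + 4) + (2 * k * (round_time + 1) + 3)"

lemma cover_program:
  "runs cover_program (\<lambda>_. 0) M0
    (\<lambda>t R' M'. t \<le> total_time \<and> (\<exists>vs. length vs = 2 * k \<and> greedy_state vs M'))"
  unfolding cover_program_def
proof (rule runs_Seq, rule runs_mono[OF prologue], elim conjE)
  fix t1 R1 M1 assume t1: "t1 \<le> 2 * T + 18" and env: "env R1" and M1: "M1 = M0"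
  show "runs (build_matrix ;; greedy_cover) R1 M1
    (\<lambda>t2 R' M'. t1 + t2 \<le> total_time \<and> (\<exists>vs. length vs = 2 * k \<and> greedy_state vs M'))"
    unfolding M1
  proof (rule runs_Seq, rule runs_mono[OF build_matrix[OF env]], elim conjE)
    fix t2 R2 M2
    assume t2: "t2 \<le> n * (row_time + 1) + 4" and env2: "env R2" and M2: "M2 = filled (n * n)"
    show "runs greedy_cover R2 M2
      (\<lambda>t3 R' M'. t1 + (t2 + t3) \<le> total_time \<and> (\<exists>vs. length vs = 2 * k \<and> greedy_state vs M'))"
      unfolding M2
      by (rule runs_mono[OF greedy_cover[OF k n env2 greedy_state_start]])
        (use t1 t2 in \<open>auto simp: total_time_def\<close>)
  qed
qed

end

section \<open>Squared distances, diameters and the constants\<close>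

lemma sqdist_coordinates:
  assumes "x u \<in> carrier_vec m" and "x v \<in> carrier_vec m"
  shows "sqdist x u v = sq_dist m (\<lambda>w. vec_index (x w)) u v"
  using assms by (simp add: sqdist_def scalar_prod_def power2_eq_square lessThan_atLeast0)

lemma diam_le:
  assumes "S \<subseteq> {..<n}" and "0 \<le> \<delta>" and "\<And>u v. u \<in> S \<Longrightarrow> v \<in> S \<Longrightarrow> d u v \<le> \<delta>"
  shows "diam S d \<le> \<delta>"
proof (cases "S = {}")
  case False
  have "{d u v | u v. u \<in> S \<and> v \<in> S} = (\<lambda>(u, v). d u v) ` (S \<times> S)" by auto
  moreover have "finite S" using assms(1) finite_subset by blast
  ultimately show ?thesis using False assms(3) by (auto simp: diam_def)
qed (use assms(2) in \<open>simp add: diam_def\<close>)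

text \<open>The bound (a + b)^2 \<le> 2 a^2 + 2 b^2 in each coordinate. Two points within \<delta>/4
  of a center are within \<delta> of each other.\<close>

lemma sq_dist_triangle: "sq_dist m y u w \<le> 2 * sq_dist m y v u + 2 * sq_dist m y v w"
  unfolding sum_distrib_left sum.distrib[symmetric]
proof (rule sum_mono)
  fix j
  have "0 \<le> (y u j + y w j - 2 * y v j)\<^sup>2" by simp
  then show "(y u j - y w j)\<^sup>2 \<le> 2 * (y v j - y u j)\<^sup>2 + 2 * (y v j - y w j)\<^sup>2"
    by (simp add: power2_eq_square algebra_simps)
qed

text \<open>The three-step analogue, along v, z, u, w. When two balls of squared radius \<delta>/36
  share a point z, it gives 9 \<delta>/36 = \<delta>/4, so the wide ball about v swallows the small
  ball about u.\<close>

lemma sq_dist_triangle3: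
  "sq_dist m y v w \<le> 3 * sq_dist m y v z + 3 * sq_dist m y u z + 3 * sq_dist m y u w"
  unfolding sum_distrib_left sum.distrib[symmetric]
proof (rule sum_mono)
  fix j
  have sq: "(p + q + s)\<^sup>2 \<le> 3 * p\<^sup>2 + 3 * q\<^sup>2 + 3 * s\<^sup>2" for p q s :: real
  proof -
    have "0 \<le> (p - q)\<^sup>2 + (q - s)\<^sup>2 + (p - s)\<^sup>2" by simp
    then show ?thesis by (simp add: power2_eq_square algebra_simps)
  qed
  show "(y v j - y w j)\<^sup>2 \<le> 3 * (y v j - y z j)\<^sup>2 + 3 * (y u j - y z j)\<^sup>2 + 3 * (y u j - y w j)\<^sup>2"
    using sq[of "y v j - y z j" "- (y u j - y z j)" "y u j - y w j"] by (simp add: power2_commute[of "y z j" "y u j"])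
qed

text \<open>For k \<ge> 2, ln(8k) = 3 ln 2 + ln k \<le> 4 ln k \<le> 8 (ln k)^2, since ln k \<ge> ln
  2 \<ge> 1/2. For \<epsilon> \<le> 1/2, ln(1/\<epsilon>) \<ge> 1/2 \<ge> \<epsilon>, so the squared
  logarithm absorbs two of the three factors \<epsilon>.\<close>

lemma eigenvalue_large_imp:
  assumes G: "regular_graph n r E" and d: "\<And>u v. u < n \<Longrightarrow> v < n \<Longrightarrow> sqdist x u v = sq_dist m y u v"
    and k: "1 \<le> k" "k \<le> n" and eps: "0 < \<epsilon>" "\<epsilon> \<le> 1 / 2" and delta: "0 < \<delta>"
    and large: "eigenvalue_large 2304 n r E k x \<epsilon> \<delta>"
  shows "2 \<le> k" and "8 * ln (8 * real k) * energy n r E (sq_dist m y)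
    < laplacian_eigenvalue n r E k * \<epsilon> * (\<delta> / 36)"
proof -
  let ?d = "sq_dist m y"
  let ?ev = "laplacian_eigenvalue n r E k"
  define e where "e = energy n r E ?d"
  define L where "L = ln (real k)"
  define l where "l = ln (1 / \<epsilon>)"
  have "(\<Sum>(u, v)\<in>E. sqdist x u v) = (\<Sum>(u, v)\<in>E. ?d u v)"
    using G by (intro sum.cong refl) (auto simp: regular_graph_def intro!: d)
  then have "energy n r E (sqdist x) = e" by (simp add: energy_def e_def)
  then have large': "2304 * L\<^sup>2 * e * (l\<^sup>2 / (\<epsilon> ^ 3 * \<delta>)) < ?ev"
    using large by (simp add: eigenvalue_large_def L_def l_def)
  show k2: "2 \<le> k"
  proof (rule ccontr)
    assume "\<not> 2 \<le> k"
    then have "k = 1" using k by simp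
    then show False using large' laplacian_eigenvalue_1[OF G] k by (simp add: L_def)
  qed
  have e: "0 \<le> e" unfolding e_def energy_def by (intro mult_nonneg_nonneg sum_nonneg) (auto intro: sum_nonneg)
  have ln2: "1 / 2 \<le> ln (2 :: real)" using ln_le_minus_one[of "1 / 2 :: real"] by (simp add: ln_div)
  have "ln 2 \<le> L" using k2 by (simp add: L_def)
  then have L: "1 / 2 \<le> L" using ln2 by simp
  have "2 \<le> 1 / \<epsilon>" using eps by (simp add: field_simps)
  then have "ln 2 \<le> l" unfolding l_def by (intro ln_mono) auto
  then have "1 / 2 \<le> l" using ln2 by simp
  then have "\<epsilon> \<le> l" using eps by simp
  then have "\<epsilon>\<^sup>2 \<le> l\<^sup>2" using eps by (intro power_mono) auto
  have "ln (8 :: real) = ln (2 ^ 3)" by simp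
  also have "\<dots> = 3 * ln 2" by (subst ln_realpow) auto
  finally have "ln (8 * real k) = 3 * ln 2 + L" using k2 by (simp add: ln_mult L_def)
  also have "\<dots> \<le> 4 * L" using \<open>ln 2 \<le> L\<close> by simp
  also have "\<dots> \<le> 8 * L\<^sup>2" using L mult_left_mono[of "1 / 2" L L] by (simp add: power2_eq_square)
  finally have "288 * ln (8 * real k) * e \<le> 2304 * L\<^sup>2 * e" using e by (intro mult_right_mono) auto
  also have "\<dots> \<le> 2304 * L\<^sup>2 * e * (l\<^sup>2 / \<epsilon>\<^sup>2)"
    using \<open>\<epsilon>\<^sup>2 \<le> l\<^sup>2\<close> eps e mult_left_mono[of 1 "l\<^sup>2 / \<epsilon>\<^sup>2" "2304 * L\<^sup>2 * e"] by simp
  also have "\<dots> = 2304 * L\<^sup>2 * e * (l\<^sup>2 / (\<epsilon> ^ 3 * \<delta>)) * (\<epsilon> * \<delta>)"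
    using eps delta by (simp add: field_simps power2_eq_square power3_eq_cube)
  also have "\<dots> < ?ev * (\<epsilon> * \<delta>)" using large' eps delta by (intro mult_strict_right_mono) auto
  finally show "8 * ln (8 * real k) * energy n r E ?d < ?ev * \<epsilon> * (\<delta> / 36)"
    unfolding e_def[symmetric] by simp
qed

lemma low_diameter_coverI:
  fixes x :: "nat \<Rightarrow> real vec" and y :: "nat \<Rightarrow> nat \<Rightarrow> real"
  assumes d: "\<And>u v. u < n \<Longrightarrow> v < n \<Longrightarrow> sqdist x u v = sq_dist m y u v" and delta: "0 < \<delta>"
    and len: "length vs = 2 * k" and vs: "set vs \<subseteq> {..<n}"
    and T: "\<And>i. i < 2 * k \<Longrightarrow> T (Suc i) = {u. u < n \<and> 4 * sq_dist m y (vs ! i) u \<le> \<delta>}"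
    and cover: "(1 - \<epsilon>) * real n \<le> real (card (\<Union>v\<in>set vs. {u. u < n \<and> 4 * sq_dist m y v u \<le> \<delta>}))"
  shows "low_diameter_cover n k x \<epsilon> \<delta> T"
proof -
  have "{1..2 * k} = Suc ` {..<2 * k}" by (simp add: lessThan_atLeast0 image_Suc_atLeastLessThan atLeastLessThanSuc_atLeastAtMost)
  then have "(\<Union>i\<in>{1..2 * k}. T i) = (\<Union>i<2 * k. T (Suc i))" by simp
  also have "\<dots> = (\<Union>v\<in>set vs. {u. u < n \<and> 4 * sq_dist m y v u \<le> \<delta>})"
    using T by (auto simp: set_conv_nth len)
  finally have union: "(\<Union>i\<in>{1..2 * k}. T i) = (\<Union>v\<in>set vs. {u. u < n \<and> 4 * sq_dist m y v u \<le> \<delta>})" .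
  have "T i \<subseteq> {..<n} \<and> diam (T i) (sqdist x) \<le> \<delta>" if i: "i \<in> {1..2 * k}" for i
  proof -
    obtain j where j: "i = Suc j" "j < 2 * k" using i by (cases i) auto
    have Ti: "T i = {u. u < n \<and> 4 * sq_dist m y (vs ! j) u \<le> \<delta>}" using T j by simp
    have "diam (T i) (sqdist x) \<le> \<delta>"
    proof (rule diam_le)
      fix u w assume "u \<in> T i" "w \<in> T i"
      then show "sqdist x u w \<le> \<delta>"
        using d[of u w] sq_dist_triangle[where m = m and y = y and u = u and w = w and v = "vs ! j"]
        unfolding Ti by auto
    qed (use delta Ti in auto)
    then show ?thesis using Ti by auto
  qed
  then show ?thesis unfolding low_diameter_cover_def union using cover by blast
qed

section \<open>Instances\<close>

lemma length_concat_uniform: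
  "(\<And>i. i < n \<Longrightarrow> length (f i) = l) \<Longrightarrow> length (concat (map f [0..<n])) = n * l"
  by (induction n) auto

lemma nth_concat_uniform:
  assumes "\<And>i. i < n \<Longrightarrow> length (f i) = l" and "i < n" and "j < l"
  shows "concat (map f [0..<n]) ! (i * l + j) = f i ! j"
  using assms
proof (induction n)
  case (Suc n)
  have len: "length (concat (map f [0..<n])) = n * l"
    using Suc.prems(1) by (intro length_concat_uniform) simp
  show ?case
  proof (cases "i = n")
    case True
    then show ?thesis by (simp add: nth_append len)
  next
    case False
    then have i: "i < n" using Suc.prems(2) by simp
    have "i * l + j < Suc i * l" using Suc.prems(3) by simp
    also have "\<dots> \<le> n * l" using i by (intro mult_le_mono1) simp
    finally have "concat (map f [0..<Suc n]) ! (i * l + j) = concat (map f [0..<n]) ! (i * l + j)"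
      by (simp add: nth_append len)
    then show ?thesis using Suc.IH Suc.prems(1,3) i by simp
  qed
qed simp

definition inst_num :: "cover_instance \<Rightarrow> nat \<Rightarrow> nat \<Rightarrow> int" where
  "inst_num I v j = fst (quotient_of (vec_index (inst_x I v) j))"

definition inst_den :: "cover_instance \<Rightarrow> nat \<Rightarrow> nat \<Rightarrow> int" where
  "inst_den I v j = snd (quotient_of (vec_index (inst_x I v) j))"

abbreviation inst_edges :: "cover_instance \<Rightarrow> int list" where
  "inst_edges I \<equiv> [of_bool ((u, v) \<in> inst_E I). u \<leftarrow> [0..<inst_n I], v \<leftarrow> [0..<inst_n I]]"

abbreviation inst_vectors :: "cover_instance \<Rightarrow> int list" where
  "inst_vectors I \<equiv>
     concat [encode_rat (vec_index (inst_x I v) j). v \<leftarrow> [0..<inst_n I], j \<leftarrow> [0..<inst_dim I]]"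

lemma concat_concat: "concat (concat xss) = concat (map concat xss)"
  by (induction xss) auto

text \<open>Both levels of the comprehension become concatenations of blocks of equal length, so
  that positions follow from \<open>nth_concat_uniform\<close> applied twice.\<close>

lemma inst_vectors_blocks:
  "inst_vectors I = concat (map (\<lambda>v. concat (map (\<lambda>j. [inst_num I v j, inst_den I v j]) [0..<inst_dim I])) [0..<inst_n I])"
  by (simp add: encode_rat_def inst_num_def inst_den_def concat_concat o_def map_concat)

lemma length_inst_edges: "length (inst_edges I) = inst_n I * inst_n I"
  by (rule length_concat_uniform) simp

lemma length_inst_block:
  "length (concat (map (\<lambda>j. [inst_num I v j, inst_den I v j]) [0..<inst_dim I])) = inst_dim I * 2"
  by (rule length_concat_uniform) simp

lemma length_inst_vectors: "length (inst_vectors I) = inst_n I * (inst_dim I * 2)"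
  unfolding inst_vectors_blocks by (rule length_concat_uniform) (rule length_inst_block)

lemma nth_inst_vectors:
  assumes "v < inst_n I" and "j < inst_dim I"
  shows "inst_vectors I ! (2 * (v * inst_dim I + j)) = inst_num I v j"
    and "inst_vectors I ! (2 * (v * inst_dim I + j) + 1) = inst_den I v j"
proof -
  have nth: "inst_vectors I ! (v * (inst_dim I * 2) + (j * 2 + c)) = [inst_num I v j, inst_den I v j] ! c" if "c < 2" for c
  proof -
    have "j * 2 + c < inst_dim I * 2" using assms(2) that by simp
    then have "inst_vectors I ! (v * (inst_dim I * 2) + (j * 2 + c))
        = concat (map (\<lambda>j. [inst_num I v j, inst_den I v j]) [0..<inst_dim I]) ! (j * 2 + c)"
      unfolding inst_vectors_blocks using assms(1)
      by (intro nth_concat_uniform) (simp_all only: length_inst_block)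
    also have "\<dots> = [inst_num I v j, inst_den I v j] ! c"
      using assms(2) that by (intro nth_concat_uniform) simp_all
    finally show ?thesis .
  qed
  show "inst_vectors I ! (2 * (v * inst_dim I + j)) = inst_num I v j"
    using nth[of 0] by (simp add: algebra_simps)
  show "inst_vectors I ! (2 * (v * inst_dim I + j) + 1) = inst_den I v j"
    using nth[of 1] by (simp add: algebra_simps)
qed

abbreviation inst_header :: "cover_instance \<Rightarrow> int list" where
  "inst_header I \<equiv> [int (inst_n I), int (inst_r I), int (inst_k I), int (inst_dim I),
     fst (quotient_of (inst_eps I)), snd (quotient_of (inst_eps I)),
     fst (quotient_of (inst_delta I)), snd (quotient_of (inst_delta I))]"

lemma encode_instance_parts: "encode_instance I = inst_header I @ inst_edges I @ inst_vectors I"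
  by (simp add: encode_instance_def encode_rat_def)

lemma length_encode_instance:
  "length (encode_instance I) = 8 + inst_n I * inst_n I + 2 * (inst_n I * inst_dim I)"
  unfolding encode_instance_parts length_append length_inst_edges length_inst_vectors by simp

lemma nth_encode_instance:
  assumes "v < inst_n I" and "j < inst_dim I"
  shows "encode_instance I ! (8 + inst_n I * inst_n I + 2 * (v * inst_dim I + j)) = inst_num I v j"
    and "encode_instance I ! (8 + inst_n I * inst_n I + 2 * (v * inst_dim I + j) + 1) = inst_den I v j"
proof -
  have "length (inst_header I @ inst_edges I) = 8 + inst_n I * inst_n I"
    unfolding length_append length_inst_edges by simp
  then have "encode_instance I ! (8 + inst_n I * inst_n I + p) = inst_vectors I ! p" for p
    unfolding encode_instance_parts append_assoc[symmetric] by (metis nth_append_length_plus)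
  from this[of "2 * (v * inst_dim I + j)"] this[of "2 * (v * inst_dim I + j) + 1"]
  show "encode_instance I ! (8 + inst_n I * inst_n I + 2 * (v * inst_dim I + j)) = inst_num I v j"
    and "encode_instance I ! (8 + inst_n I * inst_n I + 2 * (v * inst_dim I + j) + 1) = inst_den I v j"
    using nth_inst_vectors[OF assms] by (simp_all only: add.assoc)
qed

section \<open>Input size and polynomial running time\<close>

lemma mul_time_le_input_size:
  assumes "z \<in> set inp"
  shows "mul_time z \<le> 8 * input_size inp + 10"
proof -
  have "nat (bitlen \<bar>z\<bar>) + 1 \<le> input_size inp"
    unfolding input_size_def using assms by (intro member_le_sum_list) auto
  then show ?thesis by (simp add: mul_time_def)
qed

lemma length_le_input_size: "length inp \<le> input_size inp"
  by (induction inp) (auto simp: input_size_def)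

definition inst_memory :: "cover_instance \<Rightarrow> nat \<Rightarrow> int" where
  "inst_memory I a = (if a < length (encode_instance I) then encode_instance I ! a else 0)"

lemma cover_run_instance:
  assumes wf: "wf_instance I"
  shows "cover_run (inst_n I) (inst_dim I) (inst_k I)
    (fst (quotient_of (inst_delta I))) (snd (quotient_of (inst_delta I)))
    (inst_num I) (inst_den I) (inst_memory I) (8 * input_size (encode_instance I) + 10)"
proof -
  let ?n = "inst_n I" and ?m = "inst_dim I" and ?T = "8 * input_size (encode_instance I) + 10"
  have time: "mul_time (encode_instance I ! p) \<le> ?T" if "p < length (encode_instance I)" for p
    using that by (intro mul_time_le_input_size) simp
  have range: "8 + ?n * ?n + 2 * (v * ?m + j) + 1 < length (encode_instance I)" if "v < ?n" "j < ?m" for v j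
  proof -
    have "v * ?m + j < Suc v * ?m" using that by simp
    also have "\<dots> \<le> ?n * ?m" using that by (intro mult_le_mono1) simp
    finally show ?thesis unfolding length_encode_instance by simp
  qed
  have head: "encode_instance I ! p = inst_header I ! p" if "p < 8" for p
    unfolding encode_instance_parts using that by (subst nth_append) simp
  have small: "p < length (encode_instance I)" if "p < 8" for p
    using that unfolding length_encode_instance by simp
  have mem: "inst_memory I p = inst_header I ! p" if "p < 8" for p
    using small[OF that] head[OF that] by (simp add: inst_memory_def)
  show ?thesis
  proof unfold_locales
    fix v j assume vj: "v < ?n" "j < ?m"
    show "inst_memory I (8 + ?n * ?n + 2 * (v * ?m + j)) = inst_num I v j"
      "inst_memory I (8 + ?n * ?n + 2 * (v * ?m + j) + 1) = inst_den I v j"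
      using range[OF vj] nth_encode_instance[OF vj] by (simp_all add: inst_memory_def)
    show "inst_den I v j > 0"
      unfolding inst_den_def by (metis prod.collapse quotient_of_denom_pos)
    show "mul_time (inst_num I v j) \<le> ?T" "mul_time (inst_den I v j) \<le> ?T"
      using time[of "8 + ?n * ?n + 2 * (v * ?m + j)"] time[of "8 + ?n * ?n + 2 * (v * ?m + j) + 1"]
        range[OF vj] nth_encode_instance[OF vj] by simp_all
  next
    show "snd (quotient_of (inst_delta I)) > 0" by (metis prod.collapse quotient_of_denom_pos)
    show "mul_time (fst (quotient_of (inst_delta I))) \<le> ?T" "mul_time (snd (quotient_of (inst_delta I))) \<le> ?T"
      "mul_time (int ?n) \<le> ?T"
      using time[OF small, of 6] time[OF small, of 7] time[OF small, of 0] by (simp_all add: head)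
    show "inst_memory I 0 = int ?n" "inst_memory I 2 = int (inst_k I)" "inst_memory I 3 = int ?m"
      "inst_memory I 6 = fst (quotient_of (inst_delta I))" "inst_memory I 7 = snd (quotient_of (inst_delta I))"
      by (simp_all add: mem)
    show "inst_k I \<le> ?n" "0 < ?n" using wf by (auto simp: wf_instance_def)
    show "inst_memory I i = 0" if "8 + ?n * ?n + 2 * (?n * ?m) \<le> i" for i
      using that by (simp add: inst_memory_def length_encode_instance)
  qed
qed

text \<open>A good run exists for every list of coins, so the success event is everything and has
  probability 1.\<close>

lemma randomized_polytime_deterministic:
  fixes c :: com and q :: "nat poly"
  assumes "\<And>a. a \<in> Inst \<Longrightarrow> runs c (\<lambda>_. 0) (\<lambda>i. if i < length (enc a) then enc a ! i else 0)
    (\<lambda>t R M. t \<le> poly q (input_size (enc a)) \<and> Sol a M)"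
  shows "randomized_polytime enc Inst Sol"
  unfolding randomized_polytime_def
proof (rule exI[of _ c], rule exI[of _ q], rule ballI)
  fix a assume a: "a \<in> Inst"
  let ?p = "poly q (input_size (enc a))"
  have run: "\<exists>t R M. exec c (initial_state (enc a) bs) t (R, M, bs) \<and> t \<le> ?p \<and> Sol a M" for bs
    using assms[OF a] unfolding runs_def initial_state_def by blast
  let ?S = "{bs :: bool list. length bs = ?p}"
  have all: "{bs. \<exists>t R M bs'. exec c (initial_state (enc a) bs) t (R, M, bs') \<and> Sol a M} = UNIV"
    using run by blast
  have "measure_pmf.prob (pmf_of_set ?S)
      {bs. \<exists>t R M bs'. exec c (initial_state (enc a) bs) t (R, M, bs') \<and> Sol a M} \<ge> 2 / 3"
    unfolding all by simp
  moreover have "\<forall>bs. length bs = ?p \<longrightarrow> (\<exists>t\<le>?p. \<exists>s'. exec c (initial_state (enc a) bs) t s')"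
    using run by blast
  ultimately show "\<exists>p. p = ?p \<and>
      (\<forall>bs. length bs = p \<longrightarrow> (\<exists>t\<le>p. \<exists>s'. exec c (initial_state (enc a) bs) t s')) \<and>
      measure_pmf.prob (pmf_of_set {bs. length bs = p})
        {bs. \<exists>t R M bs'. exec c (initial_state (enc a) bs) t (R, M, bs') \<and> Sol a M} \<ge> 2 / 3"
    by blast
qed

text \<open>\<open>total_time\<close> with \<open>n\<close>, \<open>m\<close> and \<open>k\<close>
  replaced by the input size \<open>s\<close>, and \<open>T\<close> by
  \<open>8 * s + 10\<close>.\<close>

definition time_bound :: "nat poly" where
  "time_bound = (let s = [:0, 1:]; t = [:10, 8:] in
     2 * t + 18 + (s * (s * (s * (16 * t + 16) + 2 * t + 26) + 7) + 4) + (2 * s * (s * (10 * s + 12) + 9 * s + 10) + 3))"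

lemma poly_time_bound:
  "poly time_bound s = 2 * (8 * s + 10) + 18 +
     (s * (s * (s * (16 * (8 * s + 10) + 16) + 2 * (8 * s + 10) + 26) + 7) + 4) +
     (2 * s * (s * (10 * s + 12) + 9 * s + 10) + 3)"
  by (simp add: time_bound_def Let_def algebra_simps)

lemma (in cover_run) total_time_le:
  assumes "n \<le> s" and "m \<le> s" and "T = 8 * s + 10"
  shows "total_time \<le> poly time_bound s"
proof -
  have ks: "k \<le> s" using k assms(1) by simp
  have "row_time \<le> s * (s * (16 * (8 * s + 10) + 16) + 2 * (8 * s + 10) + 26) + 6"
    unfolding row_time_def unfolding assms(3)
    by (intro add_mono mult_le_mono order.refl assms(1,2))
  then have "row_time + 1 \<le> s * (s * (16 * (8 * s + 10) + 16) + 2 * (8 * s + 10) + 26) + 7" by simp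
  then have rows: "n * (row_time + 1) \<le> s * (s * (s * (16 * (8 * s + 10) + 16) + 2 * (8 * s + 10) + 26) + 7)"
    by (intro mult_le_mono assms(1))
  have "round_time \<le> s * (10 * s + 12) + 9 * s + 9"
    unfolding round_time_def by (intro add_mono mult_le_mono order.refl assms(1))
  then have "round_time + 1 \<le> s * (10 * s + 12) + 9 * s + 10" by simp
  then have rounds: "2 * k * (round_time + 1) \<le> 2 * s * (s * (10 * s + 12) + 9 * s + 10)"
    using ks by (intro mult_le_mono) auto
  show ?thesis
    unfolding total_time_def poly_time_bound
    by (intro add_mono order.refl rows rounds) (simp add: assms(3))
qed

text \<open>The header gives these numbers in binary, but the adjacency matrix and the vectors
  contribute n^2 + 2nm entries, each of size at least 1, and n is positive.\<close>

lemma inst_size: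
  assumes "wf_instance I"
  shows "inst_n I \<le> input_size (encode_instance I)" and "inst_dim I \<le> input_size (encode_instance I)"
proof -
  have n: "0 < inst_n I" using assms by (auto simp: wf_instance_def)
  have "inst_n I * 1 \<le> inst_n I * inst_n I" "1 * inst_dim I \<le> inst_n I * inst_dim I"
    using n by (intro mult_le_mono; simp)+
  then show "inst_n I \<le> input_size (encode_instance I)" "inst_dim I \<le> input_size (encode_instance I)"
    using length_le_input_size[of "encode_instance I"] unfolding length_encode_instance by linarith+
qed

lemma of_rat_quotient: "of_rat q = real_of_int (fst (quotient_of q)) / real_of_int (snd (quotient_of q))"
proof -
  have "q = of_int (fst (quotient_of q)) / of_int (snd (quotient_of q))"
    by (rule quotient_of_div) simp
  then have "of_rat q = (of_rat (of_int (fst (quotient_of q)) / of_int (snd (quotient_of q))) :: real)" by simp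
  then show ?thesis by (simp add: of_rat_divide)
qed

text \<open>Real vectors are no input for a program, so existence is derived from the balls
  themselves; they are enlarged to squared radius \<delta>/4 only to share
  \<open>low_diameter_coverI\<close> with the greedy sets.\<close>

lemma cover_exists:
  assumes G: "regular_graph n r E" and x: "\<forall>v<n. x v \<in> carrier_vec m"
    and k: "1 \<le> k" "k \<le> n" and eps: "0 < \<epsilon>" "\<epsilon> \<le> 1 / 2" and delta: "0 < \<delta>"
    and large: "eigenvalue_large 2304 n r E k x \<epsilon> \<delta>"
  shows "\<exists>T. low_diameter_cover n k x \<epsilon> \<delta> T"
proof -
  define y where "y v = vec_index (x v)" for v
  have d: "sqdist x u v = sq_dist m y u v" if "u < n" "v < n" for u v
    unfolding y_def using sqdist_coordinates x that by blast
  note L = eigenvalue_large_imp[OF G d k eps delta large]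
  have "0 < \<delta> / 36" using delta by simp
  from few_balls_cover[OF G L(1) k(2) this eps(1) L(2)]
  obtain ws where ws: "length ws = 2 * k" "set ws \<subseteq> {..<n}"
    and cover: "(1 - \<epsilon>) * real n \<le> real (card ({..<n} \<inter> (\<Union>w\<in>set ws. {v. sq_dist m y w v \<le> \<delta> / 36})))"
    by blast
  define wide where "wide v = {u. u < n \<and> 4 * sq_dist m y v u \<le> \<delta>}" for v
  have "{..<n} \<inter> (\<Union>w\<in>set ws. {v. sq_dist m y w v \<le> \<delta> / 36}) \<subseteq> (\<Union>w\<in>set ws. wide w)"
    using delta by (auto simp: wide_def)
  moreover have "finite (\<Union>w\<in>set ws. wide w)" by (auto simp: wide_def)
  ultimately have "card ({..<n} \<inter> (\<Union>w\<in>set ws. {v. sq_dist m y w v \<le> \<delta> / 36})) \<le> card (\<Union>w\<in>set ws. wide w)"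
    by (intro card_mono) auto
  then have "(1 - \<epsilon>) * real n \<le> real (card (\<Union>w\<in>set ws. wide w))" using cover by linarith
  then have "low_diameter_cover n k x \<epsilon> \<delta> (\<lambda>i. wide (ws ! (i - 1)))"
    using d delta ws by (intro low_diameter_coverI[where m = m and y = y and vs = ws]) (auto simp: wide_def)
  then show ?thesis by blast
qed

text \<open>The list \<open>ws\<close> from the spectral argument enters only as the competitor in
  \<open>greedy_covers\<close>: the wide balls of the greedy run cover at least as much as the near
  balls about \<open>ws\<close>.\<close>

lemma (in cover_run) greedy_state_cover:
  assumes st: "greedy_state vs M" and len: "length vs = 2 * k"
    and G: "regular_graph n r E" and d: "\<And>u v. u < n \<Longrightarrow> v < n \<Longrightarrow> sqdist x u v = sq_dist m y u v"
    and k1: "1 \<le> k" and eps: "0 < \<epsilon>" "\<epsilon> \<le> 1 / 2" and delta: "0 < \<delta>" "\<delta> = real_of_int dn / real_of_int dd"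
    and large: "eigenvalue_large 2304 n r E k x \<epsilon> \<delta>"
  shows "low_diameter_cover n k x \<epsilon> \<delta> (\<lambda>i. {v. v < n \<and> M ((i - 1) * n + v) \<noteq> 0})"
proof -
  note L = eigenvalue_large_imp[OF G d k1 k eps delta(1) large]
  have "0 < \<delta> / 36" using delta by simp
  from few_balls_cover[OF G L(1) k this eps(1) L(2)]
  obtain ws where ws: "length ws = 2 * k" "set ws \<subseteq> {..<n}"
    and cover: "(1 - \<epsilon>) * real n \<le> real (card ({..<n} \<inter> (\<Union>w\<in>set ws. {v. sq_dist m y w v \<le> \<delta> / 36})))"
    by blast
  have run: "greedy near wide n {..<n} vs"
    and out: "\<And>i u. i < 2 * k \<Longrightarrow> u < n \<Longrightarrow> M (i * n + u) = of_bool (u \<in> wide (vs ! i))"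
    using st len unfolding greedy_state_def by auto
  have near: "{..<n} \<inter> (\<Union>w\<in>set ws. {v. sq_dist m y w v \<le> \<delta> / 36}) = {..<n} \<inter> \<Union>(near ` set ws)"
    unfolding near_def delta(2)[symmetric] by auto
  have meet: "near w \<subseteq> wide v" if nonempty: "near v \<inter> near w \<noteq> {}" for v w
  proof
    fix u assume u: "u \<in> near w"
    obtain z where "z \<in> near v" "z \<in> near w" using nonempty by blast
    then show "u \<in> wide v"
      using u sq_dist_triangle3[where m = m and y = y and v = v and w = u and z = z and u = w]
      by (auto simp: near_def wide_def)
  qed
  have "card ({..<n} \<inter> \<Union>(near ` set ws)) \<le> card ({..<n} \<inter> \<Union>(wide ` set vs))"
    using run ws len by (intro greedy_covers meet near_wide) auto
  also have "{..<n} \<inter> \<Union>(wide ` set vs) = (\<Union>v\<in>set vs. {u. u < n \<and> 4 * sq_dist m y v u \<le> \<delta>})"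
    unfolding wide_def delta(2)[symmetric] by auto
  finally have "(1 - \<epsilon>) * real n \<le> real (card (\<Union>v\<in>set vs. {u. u < n \<and> 4 * sq_dist m y v u \<le> \<delta>}))"
    using cover unfolding near by linarith
  then show ?thesis
    using d delta(1) len greedy_centers[OF run]
  proof (intro low_diameter_coverI[where m = m and y = y and vs = vs])
    show "{v. v < n \<and> M ((Suc i - 1) * n + v) \<noteq> 0} = {u. u < n \<and> 4 * sq_dist m y (vs ! i) u \<le> \<delta>}"
      if "i < 2 * k" for i
      using out[OF that] by (auto simp: wide_def delta(2))
  qed auto
qed

text \<open>The time bound stands outside the implications: the program stops in time on every
  well-formed instance, and only the correctness of its answer depends on the eigenvalue condition,
  which it does not test.\<close>

lemma cover_program_correct:
  assumes wf: "wf_instance I"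
  shows "runs cover_program (\<lambda>_. 0)
    (\<lambda>i. if i < length (encode_instance I) then encode_instance I ! i else 0)
    (\<lambda>t R M. t \<le> poly time_bound (input_size (encode_instance I)) \<and>
      (inst_eps I \<le> 1 / 2 \<longrightarrow>
       eigenvalue_large 2304 (inst_n I) (inst_r I) (inst_E I) (inst_k I)
         (real_x I) (of_rat (inst_eps I)) (of_rat (inst_delta I)) \<longrightarrow>
       low_diameter_cover (inst_n I) (inst_k I) (real_x I)
         (of_rat (inst_eps I)) (of_rat (inst_delta I)) (decode_sets I M)))"
    (is "runs _ _ _ (\<lambda>t R M. ?Q t M)")
proof -
  interpret cover_run "inst_n I" "inst_dim I" "inst_k I"
    "fst (quotient_of (inst_delta I))" "snd (quotient_of (inst_delta I))"
    "inst_num I" "inst_den I" "inst_memory I" "8 * input_size (encode_instance I) + 10"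
    by (rule cover_run_instance[OF wf])
  have wf': "regular_graph (inst_n I) (inst_r I) (inst_E I)" "1 \<le> inst_k I" "0 < inst_eps I" "0 < inst_delta I"
    and x: "\<And>v. v < inst_n I \<Longrightarrow> inst_x I v \<in> carrier_vec (inst_dim I)"
    using wf by (auto simp: wf_instance_def)
  have d: "sqdist (real_x I) u v = sq_dist (inst_dim I) y u v" if "u < inst_n I" "v < inst_n I" for u v
  proof -
    have "sqdist (real_x I) u v = sq_dist (inst_dim I) (\<lambda>w. vec_index (real_x I w)) u v"
      using x that by (intro sqdist_coordinates) (auto simp: real_x_def)
    also have "\<dots> = sq_dist (inst_dim I) y u v"
      using carrier_vecD[OF x[OF that(1)]] carrier_vecD[OF x[OF that(2)]]
      by (intro sum.cong refl) (auto simp: real_x_def y_def inst_num_def inst_den_def of_rat_quotient)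
    finally show ?thesis .
  qed
  have half: "(of_rat (inst_eps I) :: real) \<le> 1 / 2" if "inst_eps I \<le> 1 / 2"
  proof -
    have "(of_rat (inst_eps I) :: real) \<le> of_rat (1 / 2)" using that by (simp only: of_rat_less_eq)
    then show ?thesis by (simp add: of_rat_divide)
  qed
  have "runs cover_program (\<lambda>_. 0) (inst_memory I) (\<lambda>t R M. ?Q t M)"
  proof (rule runs_mono[OF cover_program], elim conjE exE, intro conjI impI)
    fix t and R' M :: "nat \<Rightarrow> int" and vs
    assume t: "t \<le> total_time" and vs: "length vs = 2 * inst_k I" "greedy_state vs M"
    show "t \<le> poly time_bound (input_size (encode_instance I))"
      using t total_time_le[OF inst_size[OF wf] refl] by simp
    assume e2: "inst_eps I \<le> 1 / 2" and large: "eigenvalue_large 2304 (inst_n I) (inst_r I) (inst_E I) (inst_k I)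
         (real_x I) (of_rat (inst_eps I)) (of_rat (inst_delta I))"
    show "low_diameter_cover (inst_n I) (inst_k I) (real_x I)
         (of_rat (inst_eps I)) (of_rat (inst_delta I)) (decode_sets I M)"
      unfolding decode_sets_def
      by (rule greedy_state_cover[OF vs(2,1) wf'(1) d wf'(2) _ half[OF e2] _ of_rat_quotient large])
        (use wf' in simp_all)
  qed
  then show ?thesis unfolding inst_memory_def .
qed

theorem theorem3p1:
  shows "\<exists>c\<^sub>1::real. c\<^sub>1 > 0 \<and>
    (\<forall>(n::nat) (r::nat) (E::(nat \<times> nat) set) (k::nat) (m::nat) (x::nat \<Rightarrow> real vec) (\<epsilon>::real) (\<delta>::real).
       regular_graph n r E \<longrightarrow> (\<forall>v<n. x v \<in> carrier_vec m) \<longrightarrow> 1 \<le> k \<longrightarrow> k \<le> n \<longrightarrow>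
       0 < \<epsilon> \<longrightarrow> \<epsilon> \<le> 1 / 2 \<longrightarrow> 0 < \<delta> \<longrightarrow>
       eigenvalue_large c\<^sub>1 n r E k x \<epsilon> \<delta> \<longrightarrow>
       (\<exists>T. low_diameter_cover n k x \<epsilon> \<delta> T)) \<and>
    randomized_polytime encode_instance {I. wf_instance I}
      (\<lambda>I M. inst_eps I \<le> 1 / 2 \<longrightarrow>
         eigenvalue_large c\<^sub>1 (inst_n I) (inst_r I) (inst_E I) (inst_k I)
           (real_x I) (of_rat (inst_eps I)) (of_rat (inst_delta I)) \<longrightarrow>
         low_diameter_cover (inst_n I) (inst_k I) (real_x I)
           (of_rat (inst_eps I)) (of_rat (inst_delta I)) (decode_sets I M))"
proof (intro exI[of _ 2304] conjI allI impI)
  show "\<exists>T. low_diameter_cover n k x \<epsilon> \<delta> T"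
    if "regular_graph n r E" "\<forall>v<n. x v \<in> carrier_vec m" "1 \<le> k" "k \<le> n"
      "0 < \<epsilon>" "\<epsilon> \<le> 1 / 2" "0 < \<delta>" "eigenvalue_large 2304 n r E k x \<epsilon> \<delta>"
    for n r k m :: nat and E x and \<epsilon> \<delta> :: real
    using that by (rule cover_exists)
  show "randomized_polytime encode_instance {I. wf_instance I}
      (\<lambda>I M. inst_eps I \<le> 1 / 2 \<longrightarrow>
         eigenvalue_large 2304 (inst_n I) (inst_r I) (inst_E I) (inst_k I)
           (real_x I) (of_rat (inst_eps I)) (of_rat (inst_delta I)) \<longrightarrow>
         low_diameter_cover (inst_n I) (inst_k I) (real_x I)
           (of_rat (inst_eps I)) (of_rat (inst_delta I)) (decode_sets I M))"
    by (rule randomized_polytime_deterministic) (rule cover_program_correct, simp)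
qed simp

end
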